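(* Let $1<p<\infty$ and let $\omega\in\mathrm{Rat}$, say $\omega=s/q$ with $s,q$ co-prime polynomials. Let $T_\omega$ be the Toeplitz-like operator on $H^p$ with symbol $\omega$. For $\lambda\in\mathbb{C}$ define \[ \begin{aligned} k_q&=\sharp\{\text{roots of } q \text{ inside } \overline{\mathbb{D}}\}=\sharp\{\text{poles of }\lambda-\omega\text{ inside }\overline{\mathbb{D}}\},\\ k_\lambda^-&=\sharp\{\text{roots of }\lambda q-s\text{ inside }\mathbb{D}\}=\sharp\{\text{zeroes of }\lambda-\omega\text{ inside }\mathbb{D}\},\\ k_\lambda^0&=\sharp\{\text{roots of }\lambda q-s\text{ on }\mathbb{T}\}=\sharp\{\text{zeroes of }\lambda-\omega\text{ on }\mathbb{T}\}, \end{aligned} \] where in all these sets multiplicities of the roots, poles and zeroes are to be taken into account. Then the resolvent set $\rho(T_\omega)$, point spectrum $\sigma_{\mathrm p}(T_\omega)$, residual spectrum $\sigma_{\mathrm r}(T_\omega)$ and continuous spectrum $\sigma_{\mathrm c}(T_\omega)$ of $T_\omega$ are given by \[ \begin{aligned} \rho(T_\omega)&=\{\lambda\in\mathbb{C}\mid k_\lambda^0=0\text{ and }k_q=k_\lambda^-\},\\ \sigma_{\mathrm p}(T_\omega)&=\{\lambda\in\mathbb{C}\mid k_q>k_\lambda^-+k_\lambda^0\},\\ \sigma_{\mathrm r}(T_\omega)&=\{\lambda\in\mathbb{C}\mid k_q<k_\lambda^-\},\\ \sigma_{\mathrm c}(T_\omega)&=\{\lambda\in\mathbb{C}\mid k_\lambda^0>0\text{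 and }k_\lambda^-\le k_q\le k_\lambda^-+k_\lambda^0\}. \end{aligned} \] Furthermore, $\sigma_{\mathrm{ess}}(T_\omega)=\omega(\mathbb{T})=\{\lambda\in\mathbb{C}\mid k_\lambda^0>0\}$, where $\omega(\mathbb{T})=\{\omega(e^{i\theta})\mid 0\le\theta\le2\pi,\ e^{i\theta}\text{ not a pole of }\omega\}$.
   Context: $\mathbb{D}$ is the open unit disc in $\mathbb{C}$, $\overline{\mathbb{D}}$ its closure, $\mathbb{T}$ the unit circle. $\mathrm{Rat}$ is the space of rational functions with complex coefficients; $\mathrm{Rat}_0(\mathbb{T})$ is the subspace of strictly proper rational functions all of whose poles lie on $\mathbb{T}$ (including $0$). $L^p=L^p(\mathbb{T})$, $H^p$ is the Hardy space of the disc (identified via boundary values with a closed subspace of $L^p$), and $\mathbb{P}$ is the Riesz projection of $L^p$ onto $H^p$. For $\omega\in\mathrm{Rat}$, possibly with poles on $\mathbb{T}$, the (in general unbounded) operator $T_\omega$ on $H^p$ is defined by \[ \mathrm{Dom}(T_\omega)=\{g\in H^p \mid \omega g=f+\rho \text{ with } f\in L^p,\ \rho\in\mathrm{Rat}_0(\mathbb{T})\},\qquad T_\omega g=\mathbb{P}f . \] This is a densely defined closed operator, and $\lambda I_{H^p}-T_\omega=T_{\lambda-\omega}$ for $\lambda\in\mathbb{C}$. A closed operator is Fredholm if its kernel is finite dimensional and its range is closed with finite codimension. The essential spectrum $\sigma_{\mathrm{ess}}(T_\omega)$ is the set of $\lambda\in\mathbb{C}$ for which $\lambda I_{H^p}-T_\omega$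 is not Fredholm. The resolvent set $\rho(T_\omega)$ is the set of $\lambda$ for which $\lambda I-T_\omega:\mathrm{Dom}(T_\omega)\to H^p$ is bijective; the point spectrum $\sigma_{\mathrm p}(T_\omega)$ is the set of $\lambda$ for which $\lambda I-T_\omega$ is not injective; the residual spectrum $\sigma_{\mathrm r}(T_\omega)$ is the set of $\lambda$ for which $\lambda I-T_\omega$ is injective but does not have dense range; the continuous spectrum $\sigma_{\mathrm c}(T_\omega)$ is the set of $\lambda$ for which $\lambda I-T_\omega$ is injective with dense range but is not surjective.
   Formalization: The symbol ω is assumed non-constant: for ω = c the polynomial λq − s vanishes at λ = c, so its root counts are undefined, and c is in the point spectrum although k_q = 0 cannot exceed k_λ^- + k_λ^0. *)

theory Defs
  imports
    "HOL-Complex_Analysis.Complex_Analysis"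
    "HOL-Probability.Probability_Measure"
    "HOL-Computational_Algebra.Computational_Algebra"
    "HOL-Computational_Algebra.Field_as_Ring"
begin

section \<open>The unit circle and functions on it modulo null sets\<close>

text \<open>
  Normalized arc length. The underlying measurable space is the circle itself, so the values of a
  function \<open>complex \<Rightarrow> complex\<close> off the circle play no role in what follows.
\<close>

definition arc_measure :: "complex measure" where
  "arc_measure = distr (uniform_measure lborel {0..2 * pi}) (restrict_space borel (sphere 0 1)) cis"

lemma sets_arc_measure [measurable_cong]:
  "sets arc_measure = sets (restrict_space borel (sphere 0 1))"
  by (simp add: arc_measure_def)

lemma space_arc_measure: "space arc_measure = sphere 0 1"
  by (simp add: arc_measure_def space_restrict_space)

interpretation arc_measure: prob_space arc_measure
proof -
  interpret U: prob_space "uniform_measure lborel {0..2 * pi}"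
    by (rule prob_space_uniform_measure) auto
  have "cis \<in> borel_measurable borel"
    by (intro borel_measurable_continuous_onI continuous_intros)
  then show "prob_space arc_measure"
    unfolding arc_measure_def
    by (intro U.prob_space_distr measurable_restrict_space2) auto
qed

definition ae_eq :: "(complex \<Rightarrow> complex) \<Rightarrow> (complex \<Rightarrow> complex) \<Rightarrow> bool" where
  "ae_eq f g \<longleftrightarrow> f \<in> borel_measurable arc_measure \<and> g \<in> borel_measurable arc_measure
     \<and> (AE z in arc_measure. f z = g z)"

quotient_type circ_fun = "complex \<Rightarrow> complex" / partial: ae_eq
proof (rule part_equivpI)
  show "\<exists>f. ae_eq f f" by (rule exI[of _ "\<lambda>_. 0"]) (simp add: ae_eq_def)
  show "symp ae_eq" by (auto simp: symp_def ae_eq_def elim: eventually_mono)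
  show "transp ae_eq" by (auto simp: transp_def ae_eq_def)
qed

instantiation circ_fun :: comm_ring
begin

lift_definition zero_circ_fun :: circ_fun is "\<lambda>_. 0"
  by (simp add: ae_eq_def)

lift_definition plus_circ_fun :: "circ_fun \<Rightarrow> circ_fun \<Rightarrow> circ_fun" is "\<lambda>f g z. f z + g z"
  by (auto simp: ae_eq_def)

lift_definition minus_circ_fun :: "circ_fun \<Rightarrow> circ_fun \<Rightarrow> circ_fun" is "\<lambda>f g z. f z - g z"
  by (auto simp: ae_eq_def)

lift_definition uminus_circ_fun :: "circ_fun \<Rightarrow> circ_fun" is "\<lambda>f z. - f z"
  by (auto simp: ae_eq_def)

lift_definition times_circ_fun :: "circ_fun \<Rightarrow> circ_fun \<Rightarrow> circ_fun" is "\<lambda>f g z. f z * g z"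
  by (auto simp: ae_eq_def)

instance
  by standard (transfer; simp add: ae_eq_def algebra_simps)+

end

lift_definition scale_circ :: "complex \<Rightarrow> circ_fun \<Rightarrow> circ_fun" is "\<lambda>c f z. c * f z"
  by (auto simp: ae_eq_def)

global_interpretation circ: vector_space scale_circ
  defines circ_span = circ.span
  by unfold_locales (transfer; simp add: ae_eq_def algebra_simps)+


section \<open>The spaces \<open>L\<^sup>p\<close> and \<open>H\<^sup>p\<close> and the Riesz projection\<close>

lift_definition p_integrable :: "real \<Rightarrow> circ_fun \<Rightarrow> bool" is
  "\<lambda>p f. integrable arc_measure (\<lambda>z. norm (f z) powr p)"
  by (intro integrable_cong_AE) (auto simp: ae_eq_def)

lift_definition Lp_norm :: "real \<Rightarrow> circ_fun \<Rightarrow> real" is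
  "\<lambda>p f. (\<integral>z. norm (f z) powr p \<partial>arc_measure) powr (1 / p)"
  by (intro arg_cong2[where f = "(powr)"] integral_cong_AE refl) (auto simp: ae_eq_def)

definition Lp :: "real \<Rightarrow> circ_fun set" where
  "Lp p = {f. p_integrable p f}"

lemma measurable_powi_arc [measurable]: "(\<lambda>z. z powi n) \<in> borel_measurable arc_measure"
proof -
  have "(\<lambda>z::complex. z powi n) \<in> borel_measurable (restrict_space borel (sphere 0 1))"
    by (intro borel_measurable_continuous_on_restrict continuous_intros) auto
  then show ?thesis
    by (simp cong: measurable_cong_sets add: sets_arc_measure)
qed

lift_definition fourier_coeff :: "circ_fun \<Rightarrow> int \<Rightarrow> complex" is
  "\<lambda>f n. \<integral>z. f z * z powi (- n) \<partial>arc_measure"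
  by (intro ext integral_cong_AE) (auto simp: ae_eq_def)

definition hardy_disc :: "real \<Rightarrow> (complex \<Rightarrow> complex) set" where
  "hardy_disc p = {F. F holomorphic_on ball 0 1 \<and>
     (\<exists>C. \<forall>r\<in>{0..<1}. (\<integral>z. norm (F (of_real r * z)) powr p \<partial>arc_measure) \<le> C)}"

lift_definition boundary_value :: "(complex \<Rightarrow> complex) \<Rightarrow> circ_fun \<Rightarrow> bool" is
  "\<lambda>F f. AE z in arc_measure. ((\<lambda>r. F (of_real r * z)) \<longlongrightarrow> f z) (at_left (1::real))"
  by (auto simp: ae_eq_def elim!: eventually_elim2)

definition Hp :: "real \<Rightarrow> circ_fun set" where
  "Hp p = {f \<in> Lp p. \<exists>F \<in> hardy_disc p. boundary_value F f}"

text \<open>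
  The projection of \<open>L\<^sup>p\<close> onto \<open>H\<^sup>p\<close> that removes the Fourier coefficients with negative index.
  It is defined on all of \<open>L\<^sup>p\<close> for \<open>1 < p < \<infinity>\<close>, by the theorem of M. Riesz; \<open>h\<close> is unique because
  the coefficients with negative index of a member of \<open>H\<^sup>p\<close> vanish.
\<close>

definition riesz_proj :: "real \<Rightarrow> circ_fun \<Rightarrow> circ_fun" where
  "riesz_proj p f = (THE h. h \<in> Hp p \<and> (\<forall>n\<ge>0. fourier_coeff h n = fourier_coeff f n))"


lemma powr_add_convex:
  fixes a b A B p :: real
  assumes "a \<ge> 0" "b \<ge> 0" "A > 0" "B > 0" "p \<ge> 1"
  shows "(a + b) powr p \<le> (A + B) powr p * (A / (A + B) * (a / A) powr p + B / (A + B) * (b / B) powr p)"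
proof -
  have conv: "(t * x + (1 - t) * y) powr p \<le> t * x powr p + (1 - t) * y powr p"
    if xyt: "x \<ge> 0" "y \<ge> 0" "t > 0" "t < 1" for x y t :: real
  proof -
    have small: "t powr p \<le> t" if "t > 0" "t < 1" for t :: real
      using that powr_mono'[of 1 p t] assms(5) by simp
    consider "x = 0" | "y = 0" | "x > 0" "y > 0"
      using xyt by (auto simp: order_le_less)
    then show ?thesis
    proof cases
      case 1
      then show ?thesis
        using xyt small[of "1 - t"] by (simp add: powr_mult mult_right_mono)
    next
      case 2
      then show ?thesis
        using xyt small[of t] by (simp add: powr_mult mult_right_mono)
    next
      case 3
      then show ?thesis
        using convex_onD[OF powr_convex[OF assms(5)], of "1 - t" x y] xyt by simp
    qed
  qed
  define t where "t = A / (A + B)"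
  have t: "t > 0" "t < 1" "1 - t = B / (A + B)"
    using assms by (auto simp: t_def field_simps)
  have "a + b = (A + B) * (t * (a / A) + (1 - t) * (b / B))"
    using assms t(3) by (simp add: t_def distrib_left)
  then have "(a + b) powr p = (A + B) powr p * (t * (a / A) + (1 - t) * (b / B)) powr p"
    using assms t by (simp add: powr_mult)
  also have "\<dots> \<le> (A + B) powr p * (t * (a / A) powr p + (1 - t) * (b / B) powr p)"
    using assms t conv[of "a / A" "b / B" t] by (intro mult_left_mono) auto
  finally show ?thesis
    using t(3) by (simp add: t_def)
qed

lemma Lp_minus:
  assumes "p \<ge> 1" "f \<in> Lp p" "g \<in> Lp p"
  shows "f - g \<in> Lp p"
  using assms unfolding Lp_def mem_Collect_eq
proof transfer
  fix p :: real and f g :: "complex \<Rightarrow> complex"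
  assume "ae_eq f f" "ae_eq g g" and p: "p \<ge> 1"
    and I [measurable]: "integrable arc_measure (\<lambda>z. norm (f z) powr p)"
      "integrable arc_measure (\<lambda>z. norm (g z) powr p)"
  then have [measurable]: "f \<in> borel_measurable arc_measure" "g \<in> borel_measurable arc_measure"
    by (auto simp: ae_eq_def)
  show "integrable arc_measure (\<lambda>z. norm (f z - g z) powr p)"
  proof (rule Bochner_Integration.integrable_bound)
    show "integrable arc_measure
        (\<lambda>z. 2 powr p * (1 / 2 * norm (f z) powr p + 1 / 2 * norm (g z) powr p))"
      using I by auto
    show "AE z in arc_measure. norm (norm (f z - g z) powr p)
        \<le> norm (2 powr p * (1 / 2 * norm (f z) powr p + 1 / 2 * norm (g z) powr p))"
    proof (rule AE_I2)
      fix z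
      have "norm (f z - g z) powr p \<le> (norm (f z) + norm (g z)) powr p"
        using p by (intro powr_mono2 norm_triangle_ineq4) auto
      also have "\<dots> \<le> 2 powr p * (1 / 2 * norm (f z) powr p + 1 / 2 * norm (g z) powr p)"
        using powr_add_convex[of "norm (f z)" "norm (g z)" 1 1 p] p by simp
      finally show "norm (norm (f z - g z) powr p)
        \<le> norm (2 powr p * (1 / 2 * norm (f z) powr p + 1 / 2 * norm (g z) powr p))"
        by simp
    qed
  qed simp
qed

lemma Lp_norm_eq_0:
  assumes "p \<ge> 1" "f \<in> Lp p"
  shows "Lp_norm p f = 0 \<longleftrightarrow> f = 0"
  using assms unfolding Lp_def mem_Collect_eq
proof transfer
  fix p :: real and f :: "complex \<Rightarrow> complex"
  assume "ae_eq f f" and p: "p \<ge> 1" and I: "integrable arc_measure (\<lambda>z. norm (f z) powr p)"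
  have "(\<integral>z. norm (f z) powr p \<partial>arc_measure) = 0 \<longleftrightarrow> (AE z in arc_measure. norm (f z) powr p = 0)"
    by (rule integral_nonneg_eq_0_iff_AE[OF I]) auto
  then show "((\<integral>z. norm (f z) powr p \<partial>arc_measure) powr (1 / p) = 0) = ae_eq f (\<lambda>_. 0)"
    using \<open>ae_eq f f\<close> p by (simp add: ae_eq_def)
qed

lemma Lp_norm_minus_commute: "Lp_norm p (f - g) = Lp_norm p (g - f)"
  by transfer (simp add: norm_minus_commute)

lemma Lp_norm_minus_self [simp]: "Lp_norm p (0 - f) = Lp_norm p f"
  by transfer simp

lemma Lp_norm_nonneg [simp]: "Lp_norm p f \<ge> 0"
  by transfer simp

lemma Lp_norm_triangle:
  assumes "p \<ge> 1" "f \<in> Lp p" "g \<in> Lp p"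
  shows "Lp_norm p (f + g) \<le> Lp_norm p f + Lp_norm p g"
proof (cases "f = 0 \<or> g = 0")
  case True
  then show ?thesis by auto
next
  case False
  define A B where "A = Lp_norm p f" and "B = Lp_norm p g"
  have AB: "A > 0" "B > 0"
    using False assms Lp_norm_eq_0[of p] by (simp_all add: A_def B_def order.strict_iff_order)
  have N: "Lp_norm p f = A" "Lp_norm p g = B"
    by (simp_all add: A_def B_def)
  have "p_integrable p f" "p_integrable p g"
    using assms by (simp_all add: Lp_def)
  then have "Lp_norm p (f + g) \<le> A + B"
    using N AB assms(1)
  proof (transfer fixing: A B p)
    fix f g :: "complex \<Rightarrow> complex"
    assume "ae_eq f f" "ae_eq g g" and AB: "A > 0" "B > 0" and p: "p \<ge> 1"
      and I: "integrable arc_measure (\<lambda>z. norm (f z) powr p)"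
        "integrable arc_measure (\<lambda>z. norm (g z) powr p)"
      and A: "(\<integral>z. norm (f z) powr p \<partial>arc_measure) powr (1 / p) = A"
      and B: "(\<integral>z. norm (g z) powr p \<partial>arc_measure) powr (1 / p) = B"
    then have [measurable]: "f \<in> borel_measurable arc_measure" "g \<in> borel_measurable arc_measure"
      by (auto simp: ae_eq_def)
    have root: "(\<integral>z. norm (h z) powr p \<partial>arc_measure) = C powr p"
      if "(\<integral>z. norm (h z) powr p \<partial>arc_measure) powr (1 / p) = C" for h :: "complex \<Rightarrow> complex" and C
      using p that by (auto simp: powr_powr)
    let ?R = "\<lambda>z. (A + B) powr p * (A / (A + B) * (norm (f z) / A) powr p + B / (A + B) * (norm (g z) / B) powr p)"
    have IR: "integrable arc_measure ?R"
      using I AB by (auto simp: powr_divide)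
    have "(\<integral>z. norm (f z + g z) powr p \<partial>arc_measure) \<le> (\<integral>z. ?R z \<partial>arc_measure)"
    proof (rule integral_mono')
      fix z
      have "norm (f z + g z) powr p \<le> (norm (f z) + norm (g z)) powr p"
        using p by (intro powr_mono2 norm_triangle_ineq) auto
      also have "\<dots> \<le> ?R z"
        using AB p by (intro powr_add_convex) auto
      finally show "norm (f z + g z) powr p \<le> ?R z" .
    next
      show "0 \<le> ?R z" for z
        using AB by (intro mult_nonneg_nonneg add_nonneg_nonneg) auto
    qed (rule IR)
    also have "\<dots> = (A + B) powr p * (A / (A + B) * ((\<integral>z. norm (f z) powr p \<partial>arc_measure) / A powr p)
        + B / (A + B) * ((\<integral>z. norm (g z) powr p \<partial>arc_measure) / B powr p))"
      using I AB by (simp add: powr_divide)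
    also have "\<dots> = (A + B) powr p * (A / (A + B) + B / (A + B))"
      using AB root[OF A] root[OF B] by simp
    also have "\<dots> = (A + B) powr p"
      using AB by (simp add: add_divide_distrib[symmetric])
    finally have "(\<integral>z. norm (f z + g z) powr p \<partial>arc_measure) powr (1 / p) \<le> ((A + B) powr p) powr (1 / p)"
      using p by (intro powr_mono2) auto
    then show "(\<integral>z. norm (f z + g z) powr p \<partial>arc_measure) powr (1 / p) \<le> A + B"
      using AB p by (simp add: powr_powr)
  qed
  then show ?thesis
    by (simp add: N)
qed

lemma Metric_space_Hp:
  assumes "p \<ge> 1"
  shows "Metric_space (Hp p) (\<lambda>f g. Lp_norm p (f - g))"
proof
  fix f g h
  assume "f \<in> Hp p" "g \<in> Hp p"
  then have fg: "f \<in> Lp p" "g \<in> Lp p" by (auto simp: Hp_def)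
  then show "Lp_norm p (f - g) = 0 \<longleftrightarrow> f = g"
    using Lp_norm_eq_0[OF assms Lp_minus[OF assms fg]] by simp
  assume "h \<in> Hp p"
  then have "h \<in> Lp p" by (auto simp: Hp_def)
  then show "Lp_norm p (f - h) \<le> Lp_norm p (f - g) + Lp_norm p (g - h)"
    using Lp_norm_triangle[OF assms Lp_minus[OF assms fg] Lp_minus[OF assms fg(2)], of h] by simp
qed (auto simp: Lp_norm_minus_commute)

definition Hp_topology :: "real \<Rightarrow> circ_fun topology" where
  "Hp_topology p = Metric_space.mtopology (Hp p) (\<lambda>f g. Lp_norm p (f - g))"


section \<open>Spectral notions for operators in \<open>H\<^sup>p\<close>\<close>

text \<open>
  An unbounded operator in \<open>H\<^sup>p\<close> is given by its domain \<open>D\<close> and a map \<open>T\<close> of which only the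
  restriction to \<open>D\<close> is relevant.
\<close>

definition resolvent_map :: "complex \<Rightarrow> (circ_fun \<Rightarrow> circ_fun) \<Rightarrow> circ_fun \<Rightarrow> circ_fun" where
  "resolvent_map l T g = scale_circ l g - T g"

text \<open>Meant for closed operators only; closedness of \<open>T\<close> itself is not part of the definition.\<close>

definition fredholm :: "real \<Rightarrow> circ_fun set \<Rightarrow> (circ_fun \<Rightarrow> circ_fun) \<Rightarrow> bool" where
  "fredholm p D T \<longleftrightarrow>
     (\<exists>B. finite B \<and> {g \<in> D. T g = 0} = circ_span B) \<and>
     closedin (Hp_topology p) (T ` D) \<and>
     (\<exists>B. finite B \<and> B \<subseteq> Hp p \<and> Hp p = circ_span (T ` D \<union> B))"

definition dense_range :: "real \<Rightarrow> circ_fun set \<Rightarrow> (circ_fun \<Rightarrow> circ_fun) \<Rightarrow> bool" where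
  "dense_range p D T \<longleftrightarrow> Hp_topology p closure_of (T ` D) = Hp p"

definition resolvent_set :: "real \<Rightarrow> circ_fun set \<Rightarrow> (circ_fun \<Rightarrow> circ_fun) \<Rightarrow> complex set" where
  "resolvent_set p D T = {l. bij_betw (resolvent_map l T) D (Hp p)}"

definition point_spectrum :: "circ_fun set \<Rightarrow> (circ_fun \<Rightarrow> circ_fun) \<Rightarrow> complex set" where
  "point_spectrum D T = {l. \<not> inj_on (resolvent_map l T) D}"

definition residual_spectrum :: "real \<Rightarrow> circ_fun set \<Rightarrow> (circ_fun \<Rightarrow> circ_fun) \<Rightarrow> complex set" where
  "residual_spectrum p D T =
     {l. inj_on (resolvent_map l T) D \<and> \<not> dense_range p D (resolvent_map l T)}"

definition continuous_spectrum :: "real \<Rightarrow> circ_fun set \<Rightarrow> (circ_fun \<Rightarrow> circ_fun) \<Rightarrow> complex set" where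
  "continuous_spectrum p D T =
     {l. inj_on (resolvent_map l T) D \<and> dense_range p D (resolvent_map l T)
        \<and> resolvent_map l T ` D \<noteq> Hp p}"

definition essential_spectrum :: "real \<Rightarrow> circ_fun set \<Rightarrow> (circ_fun \<Rightarrow> circ_fun) \<Rightarrow> complex set" where
  "essential_spectrum p D T = {l. \<not> fredholm p D (resolvent_map l T)}"


section \<open>Rational functions\<close>

type_synonym rat_fun = "complex poly fract"

text \<open>Numerator and denominator in lowest terms; the denominator is monic.\<close>

definition rat_num :: "rat_fun \<Rightarrow> complex poly" where
  "rat_num \<omega> = fst (quot_of_fract \<omega>)"

definition rat_den :: "rat_fun \<Rightarrow> complex poly" where
  "rat_den \<omega> = snd (quot_of_fract \<omega>)"

definition rat_const :: "complex \<Rightarrow> rat_fun" where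
  "rat_const c = Fract [:c:] 1"

text \<open>The value at a pole is the irrelevant \<open>x / 0 = 0\<close>.\<close>

definition rat_eval :: "rat_fun \<Rightarrow> complex \<Rightarrow> complex" where
  "rat_eval \<omega> z = poly (rat_num \<omega>) z / poly (rat_den \<omega>) z"

definition rat_poles :: "rat_fun \<Rightarrow> complex set" where
  "rat_poles \<omega> = {z. poly (rat_den \<omega>) z = 0}"

definition count_roots :: "complex set \<Rightarrow> complex poly \<Rightarrow> nat" where
  "count_roots S f = size {# z \<in># proots f. z \<in> S #}"

definition count_zeros :: "complex set \<Rightarrow> rat_fun \<Rightarrow> nat" where
  "count_zeros S \<omega> = count_roots S (rat_num \<omega>)"

definition count_poles :: "complex set \<Rightarrow> rat_fun \<Rightarrow> nat" where
  "count_poles S \<omega> = count_roots S (rat_den \<omega>)"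

definition Rat0_circle :: "rat_fun set" where
  "Rat0_circle = {\<rho>. (\<rho> = 0 \<or> degree (rat_num \<rho>) < degree (rat_den \<rho>)) \<and> rat_poles \<rho> \<subseteq> sphere 0 1}"

definition rat_image_circle :: "rat_fun \<Rightarrow> complex set" where
  "rat_image_circle \<omega> = {rat_eval \<omega> (cis \<theta>) | \<theta>. 0 \<le> \<theta> \<and> \<theta> \<le> 2 * pi \<and> cis \<theta> \<notin> rat_poles \<omega>}"

lift_definition rat_circ :: "rat_fun \<Rightarrow> circ_fun" is rat_eval
proof -
  fix \<omega> :: rat_fun
  have [measurable]: "poly f \<in> borel_measurable arc_measure" for f :: "complex poly"
  proof -
    have "poly f \<in> borel_measurable (restrict_space borel (sphere 0 1))"
      by (intro borel_measurable_continuous_on_restrict continuous_intros)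
    then show ?thesis
      by (simp cong: measurable_cong_sets add: sets_arc_measure)
  qed
  have "rat_eval \<omega> \<in> borel_measurable arc_measure"
    unfolding rat_eval_def[abs_def] by measurable
  then show "ae_eq (rat_eval \<omega>) (rat_eval \<omega>)"
    by (simp add: ae_eq_def)
qed


section \<open>The Toeplitz-like operator\<close>

definition toeplitz_dom :: "real \<Rightarrow> rat_fun \<Rightarrow> circ_fun set" where
  "toeplitz_dom p \<omega> =
     {g \<in> Hp p. \<exists>f \<in> Lp p. \<exists>\<rho> \<in> Rat0_circle. rat_circ \<omega> * g = f + rat_circ \<rho>}"

text \<open>
  The function \<open>f\<close> below is unique, because \<open>0\<close> is the only member of
  \<^const>\<open>Rat0_circle\<close> that lies in \<open>L\<^sup>p\<close>.
\<close>

definition toeplitz :: "real \<Rightarrow> rat_fun \<Rightarrow> circ_fun \<Rightarrow> circ_fun" where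
  "toeplitz p \<omega> g =
     riesz_proj p (THE f. f \<in> Lp p \<and> (\<exists>\<rho> \<in> Rat0_circle. rat_circ \<omega> * g = f + rat_circ \<rho>))"

end

theory Submission
  imports Defs
begin

text \<open>
  Write \<open>q = Q q\<^sub>1\<close> and \<open>\<lambda> q - s = S t\<^sub>1\<close>, where \<open>Q\<close> and \<open>S\<close> are monic and carry the roots in the
  closed disc. The operator \<open>\<lambda> - T\<^sub>\<omega>\<close> maps \<open>g\<close> to \<open>h\<close> if and only if \<open>S u = Q h + r\<close> for some
  polynomial \<open>r\<close> of degree less than \<open>k\<^sub>q\<close>, where \<open>u = (t\<^sub>1 / q\<^sub>1) g\<close>. Kernel and range can thus be read
  off from division with remainder in \<open>H\<^sup>p\<close>. Roots of \<open>S\<close> in the open disc impose finitely many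
  continuous linear conditions on the range. For a root \<open>a\<close> on the circle, \<open>(z - a) H\<^sup>p\<close> is dense in
  \<open>H\<^sup>p\<close> but \<open>(z - a) H\<^sup>p + \<complex>\<close> is not all of \<open>H\<^sup>p\<close>, so that the range is not closed.

  Neither the boundedness of the Riesz projection nor the existence of radial limits is needed: the
  functions that have to be projected are sums of a member of \<open>H\<^sup>p\<close> and a rational function with poles
  in the disc, and the boundary values that occur come with a holomorphic extension. The one
  substantial analytic step is that \<open>(z - a) w \<in> H\<^sup>p\<close> and \<open>w \<in> L\<^sup>p\<close> imply \<open>w \<in> H\<^sup>p\<close> for \<open>\<bar>a\<bar> = 1\<close>. There
  the Fourier coefficients of \<open>w\<close> with negative index satisfy \<open>w\<^sub>n\<^sub>-\<^sub>1 = a w\<^sub>n\<close>, hence vanish because the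
  averages of \<open>(z / a)\<^sup>n\<close> tend to \<open>0\<close>, and the means of the extension are bounded by Jensen's
  inequality for the Poisson kernel.
\<close>

section \<open>Normalized arc length\<close>

text \<open>For each l the five spectral sets are Boolean combinations of injectivity, surjectivity,
  density of the range and the Fredholm property, all read off from S u = Q h + r. With h = 0 the
  function u is a polynomial and r a multiple of S, so a nonzero u exists exactly if k_q exceeds the
  degree of S. For the range, the k_q free coefficients of r compete with the conditions at the disc
  roots of S; as Q is invertible modulo S by coprimality, these are genuine conditions on h. At a
  circle root r contributes no more than a constant modulo z - a, so no choice of r can restore
  surjectivity.

  The obstacle is that members of H^p are classes modulo null sets, without point values. In the
  disc the Cauchy integral serves as evaluation. On the circle nothing does, and divisibility by z -
  a is derived from the fact that 1 / (z - a) is not integrable. Rational functions act on the ring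
  of all classes of measurable functions, where each nonzero one is invertible; the algebra can
  therefore be done with fractions, and only integrability and analyticity remain to be
  checked.\<close>

lemma measurable_arc_continuous:
  "continuous_on (sphere 0 1) f \<Longrightarrow> f \<in> borel_measurable arc_measure"
  by (simp cong: measurable_cong_sets add: sets_arc_measure borel_measurable_continuous_on_restrict)

lemma AE_arc_norm: "AE z in arc_measure. norm z = 1"
  by (rule AE_I2) (simp add: space_arc_measure)

lemma measurable_cis_circle:
  "cis \<in> measurable (uniform_measure lborel {0..2 * pi}) (restrict_space borel (sphere 0 1))"
proof -
  have "cis \<in> borel_measurable borel"
    by (intro borel_measurable_continuous_onI continuous_intros)
  then show ?thesis by (intro measurable_restrict_space2) auto
qed

text \<open>A fibre of \<open>cis\<close> lies in a translate of the multiples of 2 pi and is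
  therefore countable. Since points are null, poles and zeros on the circle do not disturb
  identities between classes.\<close>

lemma AE_arc_neq: "AE z in arc_measure. z \<noteq> a"
proof -
  have sub: "{t. cis t = a} \<subseteq> range (\<lambda>n::int. (SOME s. cis s = a) + 2 * pi * of_int n)"
  proof
    fix t assume "t \<in> {t. cis t = a}"
    then have t: "cis t = a" by simp
    define s where "s = (SOME s. cis s = a)"
    have s: "cis s = a" unfolding s_def using t by (rule someI)
    have "cis (t - s) = 1"
      using t s by (simp add: cis_divide [symmetric]) (metis cis_neq_zero)
    then have "cos (t - s) = 1" by (metis cis.simps(1) one_complex.simps(1))
    then obtain n :: int where "t - s = of_int n * 2 * pi" by (auto simp: cos_one_2pi_int)
    then have "t = s + 2 * pi * of_int n" by (simp add: algebra_simps)
    then show "t \<in> range (\<lambda>n::int. (SOME s. cis s = a) + 2 * pi * of_int n)"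
      unfolding s_def by blast
  qed
  have "countable {t. cis t = a}"
    by (rule countable_subset[OF sub]) auto
  then have "AE t in lborel. t \<notin> {t. cis t = a}"
    by (intro AE_not_in countable_imp_null_set_lborel)
  then have "AE t in uniform_measure lborel {0..2 * pi}. cis t \<noteq> a"
    by (intro AE_uniform_measureI) auto
  then show ?thesis
    unfolding arc_measure_def
    by (subst AE_distr_iff[OF measurable_cis_circle]) (auto simp: sets_restrict_space space_restrict_space)
qed

lemma AE_arc_notin: "finite A \<Longrightarrow> AE z in arc_measure. z \<notin> A"
  using AE_finite_allI[where S = A and M = arc_measure and Q = "\<lambda>a z. z \<noteq> a"] AE_arc_neq
  by (auto elim: eventually_mono)

lemma integral_arc:
  fixes f :: "complex \<Rightarrow> complex"
  assumes "continuous_on (sphere 0 1) f"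
  shows "(\<integral>z. f z \<partial>arc_measure) = (LBINT t:{0..2*pi}. f (cis t)) / (2 * pi)"
proof -
  have fm: "f \<in> borel_measurable (restrict_space borel (sphere 0 1))"
    using assms by (rule borel_measurable_continuous_on_restrict)
  have cont: "continuous_on UNIV (\<lambda>t. f (cis t))"
    by (rule continuous_on_compose2[OF assms]) (auto intro!: continuous_intros)
  have "(\<integral>z. f z \<partial>arc_measure) = (\<integral>t. f (cis t) \<partial>uniform_measure lborel {0..2*pi})"
    unfolding arc_measure_def by (rule integral_distr[OF measurable_cis_circle fm])
  also have "\<dots> = (\<integral>t. (indicator {0..2*pi} t / (2 * pi)) *\<^sub>R f (cis t) \<partial>lborel)"
  proof -
    have "uniform_measure lborel {0..2*pi} = density lborel (\<lambda>t. ennreal (indicator {0..2*pi} t / (2*pi)))"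
      unfolding uniform_measure_def
      by (intro density_cong) (auto intro!: AE_I2 simp: divide_ennreal split: split_indicator simp flip: ennreal_1)
    then show ?thesis
      by (simp add: integral_density borel_measurable_continuous_onI[OF cont])
  qed
  also have "\<dots> = (\<integral>t. (1 / (2*pi)) *\<^sub>R (indicator {0..2*pi} t *\<^sub>R f (cis t)) \<partial>lborel)"
    by (intro Bochner_Integration.integral_cong) auto
  also have "\<dots> = (1 / (2*pi)) *\<^sub>R (LBINT t:{0..2*pi}. f (cis t))"
    unfolding set_lebesgue_integral_def by (rule integral_scaleR_right)
  finally show ?thesis by (simp add: scaleR_conv_of_real)
qed

lemma integral_arc_powi: "(\<integral>z. z powi n \<partial>arc_measure) = (if n = 0 then 1 else 0)"
proof (cases "n = 0")
  case True
  then show ?thesis by (simp add: arc_measure.prob_space)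
next
  case False
  have "continuous_on (sphere 0 (1::real)) (\<lambda>z::complex. z powi n)"
    by (intro continuous_intros) auto
  then have 1: "(\<integral>z. z powi n \<partial>arc_measure) = (LBINT t:{0..2*pi}. cis t powi n) / (2 * pi)"
    by (rule integral_arc)
  have deriv: "((\<lambda>t. cis (of_int n * t) / (\<i> * of_int n)) has_vector_derivative (cis t powi n)) (at t within A)" for t A
  proof -
    have "((\<lambda>t. exp (\<i> * of_real (of_int n * t)) / (\<i> * of_int n)) has_vector_derivative exp (\<i> * of_real (of_int n * t))) (at t within A)"
      using False by (auto intro!: derivative_eq_intros has_vector_derivative_real_field simp: mult_ac)
    then show ?thesis by (simp only: cis_power_int) (simp add: cis_conv_exp mult_ac)
  qed
  have "(\<integral>t. indicator {0..2*pi} t *\<^sub>R (cis t powi n) \<partial>lborel)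
      = cis (of_int n * (2*pi)) / (\<i> * of_int n) - cis (of_int n * 0) / (\<i> * of_int n)"
    by (rule integral_FTC_Icc[where F = "\<lambda>t. cis (of_int n * t) / (\<i> * of_int n)"])
       (auto intro!: deriv continuous_intros)
  also have "cis (of_int n * (2*pi)) = 1"
    by (metis cis_multiple_2pi Ints_of_int mult.commute)
  finally show ?thesis using 1 False by (simp add: set_lebesgue_integral_def)
qed


section \<open>Jensen's inequality for powers\<close>

lemma powr_ge_tangent:
  fixes t c p :: real
  assumes "p \<ge> 1" "c \<ge> 0" "t \<ge> 0"
  shows "t powr p \<ge> c powr p + p * c powr (p - 1) * (t - c)"
proof -
  \<comment> \<open>At c = 0 the convention \<open>0 powr x = 0\<close> makes the right-hand side 0,
    even for p = 1, so the tangent argument is needed only for positive c.\<close>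
  consider "c = 0" | "c > 0" "t = 0" | "c > 0" "t > 0"
    using assms by fastforce
  then show ?thesis
  proof cases
    case 2
    have "c powr p = c powr (p - 1) * c"
      using 2 by (simp add: powr_diff)
    then show ?thesis
      using 2 assms mult_right_mono[of 1 p "c powr (p - 1) * c"] by (simp add: algebra_simps)
  next
    case 3
    have "convex_on {0<..} (\<lambda>x::real. x powr p)"
      by (rule convex_on_subset[OF powr_convex]) (use assms in auto)
    from convex_on_imp_above_tangent[OF this, of c t "p * c powr (p - 1)"] 3
      has_field_derivative_at_within[OF has_real_derivative_powr[of c p], of "{0<..}"]
    show ?thesis
      by (auto simp: interior_open)
  qed auto
qed

text \<open>The tangent line of the power function at the weighted mean c is integrated against the
  probability density K. It is applied with the Poisson kernel for K, and with K = 1 to compare the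
  mean of a function with its L^p norm.\<close>

lemma jensen_powr_weighted:
  fixes t K :: "'a \<Rightarrow> real" and p :: real
  assumes p: "p \<ge> 1" and t: "\<And>x. t x \<ge> 0" and K: "\<And>x. x \<in> space M \<Longrightarrow> K x \<ge> 0"
    and int: "integrable M K" "integrable M (\<lambda>x. t x * K x)" "integrable M (\<lambda>x. t x powr p * K x)"
    and one: "(\<integral>x. K x \<partial>M) = 1"
  shows "(\<integral>x. t x * K x \<partial>M) powr p \<le> (\<integral>x. t x powr p * K x \<partial>M)"
proof -
  define c where "c = (\<integral>x. t x * K x \<partial>M)"
  have c: "c \<ge> 0" unfolding c_def using t K by (intro Bochner_Integration.integral_nonneg) auto
  define d where "d = p * c powr (p - 1)"
  have "c powr p = (\<integral>x. c powr p * K x + d * (t x * K x) - d * c * K x \<partial>M)"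
    using int one by (simp add: c_def)
  also have "\<dots> \<le> (\<integral>x. t x powr p * K x \<partial>M)"
  proof (rule integral_mono)
    fix x assume x: "x \<in> space M"
    have "(c powr p + d * (t x - c)) * K x \<le> t x powr p * K x"
      using powr_ge_tangent[OF p c t] K[OF x] by (intro mult_right_mono) (auto simp: d_def)
    then show "c powr p * K x + d * (t x * K x) - d * c * K x \<le> t x powr p * K x"
      by (simp add: algebra_simps)
  qed (use int in auto)
  finally show ?thesis by (simp add: c_def)
qed

section \<open>Integrability and moments on the circle\<close>

lemma le_one_plus_powr:
  fixes t p :: real
  assumes "p \<ge> 1" "t \<ge> 0"
  shows "t \<le> 1 + t powr p"
proof (cases "t \<le> 1")
  case False
  then have "t powr 1 \<le> t powr p" using assms by (intro powr_mono) auto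
  then show ?thesis using False by simp
qed (auto intro: order_trans)

lemma integrable_arc_of_powr:
  fixes f :: "complex \<Rightarrow> complex"
  assumes [measurable]: "f \<in> borel_measurable arc_measure"
    and "integrable arc_measure (\<lambda>z. norm (f z) powr p)" "p \<ge> 1"
  shows "integrable arc_measure f"
proof (rule Bochner_Integration.integrable_bound)
  show "integrable arc_measure (\<lambda>z. 1 + norm (f z) powr p)" using assms by auto
  show "AE z in arc_measure. norm (f z) \<le> norm (1 + norm (f z) powr p)"
    using le_one_plus_powr[OF \<open>p \<ge> 1\<close>] by (intro AE_I2) (simp add: add_nonneg_nonneg)
qed simp

lemma integrable_arc_mult_bounded:
  fixes f g :: "complex \<Rightarrow> complex"
  assumes "integrable arc_measure f" and [measurable]: "g \<in> borel_measurable arc_measure"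
    and "\<And>z. norm z = 1 \<Longrightarrow> norm (g z) \<le> B"
  shows "integrable arc_measure (\<lambda>z. f z * g z)"
proof (rule Bochner_Integration.integrable_bound)
  have [measurable]: "f \<in> borel_measurable arc_measure" using assms(1) by auto
  show "integrable arc_measure (\<lambda>z. B * norm (f z))" using assms by auto
  show "AE z in arc_measure. norm (f z * g z) \<le> norm (B * norm (f z))"
    using assms(3) by (intro AE_I2) (auto simp: space_arc_measure norm_mult mult.commute[of B] abs_mult
        intro!: mult_left_mono order_trans[OF _ abs_ge_self])
  show "(\<lambda>z. f z * g z) \<in> borel_measurable arc_measure" by measurable
qed

lemma integrable_arc_bounded:
  fixes g :: "complex \<Rightarrow> complex"
  assumes "g \<in> borel_measurable arc_measure" "\<And>z. norm z = 1 \<Longrightarrow> norm (g z) \<le> B"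
  shows "integrable arc_measure g"
  using integrable_arc_mult_bounded[of "\<lambda>_. 1" g B] assms by simp

text \<open>Domination by \<open>norm c ^ n * norm (f z)\<close> allows termwise integration of the
  geometric series. With u = cnj this expands a Cauchy integral in the Fourier coefficients of index
  \<ge> 0, with u the identity in those of index \<le> 0.\<close>

lemma integral_arc_geometric:
  fixes f u :: "complex \<Rightarrow> complex"
  assumes f: "integrable arc_measure f" and u [measurable]: "u \<in> borel_measurable arc_measure"
    and u1: "\<And>z. norm z = 1 \<Longrightarrow> norm (u z) \<le> 1" and c: "norm c < 1"
  shows "(\<lambda>n. c ^ n * (\<integral>z. f z * u z ^ n \<partial>arc_measure)) sums (\<integral>z. f z / (1 - c * u z) \<partial>arc_measure)"
proof -
  have [measurable]: "f \<in> borel_measurable arc_measure" using f by auto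
  have cu: "norm (c * u z) < 1" if "norm z = 1" for z
    using mult_left_mono[OF u1[OF that], of "norm c"] c by (simp add: norm_mult)
  have int: "integrable arc_measure (\<lambda>z. f z * (c * u z) ^ n)" for n
    by (rule integrable_arc_mult_bounded[OF f, where B = 1])
       (auto simp: norm_power intro!: power_le_one less_imp_le[OF cu])
  have bnd: "norm (f z * (c * u z) ^ n) \<le> norm c ^ n * norm (f z)" if "norm z = 1" for z n
    using power_le_one[OF norm_ge_zero u1[OF that], of n]
      mult_right_mono[of "norm (u z) ^ n" 1 "norm (f z) * norm c ^ n"]
    by (simp add: norm_mult norm_power power_mult_distrib mult_ac)
  have "(\<lambda>n. \<integral>z. f z * (c * u z) ^ n \<partial>arc_measure) sums (\<integral>z. (\<Sum>n. f z * (c * u z) ^ n) \<partial>arc_measure)"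
  proof (rule sums_integral[OF int])
    show "AE z in arc_measure. summable (\<lambda>n. norm (f z * (c * u z) ^ n))"
    proof (rule AE_I2)
      fix z assume "z \<in> space arc_measure"
      then have z: "norm z = 1" by (simp add: space_arc_measure)
      show "summable (\<lambda>n. norm (f z * (c * u z) ^ n))"
        by (rule summable_comparison_test'[where g = "\<lambda>n. norm c ^ n * norm (f z)" and N = 0])
           (use c bnd[OF z] in \<open>auto intro!: summable_mult2 summable_geometric\<close>)
    qed
    show "summable (\<lambda>n. \<integral>z. norm (f z * (c * u z) ^ n) \<partial>arc_measure)"
    proof (rule summable_comparison_test'[where N = 0])
      show "summable (\<lambda>n. norm c ^ n * (\<integral>z. norm (f z) \<partial>arc_measure))"
        using c by (auto intro!: summable_mult2 summable_geometric)
      show "norm (\<integral>z. norm (f z * (c * u z) ^ n) \<partial>arc_measure) \<le> norm c ^ n * (\<integral>z. norm (f z) \<partial>arc_measure)" for n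
      proof -
        have "(\<integral>z. norm (f z * (c * u z) ^ n) \<partial>arc_measure) \<le> (\<integral>z. norm c ^ n * norm (f z) \<partial>arc_measure)"
          using int f bnd by (intro integral_mono) (auto simp: space_arc_measure)
        then show ?thesis by simp
      qed
    qed
  qed
  moreover have "(\<integral>z. (\<Sum>n. f z * (c * u z) ^ n) \<partial>arc_measure) = (\<integral>z. f z / (1 - c * u z) \<partial>arc_measure)"
  proof (rule Bochner_Integration.integral_cong[OF refl])
    fix z assume "z \<in> space arc_measure"
    then have "norm (c * u z) < 1" using cu by (simp add: space_arc_measure)
    then have "(\<lambda>n. f z * (c * u z) ^ n) sums (f z * (1 / (1 - c * u z)))"
      by (intro sums_mult geometric_sums)
    then show "(\<Sum>n. f z * (c * u z) ^ n) = f z / (1 - c * u z)"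
      by (simp add: sums_iff)
  qed
  moreover have "(\<integral>z. f z * (c * u z) ^ n \<partial>arc_measure) = c ^ n * (\<integral>z. f z * u z ^ n \<partial>arc_measure)" for n
    by (subst integral_mult_right_zero[symmetric]) (simp add: power_mult_distrib mult_ac)
  ultimately show ?thesis by simp
qed

lemma measurable_arc_id [measurable]: "(\<lambda>z. z) \<in> borel_measurable arc_measure"
  by (intro measurable_arc_continuous continuous_intros)

lemma measurable_arc_cnj [measurable]: "cnj \<in> borel_measurable arc_measure"
  by (intro measurable_arc_continuous continuous_intros)

lemma arc_cnj_eq_inverse: "norm z = 1 \<Longrightarrow> cnj z = inverse z"
  using complex_norm_square[of z] by (intro inverse_unique[symmetric]) simp

lemma arc_powi_minus: "norm z = 1 \<Longrightarrow> z powi (- int n) = cnj z ^ n"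
  by (simp add: power_int_minus arc_cnj_eq_inverse power_inverse)

lemma integral_arc_power_cnj:
  "(\<integral>z. z ^ m * cnj z ^ n \<partial>arc_measure) = (if m = n then 1 else 0)"
proof -
  have "(\<integral>z. z ^ m * cnj z ^ n \<partial>arc_measure) = (\<integral>z. z powi (int m - int n) \<partial>arc_measure)"
  proof (rule Bochner_Integration.integral_cong[OF refl])
    fix z assume "z \<in> space arc_measure"
    then have z: "norm z = 1" "z \<noteq> 0" by (auto simp: space_arc_measure)
    show "z ^ m * cnj z ^ n = z powi (int m - int n)"
      using z by (simp add: power_int_diff divide_inverse power_int_minus flip: arc_powi_minus[OF z(1)])
  qed
  then show ?thesis by (simp add: integral_arc_powi)
qed

text \<open>Average over \<open>n\<close>: the Cesaro means of the powers of a unimodular function tend to 0 boundedly.\<close>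

lemma integral_arc_mult_power_const_imp_0:
  fixes f u :: "complex \<Rightarrow> complex"
  assumes f: "integrable arc_measure f" and u [measurable]: "u \<in> borel_measurable arc_measure"
    and u1: "\<And>z. norm z = 1 \<Longrightarrow> norm (u z) = 1" and ne: "AE z in arc_measure. u z \<noteq> 1"
    and c: "\<And>n. (\<integral>z. f z * u z ^ n \<partial>arc_measure) = c"
  shows "c = 0"
proof -
  have [measurable]: "f \<in> borel_measurable arc_measure" using f by auto
  define S where "S = (\<lambda>N z. f z * ((\<Sum>n<Suc N. u z ^ n) / of_nat (Suc N)))"
  have int: "integrable arc_measure (\<lambda>z. f z * u z ^ n)" for n
    by (rule integrable_arc_mult_bounded[OF f, where B = 1]) (use u1 in \<open>auto simp: norm_power\<close>)
  have "(\<lambda>N. \<integral>z. S N z \<partial>arc_measure) \<longlonglongrightarrow> (\<integral>z. 0 \<partial>arc_measure)"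
  proof (rule integral_dominated_convergence)
    show "integrable arc_measure (\<lambda>z. norm (f z))" using f by auto
    show "AE z in arc_measure. (\<lambda>N. S N z) \<longlonglongrightarrow> 0"
      using ne AE_arc_norm
    proof eventually_elim
      case (elim z)
      have "(\<lambda>N. (\<Sum>n<Suc N. u z ^ n) / of_nat (Suc N)) \<longlonglongrightarrow> 0"
      proof (rule Lim_null_comparison)
        show "\<forall>\<^sub>F N in sequentially. norm ((\<Sum>n<Suc N. u z ^ n) / of_nat (Suc N)) \<le> (2 / norm (1 - u z)) * inverse (real (Suc N))"
        proof (intro always_eventually allI)
          fix N
          have "(\<Sum>n<Suc N. u z ^ n) = (1 - u z ^ Suc N) / (1 - u z)"
            using elim by (subst sum_gp_strict) auto
          then have "norm (\<Sum>n<Suc N. u z ^ n) \<le> 2 / norm (1 - u z)"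
            using norm_triangle_ineq4[of 1 "u z ^ Suc N"] u1[OF elim(2)]
            by (simp add: norm_divide norm_power norm_mult divide_right_mono)
          then show "norm ((\<Sum>n<Suc N. u z ^ n) / of_nat (Suc N)) \<le> (2 / norm (1 - u z)) * inverse (real (Suc N))"
            by (simp add: norm_mult norm_inverse divide_inverse mult_right_mono del: of_nat_Suc sum.lessThan_Suc)
        qed
        show "(\<lambda>N. (2 / norm (1 - u z)) * inverse (real (Suc N))) \<longlonglongrightarrow> 0"
          using tendsto_mult[OF tendsto_const LIMSEQ_inverse_real_of_nat, of "2 / norm (1 - u z)"] by simp
      qed
      from tendsto_mult[OF tendsto_const this, of "f z"] show ?case by (simp add: S_def)
    qed
    show "AE z in arc_measure. norm (S N z) \<le> norm (f z)" for N
      using AE_arc_norm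
    proof eventually_elim
      case (elim z)
      have "norm (\<Sum>n<Suc N. u z ^ n) \<le> (\<Sum>n<Suc N. norm (u z ^ n))" by (rule norm_sum)
      also have "\<dots> = real (Suc N)" using u1[OF elim] by (simp add: norm_power)
      finally have "norm ((\<Sum>n<Suc N. u z ^ n) / of_nat (Suc N)) \<le> 1"
        by (simp add: norm_divide del: of_nat_Suc sum.lessThan_Suc)
      from mult_left_mono[OF this norm_ge_zero[of "f z"]] show ?case by (simp only: S_def norm_mult mult_1_right)
    qed
  qed (auto simp: S_def)
  moreover have "(\<integral>z. S N z \<partial>arc_measure) = c" for N
  proof -
    have "S N = (\<lambda>z. (\<Sum>n<Suc N. f z * u z ^ n) / of_nat (Suc N))"
      by (simp only: S_def sum_distrib_left times_divide_eq_right)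
    then have "(\<integral>z. S N z \<partial>arc_measure) = (\<Sum>n<Suc N. (\<integral>z. f z * u z ^ n \<partial>arc_measure)) / of_nat (Suc N)"
      using int by (simp only: integral_divide_zero Bochner_Integration.integral_sum)
    then show ?thesis by (simp add: c del: of_nat_Suc sum.lessThan_Suc)
  qed
  ultimately show ?thesis by (simp add: LIMSEQ_const_iff)
qed

text \<open>If 1 / (z - a) were integrable, its moments w n would form a geometric progression with
  ratio a on either side of the jump w 1 = a * w 0 + 1. After multiplication by powers of z / a,
  respectively a / z, the moments are constant, so
  \<open>integral_arc_mult_power_const_imp_0\<close> gives w 1 = 0 and w 0 = 0, which contradicts
  the jump.\<close>

lemma not_integrable_arc_inverse:
  assumes a: "norm a = 1"
  shows "\<not> integrable arc_measure (\<lambda>z. 1 / (z - a))"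
proof
  assume I: "integrable arc_measure (\<lambda>z. 1 / (z - a))"
  have a0: "a \<noteq> 0" using a by auto
  have int: "integrable arc_measure (\<lambda>z. 1 / (z - a) * z powi n)" for n
    by (rule integrable_arc_mult_bounded[OF I, where B = 1]) (auto simp: norm_power_int)
  define w where "w n = (\<integral>z. 1 / (z - a) * z powi n \<partial>arc_measure)" for n
  have rec: "w (n + 1) = a * w n + (if n = 0 then 1 else 0)" for n
  proof -
    have "w (n + 1) - a * w n = (\<integral>z. 1 / (z - a) * z powi (n + 1) - a * (1 / (z - a) * z powi n) \<partial>arc_measure)"
      unfolding w_def integral_mult_right_zero[symmetric]
      by (rule Bochner_Integration.integral_diff[symmetric]) (intro int integrable_mult_right)+
    also have "\<dots> = (\<integral>z. z powi n \<partial>arc_measure)"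
    proof (rule integral_cong_AE)
      show "AE z in arc_measure. 1 / (z - a) * z powi (n + 1) - a * (1 / (z - a) * z powi n) = z powi n"
        using AE_arc_neq[of a] AE_arc_norm
      proof eventually_elim
        case (elim z)
        then have "z \<noteq> 0" by auto
        then have "1 / (z - a) * z powi (n + 1) - a * (1 / (z - a) * z powi n) = (z - a) * z powi n / (z - a)"
          by (simp add: power_int_add algebra_simps diff_divide_distrib)
        then show ?case using elim by simp
      qed
    qed measurable
    finally show ?thesis by (simp add: integral_arc_powi algebra_simps)
  qed
  have "w 1 = 0"
  proof -
    have pw: "w (int n + 1) = a ^ n * w 1" for n
    proof (induction n)
      case (Suc n)
      then show ?case using rec[of "int n + 1"] by (simp add: algebra_simps)
    qed simp
    have "(\<integral>z. (1 / (z - a) * z) * (z / a) ^ n \<partial>arc_measure) = w 1" for n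
    proof -
      have "(\<integral>z. (1 / (z - a) * z) * (z / a) ^ n \<partial>arc_measure) = (\<integral>z. (1 / (z - a) * z powi (int n + 1)) / a ^ n \<partial>arc_measure)"
        by (rule Bochner_Integration.integral_cong)
           (auto simp: power_divide space_arc_measure power_int_add)
      also have "\<dots> = w (int n + 1) / a ^ n" unfolding w_def by (rule integral_divide_zero)
      finally show ?thesis using pw[of n] a0 by simp
    qed
    then show ?thesis
      by (rule integral_arc_mult_power_const_imp_0[rotated -1])
         (use int[of 1] a AE_arc_neq[of a] a0 in \<open>auto simp: norm_divide\<close>)
  qed
  moreover have "w 0 = 0"
  proof -
    have "w 0 = a ^ n * w (- int n)" for n
    proof (induction n)
      case (Suc n)
      have "w (- int n) = a * w (- int (Suc n))" using rec[of "- int (Suc n)"] by simp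
      then show ?case using Suc by simp
    qed simp
    then have *: "w (- int n) * a ^ n = w 0" for n by (simp add: mult.commute)
    have "(\<integral>z. (1 / (z - a)) * (a / z) ^ n \<partial>arc_measure) = w 0" for n
    proof -
      have "(\<integral>z. (1 / (z - a)) * (a / z) ^ n \<partial>arc_measure) = (\<integral>z. (1 / (z - a) * z powi (- int n)) * a ^ n \<partial>arc_measure)"
        by (rule Bochner_Integration.integral_cong) (auto simp: power_divide power_int_minus field_simps)
      also have "\<dots> = w (- int n) * a ^ n" unfolding w_def by (rule integral_mult_left_zero)
      finally show ?thesis using * by simp
    qed
    then show ?thesis
      by (rule integral_arc_mult_power_const_imp_0[rotated -1])
         (use I a AE_arc_neq[of a] in \<open>auto simp: norm_divide\<close>)
  qed
  ultimately show False using rec[of 0] by simp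
qed


section \<open>Boundary values of functions in the Hardy space\<close>

lemma arc_cauchy_denom_ge:
  assumes "norm z = 1"
  shows "norm (1 - a * cnj z) \<ge> 1 - norm a"
  using norm_triangle_ineq2[of 1 "a * cnj z"] assms by (simp add: norm_mult)

lemma arc_cauchy_kernel_bound:
  assumes "norm z = 1" "norm a < 1"
  shows "norm (1 / (1 - a * cnj z)) \<le> 1 / (1 - norm a)"
  using arc_cauchy_denom_ge[OF assms(1), of a] assms by (auto simp: norm_divide intro!: divide_left_mono mult_pos_pos)

lemma measurable_arc_cauchy [measurable]:
  "(\<lambda>z. 1 / (1 - a * cnj z)) \<in> borel_measurable arc_measure"
  by measurable

lemma integrable_arc_cauchy:
  fixes f :: "complex \<Rightarrow> complex"
  assumes "integrable arc_measure f" "norm a < 1"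
  shows "integrable arc_measure (\<lambda>z. f z / (1 - a * cnj z))"
  using integrable_arc_mult_bounded[OF assms(1) measurable_arc_cauchy arc_cauchy_kernel_bound[OF _ assms(2)]]
  by simp

lemma arc_cauchy_power:
  assumes "norm a < 1"
  shows "(\<integral>z. z ^ k / (1 - a * cnj z) \<partial>arc_measure) = a ^ k"
proof -
  have "integrable arc_measure (\<lambda>z. z ^ k)"
    by (rule integrable_arc_bounded[where B = 1]) (auto simp: norm_power)
  from integral_arc_geometric[OF this, of cnj a]
  have "(\<lambda>n. a ^ n * (if k = n then 1 else 0)) sums (\<integral>z. z ^ k / (1 - a * cnj z) \<partial>arc_measure)"
    using assms by (simp add: integral_arc_power_cnj)
  moreover have "(\<lambda>n. a ^ n * (if k = n then 1 else 0)) sums (a ^ k)"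
    using sums_single[of k "\<lambda>n. a ^ n"] by (simp add: if_distrib eq_commute cong: if_cong)
  ultimately show ?thesis by (rule sums_unique2)
qed

lemma holomorphic_dilation_continuous_on_circle:
  assumes "F holomorphic_on ball 0 1" "0 \<le> r" "r < 1"
  shows "continuous_on (sphere 0 1) (\<lambda>z. F (of_real r * z))"
  by (rule continuous_on_compose2[OF holomorphic_on_imp_continuous_on[OF assms(1)]])
     (use assms in \<open>auto intro!: continuous_intros simp: norm_mult\<close>)

lemma integral_arc_holomorphic_sums:
  assumes F: "F holomorphic_on ball 0 1" and r: "0 \<le> r" "r < 1"
    and g: "g \<in> borel_measurable arc_measure" "\<And>z. norm z = 1 \<Longrightarrow> norm (g z) \<le> B"
  shows "(\<lambda>k. (deriv ^^ k) F 0 / fact k * of_real r ^ k * (\<integral>z. g z * z ^ k \<partial>arc_measure))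
           sums (\<integral>z. F (of_real r * z) * g z \<partial>arc_measure)"
proof -
  have [measurable]: "g \<in> borel_measurable arc_measure" by fact
  have ig: "integrable arc_measure g" by (rule integrable_arc_bounded[OF g])
  define a where "a k = (deriv ^^ k) F 0 / fact k" for k
  have S: "(\<lambda>k. a k * w ^ k) sums F w" if "norm w < 1" for w
    using holomorphic_power_series[OF F, of w] that by (simp add: a_def)
  \<comment> \<open>Convergence of the power series at a larger radius inside the disc yields
    absolute convergence at r.\<close>
  obtain R where R: "r < R" "R < 1" using r dense by blast
  have sm: "summable (\<lambda>k. norm (a k) * r ^ k)"
  proof -
    have "summable (\<lambda>k. a k * of_real R ^ k)" using S[of "of_real R"] R r by (auto simp: sums_iff)
    from powser_insidea[OF this, of "of_real r"] R r show ?thesis by (simp add: norm_mult norm_power)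
  qed
  have int: "integrable arc_measure (\<lambda>z. g z * z ^ k)" for k
    by (rule integrable_arc_mult_bounded[OF ig, where B = 1]) (auto simp: norm_power)
  have int': "integrable arc_measure (\<lambda>z. a k * of_real r ^ k * (g z * z ^ k))" for k
    using int by (rule integrable_mult_right)
  have nrm: "norm (a k * of_real r ^ k * (g z * z ^ k)) = norm (a k) * r ^ k * norm (g z)" if "norm z = 1" for k z
    using that r by (simp add: norm_mult norm_power)
  have "(\<lambda>k. \<integral>z. a k * of_real r ^ k * (g z * z ^ k) \<partial>arc_measure)
      sums (\<integral>z. (\<Sum>k. a k * of_real r ^ k * (g z * z ^ k)) \<partial>arc_measure)"
  proof (rule sums_integral[OF int'])
    show "AE z in arc_measure. summable (\<lambda>k. norm (a k * of_real r ^ k * (g z * z ^ k)))"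
      using AE_arc_norm by eventually_elim (use nrm sm in \<open>auto intro: summable_mult2\<close>)
    have "(\<integral>z. norm (a k * of_real r ^ k * (g z * z ^ k)) \<partial>arc_measure)
        = norm (a k) * r ^ k * (\<integral>z. norm (g z) \<partial>arc_measure)" for k
      by (subst integral_mult_right_zero[symmetric], rule Bochner_Integration.integral_cong[OF refl])
         (simp add: nrm space_arc_measure)
    then show "summable (\<lambda>k. \<integral>z. norm (a k * of_real r ^ k * (g z * z ^ k)) \<partial>arc_measure)"
      using sm by (auto intro: summable_mult2)
  qed
  also have "(\<integral>z. (\<Sum>k. a k * of_real r ^ k * (g z * z ^ k)) \<partial>arc_measure) = (\<integral>z. F (of_real r * z) * g z \<partial>arc_measure)"
  proof (rule Bochner_Integration.integral_cong[OF refl])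
    fix z assume "z \<in> space arc_measure"
    then have "norm (of_real r * z) < 1" using r by (simp add: space_arc_measure norm_mult)
    from sums_mult2[OF S[OF this], of "g z"]
    show "(\<Sum>k. a k * of_real r ^ k * (g z * z ^ k)) = F (of_real r * z) * g z"
      by (simp add: sums_iff power_mult_distrib mult_ac)
  qed
  finally show ?thesis by (simp add: a_def)
qed

lemma arc_continuous_bounded:
  fixes f :: "complex \<Rightarrow> complex"
  assumes "continuous_on (sphere 0 1) f"
  obtains B where "B \<ge> 0" "\<And>z. norm z = 1 \<Longrightarrow> norm (f z) \<le> B"
proof -
  have "compact (f ` sphere 0 1)"
    by (rule compact_continuous_image[OF assms]) auto
  then have "bounded (f ` sphere 0 1)" by (rule compact_imp_bounded)
  then obtain M where M: "\<And>z. norm z = 1 \<Longrightarrow> norm (f z) \<le> M"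
    by (metis bounded_iff imageI mem_sphere_0)
  have "M \<ge> 0" using order_trans[OF norm_ge_zero M[of 1]] by simp
  with M show ?thesis using that by blast
qed

lemma integrable_arc_continuous_powr:
  fixes f :: "complex \<Rightarrow> complex"
  assumes f: "continuous_on (sphere 0 1) f" and p: "p \<ge> 0"
  shows "integrable arc_measure (\<lambda>z. norm (f z) powr p)"
proof -
  have [measurable]: "f \<in> borel_measurable arc_measure" using f by (rule measurable_arc_continuous)
  obtain B where B: "\<And>z. norm z = 1 \<Longrightarrow> norm (f z) \<le> B" using arc_continuous_bounded[OF f] by blast
  show ?thesis
  proof (rule arc_measure.integrable_const_bound[where B = "B powr p"])
    show "AE z in arc_measure. norm (norm (f z) powr p) \<le> B powr p"
      using B p by (intro AE_I2) (auto simp: space_arc_measure intro!: powr_mono2)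
  qed simp
qed

section \<open>From dilations to the boundary function\<close>

lemma norm_diff_powr_le:
  fixes a b :: complex and p :: real
  assumes "p \<ge> 1"
  shows "norm (a - b) powr p \<le> 2 powr p * (norm a powr p + norm b powr p)"
proof -
  have "norm (a - b) powr p \<le> (norm a + norm b) powr p"
    using assms by (intro powr_mono2 norm_triangle_ineq4) auto
  also have "\<dots> \<le> 2 powr p * (1 / 2 * norm a powr p + 1 / 2 * norm b powr p)"
    using powr_add_convex[of "norm a" "norm b" 1 1 p] assms by simp
  also have "\<dots> \<le> 2 powr p * (norm a powr p + norm b powr p)"
    by (intro mult_left_mono add_mono) auto
  finally show ?thesis .
qed

text \<open>Splitting off the set where \<open>\<phi>\<close> exceeds \<open>K\<close> costs at most \<open>C * K powr (1 - p)\<close>, which is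
  small for large \<open>K\<close> because \<open>p > 1\<close>.\<close>

lemma integral_tendsto_0_of_bounded_powr:
  fixes \<phi> :: "nat \<Rightarrow> complex \<Rightarrow> complex" and p :: real
  assumes p: "p > 1" and [measurable]: "\<And>j. \<phi> j \<in> borel_measurable arc_measure"
    and int: "\<And>j. integrable arc_measure (\<lambda>z. norm (\<phi> j z) powr p)"
    and C: "\<And>j. (\<integral>z. norm (\<phi> j z) powr p \<partial>arc_measure) \<le> C"
    and lim: "AE z in arc_measure. (\<lambda>j. \<phi> j z) \<longlonglongrightarrow> 0"
  shows "(\<lambda>j. \<integral>z. norm (\<phi> j z) \<partial>arc_measure) \<longlonglongrightarrow> 0"
proof (rule LIMSEQ_I)
  fix e :: real assume e: "e > 0"
  have C0: "C \<ge> 0" using order_trans[OF Bochner_Integration.integral_nonneg C[of 0]] by simp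
  have i1: "integrable arc_measure (\<lambda>z. norm (\<phi> j z))" for j
    using integrable_arc_of_powr[of "\<phi> j" p] int p by (intro integrable_norm) auto
  have "((\<lambda>K. C * K powr (1 - p)) \<longlongrightarrow> 0) at_top"
    using tendsto_mult[OF tendsto_const tendsto_neg_powr[OF _ filterlim_ident, of "1 - p"], of C] p by simp
  then have "eventually (\<lambda>K. C * K powr (1 - p) < e / 2) at_top"
    using e by (auto simp: tendsto_iff dist_real_def elim!: allE[of _ "e / 2"] eventually_mono)
  then obtain K where K: "K > 0" "C * K powr (1 - p) < e / 2"
    using eventually_conj[OF _ eventually_gt_at_top[of 0]] eventually_happens'[OF trivial_limit_at_top_linorder] by blast
  have "(\<lambda>j. \<integral>z. min (norm (\<phi> j z)) K \<partial>arc_measure) \<longlonglongrightarrow> (\<integral>z. 0 \<partial>arc_measure)"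
  proof (rule integral_dominated_convergence[where w = "\<lambda>_. K"])
    show "AE z in arc_measure. (\<lambda>j. min (norm (\<phi> j z)) K) \<longlonglongrightarrow> 0"
      using lim
    proof eventually_elim
      case (elim z)
      from tendsto_min[OF tendsto_norm_zero[OF elim] tendsto_const, of K] K show ?case by simp
    qed
    show "AE z in arc_measure. norm (min (norm (\<phi> j z)) K) \<le> K" for j
      using K by (intro AE_I2) auto
  qed auto
  from LIMSEQ_D[OF this, of "e / 2"] e obtain N where
    N: "\<And>j. j \<ge> N \<Longrightarrow> \<bar>\<integral>z. min (norm (\<phi> j z)) K \<partial>arc_measure\<bar> < e / 2" by auto
  show "\<exists>N. \<forall>j\<ge>N. norm ((\<integral>z. norm (\<phi> j z) \<partial>arc_measure) - 0) < e"
  proof (intro exI allI impI)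
    fix j assume j: "j \<ge> N"
    have imin: "integrable arc_measure (\<lambda>z. min (norm (\<phi> j z)) K)"
      by (rule Bochner_Integration.integrable_bound[OF i1[of j]]) (use K in auto)
    have "(\<integral>z. norm (\<phi> j z) \<partial>arc_measure) \<le> (\<integral>z. min (norm (\<phi> j z)) K + K powr (1 - p) * norm (\<phi> j z) powr p \<partial>arc_measure)"
    proof (rule integral_mono)
      fix z
      show "norm (\<phi> j z) \<le> min (norm (\<phi> j z)) K + K powr (1 - p) * norm (\<phi> j z) powr p"
      proof (cases "norm (\<phi> j z) \<le> K")
        case False
        define t where "t = norm (\<phi> j z)"
        have t: "t > K" "t > 0" using False K by (auto simp: t_def)
        have "t = t powr (1 - p) * t powr p" using t by (simp flip: powr_add)
        also have "\<dots> \<le> K powr (1 - p) * t powr p"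
          using t K p by (intro mult_right_mono powr_mono2') auto
        finally show ?thesis using K t unfolding t_def [symmetric] by simp
      qed simp
    qed (use i1 int imin in auto)
    also have "\<dots> = (\<integral>z. min (norm (\<phi> j z)) K \<partial>arc_measure) + K powr (1 - p) * (\<integral>z. norm (\<phi> j z) powr p \<partial>arc_measure)"
      using imin int by simp
    also have "\<dots> < e / 2 + e / 2"
    proof (rule add_strict_mono)
      show "(\<integral>z. min (norm (\<phi> j z)) K \<partial>arc_measure) < e / 2" using N[OF j] by simp
      have "K powr (1 - p) * (\<integral>z. norm (\<phi> j z) powr p \<partial>arc_measure) \<le> K powr (1 - p) * C"
        by (rule mult_left_mono[OF C]) auto
      then show "K powr (1 - p) * (\<integral>z. norm (\<phi> j z) powr p \<partial>arc_measure) < e / 2"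
        using K(2) unfolding mult.commute[of C] by linarith
    qed
    finally show "norm ((\<integral>z. norm (\<phi> j z) \<partial>arc_measure) - 0) < e" by simp
  qed
qed

text \<open>Membership in \<open>Hp\<close> with its witnesses exposed: a representative f, the
  extension F and a bound C for the means. The analytic arguments work with these functions, not
  with classes.\<close>

definition hardy_boundary :: "real \<Rightarrow> real \<Rightarrow> (complex \<Rightarrow> complex) \<Rightarrow> (complex \<Rightarrow> complex) \<Rightarrow> bool" where
  "hardy_boundary p C F f \<longleftrightarrow> f \<in> borel_measurable arc_measure \<and>
     integrable arc_measure (\<lambda>z. norm (f z) powr p) \<and> F holomorphic_on ball 0 1 \<and>
     (\<forall>r\<in>{0..<1}. (\<integral>z. norm (F (of_real r * z)) powr p \<partial>arc_measure) \<le> C) \<and>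
     (AE z in arc_measure. ((\<lambda>r. F (of_real r * z)) \<longlongrightarrow> f z) (at_left (1::real)))"

lemma hardy_boundaryD:
  assumes "hardy_boundary p C F f"
  shows "f \<in> borel_measurable arc_measure" "integrable arc_measure (\<lambda>z. norm (f z) powr p)"
    "F holomorphic_on ball 0 1"
    "\<forall>r\<in>{0..<1}. (\<integral>z. norm (F (of_real r * z)) powr p \<partial>arc_measure) \<le> C"
    "AE z in arc_measure. ((\<lambda>r. F (of_real r * z)) \<longlongrightarrow> f z) (at_left (1::real))"
  using assms by (simp_all add: hardy_boundary_def)

lemma hardy_boundaryI:
  assumes "f \<in> borel_measurable arc_measure" "integrable arc_measure (\<lambda>z. norm (f z) powr p)"
    "F holomorphic_on ball 0 1"
    "\<forall>r\<in>{0..<1}. (\<integral>z. norm (F (of_real r * z)) powr p \<partial>arc_measure) \<le> C"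
    "AE z in arc_measure. ((\<lambda>r. F (of_real r * z)) \<longlongrightarrow> f z) (at_left (1::real))"
  shows "hardy_boundary p C F f"
  using assms by (simp add: hardy_boundary_def)

text \<open>Radial convergence almost everywhere together with bounded L^p means, p > 1, gives
  convergence in L^1, hence convergence of the integrals against any bounded g. No maximal function
  is involved. A single sequence of radii, here in [1/2, 1), is enough to identify limits.\<close>

lemma hardy_integral_tendsto:
  assumes p: "p > 1" and hb: "hardy_boundary p C F f"
    and g [measurable]: "g \<in> borel_measurable arc_measure" and B: "\<And>z. norm z = 1 \<Longrightarrow> norm (g z) \<le> B"
  shows "(\<lambda>j. \<integral>z. F (of_real (1 - 1 / real (j + 2)) * z) * g z \<partial>arc_measure) \<longlonglongrightarrow> (\<integral>z. f z * g z \<partial>arc_measure)"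
proof -
  note [measurable] = hardy_boundaryD(1)[OF hb]
  note f = hardy_boundaryD(1)[OF hb] and int = hardy_boundaryD(2)[OF hb] and F = hardy_boundaryD(3)[OF hb]
    and C = hardy_boundaryD(4)[OF hb] and lim = hardy_boundaryD(5)[OF hb]
  define r where "r j = 1 - 1 / real (j + 2)" for j :: nat
  have r: "0 \<le> r j" "r j < 1" for j by (auto simp: r_def)
  have r_lim: "filterlim r (at_left 1) sequentially"
  proof -
    have "r \<longlonglongrightarrow> 1" unfolding r_def by real_asymp
    moreover have "r j \<noteq> 1" for j using r(2)[of j] by simp
    ultimately show ?thesis using r by (auto simp: filterlim_at)
  qed
  have cont: "continuous_on (sphere 0 1) (\<lambda>z. F (of_real (r j) * z))" for j
    by (rule holomorphic_dilation_continuous_on_circle[OF F r])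
  have [measurable]: "(\<lambda>z. F (of_real (r j) * z)) \<in> borel_measurable arc_measure" for j
    using cont by (rule measurable_arc_continuous)
  have intF: "integrable arc_measure (\<lambda>z. norm (F (of_real (r j) * z)) powr p)" for j
    using p by (intro integrable_arc_continuous_powr cont) auto
  define \<phi> where "\<phi> j z = F (of_real (r j) * z) - f z" for j z
  have [measurable]: "\<phi> j \<in> borel_measurable arc_measure" for j by (simp add: \<phi>_def[abs_def])
  have bnd: "norm (\<phi> j z) powr p \<le> 2 powr p * (norm (F (of_real (r j) * z)) powr p + norm (f z) powr p)" for j z
    unfolding \<phi>_def using p by (intro norm_diff_powr_le) auto
  have int\<phi>: "integrable arc_measure (\<lambda>z. norm (\<phi> j z) powr p)" for j
  proof (rule Bochner_Integration.integrable_bound)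
    show "integrable arc_measure (\<lambda>z. 2 powr p * (norm (F (of_real (r j) * z)) powr p + norm (f z) powr p))"
      using intF int by auto
    show "AE z in arc_measure. norm (norm (\<phi> j z) powr p)
        \<le> norm (2 powr p * (norm (F (of_real (r j) * z)) powr p + norm (f z) powr p))"
      using bnd[of j] by (intro AE_I2) (auto intro: order_trans)
  qed measurable
  have "(\<lambda>j. \<integral>z. norm (\<phi> j z) \<partial>arc_measure) \<longlonglongrightarrow> 0"
  proof (rule integral_tendsto_0_of_bounded_powr[OF p])
    show "(\<integral>z. norm (\<phi> j z) powr p \<partial>arc_measure) \<le> 2 powr p * (C + (\<integral>z. norm (f z) powr p \<partial>arc_measure))" for j
    proof -
      have "(\<integral>z. norm (\<phi> j z) powr p \<partial>arc_measure)
          \<le> (\<integral>z. 2 powr p * (norm (F (of_real (r j) * z)) powr p + norm (f z) powr p) \<partial>arc_measure)"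
        using bnd int\<phi> intF int by (intro integral_mono) auto
      also have "\<dots> = 2 powr p * ((\<integral>z. norm (F (of_real (r j) * z)) powr p \<partial>arc_measure) + (\<integral>z. norm (f z) powr p \<partial>arc_measure))"
        using intF int by simp
      also have "\<dots> \<le> 2 powr p * (C + (\<integral>z. norm (f z) powr p \<partial>arc_measure))"
        using C r by (intro mult_left_mono add_right_mono) auto
      finally show ?thesis .
    qed
    show "AE z in arc_measure. (\<lambda>j. \<phi> j z) \<longlonglongrightarrow> 0"
      using lim
    proof eventually_elim
      case (elim z)
      from filterlim_compose[OF elim r_lim] show ?case by (simp add: \<phi>_def LIM_zero_iff tendsto_diff)
    qed
  qed (use int\<phi> in auto)
  then have lim0: "(\<lambda>j. B * (\<integral>z. norm (\<phi> j z) \<partial>arc_measure)) \<longlonglongrightarrow> 0"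
    by (rule tendsto_mult_right_zero)
  have i\<phi>: "integrable arc_measure (\<phi> j)" for j
    using integrable_arc_of_powr[of "\<phi> j" p] int\<phi> p by auto
  have iFg: "integrable arc_measure (\<lambda>z. F (of_real (r j) * z) * g z)" for j
    using integrable_arc_of_powr[OF _ intF[of j]] p by (intro integrable_arc_mult_bounded[OF _ g B]) auto
  have ifg: "integrable arc_measure (\<lambda>z. f z * g z)"
    using integrable_arc_of_powr[OF f int] p by (intro integrable_arc_mult_bounded[OF _ g B]) auto
  have "(\<lambda>j. (\<integral>z. F (of_real (r j) * z) * g z \<partial>arc_measure) - (\<integral>z. f z * g z \<partial>arc_measure)) \<longlonglongrightarrow> 0"
  proof (rule Lim_null_comparison[OF always_eventually lim0], intro allI)
    fix j
    have "(\<integral>z. F (of_real (r j) * z) * g z \<partial>arc_measure) - (\<integral>z. f z * g z \<partial>arc_measure) = (\<integral>z. \<phi> j z * g z \<partial>arc_measure)"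
      using iFg ifg by (subst Bochner_Integration.integral_diff[symmetric]) (auto simp: \<phi>_def left_diff_distrib)
    also have "norm \<dots> \<le> (\<integral>z. norm (\<phi> j z * g z) \<partial>arc_measure)"
      by (rule integral_norm_bound)
    also have "\<dots> \<le> (\<integral>z. B * norm (\<phi> j z) \<partial>arc_measure)"
    proof (rule integral_mono)
      show "integrable arc_measure (\<lambda>z. norm (\<phi> j z * g z))"
        by (intro integrable_norm integrable_arc_mult_bounded[OF i\<phi> g B])
      show "norm (\<phi> j z * g z) \<le> B * norm (\<phi> j z)" if "z \<in> space arc_measure" for z
        using mult_left_mono[OF B, of z "norm (\<phi> j z)"] that by (simp add: norm_mult space_arc_measure mult.commute)
    qed (use i\<phi> in auto)
    finally show "norm ((\<integral>z. F (of_real (r j) * z) * g z \<partial>arc_measure) - (\<integral>z. f z * g z \<partial>arc_measure))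
        \<le> B * (\<integral>z. norm (\<phi> j z) \<partial>arc_measure)" by simp
  qed
  then show ?thesis unfolding r_def by (simp add: LIM_zero_iff)
qed

text \<open>For a dilation of F both identities follow from the power series and orthogonality on
  the circle; \<open>hardy_integral_tendsto\<close> carries them to radius 1. The second one
  recovers the extension from the boundary function alone.\<close>

lemma
  assumes p: "p > 1" and hb: "hardy_boundary p C F f"
  shows hardy_negative_coeff: "n \<ge> 1 \<Longrightarrow> (\<integral>z. f z * z ^ n \<partial>arc_measure) = 0"
    and hardy_cauchy: "norm a < 1 \<Longrightarrow> (\<integral>z. f z / (1 - a * cnj z) \<partial>arc_measure) = F a"
proof -
  note F = hardy_boundaryD(3)[OF hb] and lim' = hardy_integral_tendsto[OF p hb]
  assume n: "n \<ge> 1"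
  have *: "(\<integral>z. F (of_real r * z) * z ^ n \<partial>arc_measure) = 0" if r: "0 \<le> r" "r < 1" for r
  proof -
    have "(\<integral>z. z ^ n * z ^ k \<partial>arc_measure) = 0" for k
      using integral_arc_power_cnj[of "n + k" 0] n by (simp add: power_add)
    with integral_arc_holomorphic_sums[OF F r, of "\<lambda>z. z ^ n" 1]
    show ?thesis by (simp add: norm_power sums_iff)
  qed
  have "(\<lambda>j. \<integral>z. F (of_real (1 - 1 / real (j + 2)) * z) * z ^ n \<partial>arc_measure) = (\<lambda>_. 0)"
    by (intro ext) (rule *, auto simp: field_simps)
  with lim'[of "\<lambda>z. z ^ n" 1] show "(\<integral>z. f z * z ^ n \<partial>arc_measure) = 0"
    by (simp add: norm_power LIMSEQ_const_iff)
next
  note F = hardy_boundaryD(3)[OF hb] and lim' = hardy_integral_tendsto[OF p hb]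
  assume a: "norm a < 1"
  let ?g = "\<lambda>z. 1 / (1 - a * cnj z)"
  have *: "(\<integral>z. F (of_real r * z) * ?g z \<partial>arc_measure) = F (of_real r * a)" if r: "0 \<le> r" "r < 1" for r
  proof -
    have "(\<integral>z. ?g z * z ^ k \<partial>arc_measure) = a ^ k" for k
      using arc_cauchy_power[OF a, of k] by simp
    with integral_arc_holomorphic_sums[OF F r measurable_arc_cauchy arc_cauchy_kernel_bound[OF _ a]]
    have "(\<lambda>k. (deriv ^^ k) F 0 / fact k * of_real r ^ k * a ^ k) sums (\<integral>z. F (of_real r * z) * ?g z \<partial>arc_measure)"
      by simp
    moreover have "norm (of_real r * a) < 1"
      using mult_left_le[of "norm a" r] r a by (simp add: norm_mult)
    then have "(\<lambda>k. (deriv ^^ k) F 0 / fact k * of_real r ^ k * a ^ k) sums F (of_real r * a)"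
      using holomorphic_power_series[OF F, of "of_real r * a"] by (simp add: power_mult_distrib mult.assoc)
    ultimately show ?thesis by (rule sums_unique2)
  qed
  have "(\<lambda>j. \<integral>z. F (of_real (1 - 1 / real (j + 2)) * z) * ?g z \<partial>arc_measure)
      = (\<lambda>j. F (of_real (1 - 1 / real (j + 2)) * a))"
    by (intro ext) (rule *, auto simp: field_simps)
  with lim'[OF measurable_arc_cauchy arc_cauchy_kernel_bound[OF _ a]]
  have 1: "(\<lambda>j. F (of_real (1 - 1 / real (j + 2)) * a)) \<longlonglongrightarrow> (\<integral>z. f z * ?g z \<partial>arc_measure)"
    by simp
  have "(\<lambda>j. of_real (1 - 1 / real (j + 2)) * a) \<longlonglongrightarrow> of_real 1 * a"
    by (intro tendsto_mult tendsto_of_real tendsto_const) real_asymp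
  moreover have "isCont F a"
    using F a holomorphic_on_imp_continuous_on continuous_on_interior[of "ball 0 1" F a] by auto
  ultimately have "(\<lambda>j. F (of_real (1 - 1 / real (j + 2)) * a)) \<longlonglongrightarrow> F a"
    by (auto intro: isCont_tendsto_compose)
  with 1 show "(\<integral>z. f z / (1 - a * cnj z) \<partial>arc_measure) = F a"
    using LIMSEQ_unique by fastforce
qed


section \<open>Smirnov's principle for a linear factor\<close>

text \<open>For unimodular z and w this is the Poisson kernel of the point r z: the denominator has
  the same modulus as w - r z. In this form the symmetry in z and w is visible.\<close>

definition poisson_kernel :: "real \<Rightarrow> complex \<Rightarrow> complex \<Rightarrow> real" where
  "poisson_kernel r z w = (1 - r\<^sup>2) / (norm (1 - of_real r * z * cnj w))\<^sup>2"

lemma poisson_kernel_commute: "poisson_kernel r z w = poisson_kernel r w z"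
proof -
  have "norm (1 - of_real r * z * cnj w) = norm (cnj (1 - of_real r * z * cnj w))" by (rule complex_mod_cnj[symmetric])
  then show ?thesis by (simp add: poisson_kernel_def mult_ac)
qed

lemma poisson_kernel_nonneg: "0 \<le> r \<Longrightarrow> r < 1 \<Longrightarrow> poisson_kernel r z w \<ge> 0"
  by (simp add: poisson_kernel_def power_le_one)

lemma poisson_kernel_bound:
  assumes "0 \<le> r" "r < 1" "norm z = 1" "norm w = 1"
  shows "poisson_kernel r z w \<le> 1 / (1 - r)\<^sup>2"
proof -
  have "1 - r \<le> norm (1 - of_real r * z * cnj w)"
    using arc_cauchy_denom_ge[of w "of_real r * z"] assms by (simp add: norm_mult)
  then have "(1 - r)\<^sup>2 \<le> (norm (1 - of_real r * z * cnj w))\<^sup>2"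
    using assms by (intro power_mono) auto
  then show ?thesis unfolding poisson_kernel_def using assms by (intro frac_le) auto
qed

text \<open>The first summand is the Cauchy kernel at r z; the second is a series of powers of w
  with exponents \<ge> 1 and so pairs only with Fourier coefficients of negative index.\<close>

lemma poisson_kernel_eq:
  assumes "0 \<le> r" "r < 1" "norm z = 1" "norm w = 1"
  shows "of_real (poisson_kernel r z w)
    = 1 / (1 - of_real r * z * cnj w) + of_real r * cnj z * w / (1 - of_real r * cnj z * w)"
proof -
  define s where "s = of_real r * z * cnj w"
  have ns: "norm s = r" using assms by (simp add: s_def norm_mult)
  have cs: "of_real r * cnj z * w = cnj s" by (simp add: s_def)
  have "s \<noteq> 1" using ns assms by auto
  moreover have "cnj s \<noteq> 1" using \<open>s \<noteq> 1\<close> by (metis complex_cnj_cnj complex_cnj_one)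
  moreover have "of_real ((norm (1 - s))\<^sup>2) = (1 - s) * (1 - cnj s)"
    by (simp only: complex_norm_square complex_cnj_diff complex_cnj_one)
  moreover have "of_real (r\<^sup>2) = s * cnj s"
    using complex_norm_square[of s] ns by simp
  ultimately show ?thesis
    unfolding poisson_kernel_def cs s_def[symmetric] of_real_divide of_real_diff
    by (simp add: field_simps)
qed

lemma measurable_poisson_kernel [measurable]:
  assumes [measurable]: "f \<in> borel_measurable M" "g \<in> borel_measurable M"
  shows "(\<lambda>x. poisson_kernel r (f x) (g x)) \<in> borel_measurable M"
proof -
  have [measurable]: "cnj \<in> borel_measurable borel"
    by (intro borel_measurable_continuous_onI continuous_intros)
  show ?thesis unfolding poisson_kernel_def by measurable
qed

text \<open>Since the coefficients of negative index vanish, the complex Cauchy kernel may be traded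
  for the Poisson kernel, which is nonnegative with total mass 1. This is what makes Jensen's
  inequality available.\<close>

lemma poisson_integral:
  fixes w :: "complex \<Rightarrow> complex"
  assumes w: "integrable arc_measure w" and neg: "\<And>n. n \<ge> 1 \<Longrightarrow> (\<integral>z. w z * z ^ n \<partial>arc_measure) = 0"
    and r: "0 \<le> r" "r < 1" and z: "norm z = 1"
  shows "(\<integral>x. w x / (1 - of_real r * z * cnj x) \<partial>arc_measure) = (\<integral>x. w x * of_real (poisson_kernel r z x) \<partial>arc_measure)"
proof -
  have c: "norm (of_real r * cnj z) < 1" "norm (of_real r * z) < 1" using r z by (auto simp: norm_mult)
  have wz: "integrable arc_measure (\<lambda>x. w x * x)"
    by (rule integrable_arc_mult_bounded[OF w, where B = 1]) auto
  have bnd: "norm (1 / (1 - of_real r * cnj z * x)) \<le> 1 / (1 - r)" if "norm x = 1" for x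
    using arc_cauchy_kernel_bound[of "cnj x" "of_real r * cnj z"] that c r z by (simp add: norm_mult)
  have i2: "integrable arc_measure (\<lambda>x. w x * x / (1 - of_real r * cnj z * x))"
    using integrable_arc_mult_bounded[OF wz _ bnd] by simp
  have i1: "integrable arc_measure (\<lambda>x. w x / (1 - of_real r * z * cnj x))"
    using integrable_arc_cauchy[OF w c(2)] .
  have "(\<lambda>n. (of_real r * cnj z) ^ n * (\<integral>x. w x * x * x ^ n \<partial>arc_measure)) sums (\<integral>x. w x * x / (1 - of_real r * cnj z * x) \<partial>arc_measure)"
    by (rule integral_arc_geometric[OF wz _ _ c(1)]) auto
  then have 0: "(\<integral>x. w x * x / (1 - of_real r * cnj z * x) \<partial>arc_measure) = 0"
    using neg[of "Suc _"] by (simp add: sums_iff mult_ac)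
  have "(\<integral>x. w x * of_real (poisson_kernel r z x) \<partial>arc_measure)
    = (\<integral>x. w x / (1 - of_real r * z * cnj x) + of_real r * cnj z * (w x * x / (1 - of_real r * cnj z * x)) \<partial>arc_measure)"
    by (rule Bochner_Integration.integral_cong)
       (auto simp: poisson_kernel_eq[OF r z] space_arc_measure distrib_left)
  also have "\<dots> = (\<integral>x. w x / (1 - of_real r * z * cnj x) \<partial>arc_measure)
     + of_real r * cnj z * (\<integral>x. w x * x / (1 - of_real r * cnj z * x) \<partial>arc_measure)"
    by (subst Bochner_Integration.integral_add) (simp_all only: i1 i2 integrable_mult_right integral_mult_right_zero)
  finally show ?thesis using 0 by simp
qed

lemma integral_poisson_kernel:
  assumes r: "0 \<le> r" "r < 1" and z: "norm z = 1"
  shows "(\<integral>x. poisson_kernel r z x \<partial>arc_measure) = 1"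
proof -
  have "(\<integral>x. x ^ n \<partial>arc_measure) = 0" if "n \<ge> 1" for n
    using integral_arc_power_cnj[of n 0] that by simp
  from poisson_integral[OF _ _ r z, of "\<lambda>_. 1"] this
  have "(\<integral>x. of_real (poisson_kernel r z x) \<partial>arc_measure) = (\<integral>x. 1 / (1 - of_real r * z * cnj x) \<partial>arc_measure)"
    by simp
  also have "\<dots> = (1::complex)" using arc_cauchy_power[of "of_real r * z" 0] r z by (simp add: norm_mult)
  finally have "of_real (\<integral>x. poisson_kernel r z x \<partial>arc_measure) = (1::complex)" by simp
  then show ?thesis by (simp only: of_real_eq_1_iff)
qed

lemma integrable_mult_poisson_kernel:
  fixes t :: "complex \<Rightarrow> real"
  assumes t: "integrable arc_measure t" and r: "0 \<le> r" "r < 1" and z: "norm z = 1"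
  shows "integrable arc_measure (\<lambda>x. t x * poisson_kernel r z x)"
proof (rule Bochner_Integration.integrable_bound)
  have [measurable]: "t \<in> borel_measurable arc_measure" using t by auto
  show "integrable arc_measure (\<lambda>x. 1 / (1 - r)\<^sup>2 * t x)" using t by auto
  show "(\<lambda>x. t x * poisson_kernel r z x) \<in> borel_measurable arc_measure" by measurable
  show "AE x in arc_measure. norm (t x * poisson_kernel r z x) \<le> norm (1 / (1 - r)\<^sup>2 * t x)"
    using AE_arc_norm
  proof eventually_elim
    case (elim x)
    have "\<bar>t x\<bar> * poisson_kernel r z x \<le> \<bar>t x\<bar> * (1 / (1 - r)\<^sup>2)"
      by (intro mult_left_mono poisson_kernel_bound r z elim) auto
    then show ?case using poisson_kernel_nonneg[OF r] by (simp add: abs_mult)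
  qed
qed

text \<open>Jensen's inequality bounds the integrand at z by the Poisson integral of
  \<open>norm (w x) powr p\<close>. After exchanging the integrations, symmetry of the kernel shows
  that it has mass 1 in z as well.\<close>

lemma cauchy_transform_means_le:
  fixes w :: "complex \<Rightarrow> complex" and p :: real
  assumes p: "p \<ge> 1" and w [measurable]: "w \<in> borel_measurable arc_measure"
    and int: "integrable arc_measure (\<lambda>z. norm (w z) powr p)"
    and neg: "\<And>n. n \<ge> 1 \<Longrightarrow> (\<integral>z. w z * z ^ n \<partial>arc_measure) = 0"
    and r: "0 \<le> r" "r < 1"
  shows "(\<integral>z. norm (\<integral>x. w x / (1 - of_real r * z * cnj x) \<partial>arc_measure) powr p \<partial>arc_measure)
    \<le> (\<integral>z. norm (w z) powr p \<partial>arc_measure)" (is "(\<integral>z. ?W z \<partial>_) \<le> ?I")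
\<comment> \<open>A function that is not integrable has integral 0 by convention, so that case is
  trivial. The distinction also spares a proof that the inner integral depends measurably on
  z.\<close>
proof (cases "integrable arc_measure ?W")
  case True
  have wi: "integrable arc_measure w" by (rule integrable_arc_of_powr[OF w int p])
  have le: "?W z \<le> (\<integral>x. norm (w x) powr p * poisson_kernel r z x \<partial>arc_measure)" if z: "norm z = 1" for z
  proof -
    note nonneg = poisson_kernel_nonneg[OF r]
    have "norm (\<integral>x. w x / (1 - of_real r * z * cnj x) \<partial>arc_measure) \<le> (\<integral>x. norm (w x) * poisson_kernel r z x \<partial>arc_measure)"
      by (subst poisson_integral[OF wi neg r z], assumption, rule order_trans[OF integral_norm_bound])
         (simp add: norm_mult nonneg)
    then have "?W z \<le> (\<integral>x. norm (w x) * poisson_kernel r z x \<partial>arc_measure) powr p"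
      using p by (intro powr_mono2) auto
    also have "\<dots> \<le> (\<integral>x. norm (w x) powr p * poisson_kernel r z x \<partial>arc_measure)"
      using integrable_mult_poisson_kernel[of "\<lambda>_. 1", OF _ r z] wi int
      by (intro jensen_powr_weighted[OF p] integrable_mult_poisson_kernel integral_poisson_kernel r z nonneg) auto
    finally show ?thesis .
  qed
  interpret pair_sigma_finite arc_measure arc_measure ..
  \<comment> \<open>Nonnegative integrals can be exchanged without first establishing integrability
    on the product.\<close>
  have "ennreal (\<integral>z. ?W z \<partial>arc_measure) = (\<integral>\<^sup>+z. ennreal (?W z) \<partial>arc_measure)"
    by (rule nn_integral_eq_integral[symmetric, OF True]) auto
  also have "\<dots> \<le> (\<integral>\<^sup>+z. \<integral>\<^sup>+x. ennreal (norm (w x) powr p * poisson_kernel r z x) \<partial>arc_measure \<partial>arc_measure)"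
  proof (rule nn_integral_mono)
    fix z assume "z \<in> space arc_measure"
    then have z: "norm z = 1" by (simp add: space_arc_measure)
    have "(\<integral>\<^sup>+x. ennreal (norm (w x) powr p * poisson_kernel r z x) \<partial>arc_measure)
      = ennreal (\<integral>x. norm (w x) powr p * poisson_kernel r z x \<partial>arc_measure)"
      by (rule nn_integral_eq_integral[OF integrable_mult_poisson_kernel[OF int r z]])
         (auto simp: poisson_kernel_nonneg[OF r])
    then show "ennreal (?W z) \<le> (\<integral>\<^sup>+x. ennreal (norm (w x) powr p * poisson_kernel r z x) \<partial>arc_measure)"
      using le[OF z] by (simp add: ennreal_leI)
  qed
  also have "\<dots> = (\<integral>\<^sup>+x. \<integral>\<^sup>+z. ennreal (norm (w x) powr p * poisson_kernel r z x) \<partial>arc_measure \<partial>arc_measure)"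
    by (rule Fubini'[symmetric]) measurable
  also have "\<dots> = (\<integral>\<^sup>+x. ennreal (norm (w x) powr p) \<partial>arc_measure)"
  proof (rule nn_integral_cong)
    fix x assume "x \<in> space arc_measure"
    then have x: "norm x = 1" by (simp add: space_arc_measure)
    have "(\<integral>\<^sup>+z. ennreal (norm (w x) powr p * poisson_kernel r x z) \<partial>arc_measure)
      = ennreal (\<integral>z. norm (w x) powr p * poisson_kernel r x z \<partial>arc_measure)"
      by (rule nn_integral_eq_integral[OF integrable_mult_poisson_kernel[OF _ r x]])
         (auto simp: poisson_kernel_nonneg[OF r])
    then show "(\<integral>\<^sup>+z. ennreal (norm (w x) powr p * poisson_kernel r z x) \<partial>arc_measure) = ennreal (norm (w x) powr p)"
      by (simp add: integral_poisson_kernel[OF r x] poisson_kernel_commute[of r _ x])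
  qed
  also have "\<dots> = ennreal ?I" by (rule nn_integral_eq_integral[OF int]) auto
  finally show ?thesis by (simp add: ennreal_le_iff)
qed (simp add: not_integrable_integral_eq)

text \<open>The only possible extension of w is F z / (z - a), but the factor 1 / (z - a) is
  unbounded near a, so bounds for F do not carry over. Its means are controlled by recognizing it as
  the Cauchy integral of w, to which \<open>cauchy_transform_means_le\<close> applies.\<close>

lemma smirnov_linear_factor:
  fixes w f F :: "complex \<Rightarrow> complex" and p :: real
  assumes p: "p > 1" and hb: "hardy_boundary p C F f"
    and w [measurable]: "w \<in> borel_measurable arc_measure" and intw: "integrable arc_measure (\<lambda>z. norm (w z) powr p)"
    and a: "norm a = 1" and eq: "AE z in arc_measure. (z - a) * w z = f z"
  shows "hardy_boundary p (\<integral>z. norm (w z) powr p \<partial>arc_measure) (\<lambda>z. F z / (z - a)) w"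
proof -
  have a0: "a \<noteq> 0" using a by auto
  note f = hardy_boundaryD(1,2)[OF hb] and F = hardy_boundaryD(3)[OF hb] and lim = hardy_boundaryD(5)[OF hb]
  note [measurable] = f(1)
  have wi: "integrable arc_measure w" using p by (intro integrable_arc_of_powr[OF w intw]) auto
  have fi: "integrable arc_measure f" using p by (intro integrable_arc_of_powr[OF f]) auto
  have wn: "integrable arc_measure (\<lambda>z. w z * z ^ n)" for n
    by (rule integrable_arc_mult_bounded[OF wi, where B = 1]) (auto simp: norm_power)
  define c where "c n = (\<integral>z. w z * z ^ n \<partial>arc_measure)" for n
  \<comment> \<open>The index 0 is excluded because the mean of f need not vanish; the recursion
    therefore starts from \<open>c 1\<close>.\<close>
  have rec: "c (Suc n) = a * c n" if n: "n \<ge> 1" for n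
  proof -
    have "c (Suc n) - a * c n = (\<integral>z. w z * z ^ Suc n - a * (w z * z ^ n) \<partial>arc_measure)"
      unfolding c_def integral_mult_right_zero[symmetric]
      by (rule Bochner_Integration.integral_diff[symmetric]) (intro wn integrable_mult_right)+
    also have "\<dots> = (\<integral>z. f z * z ^ n \<partial>arc_measure)"
    proof (rule integral_cong_AE)
      show "AE z in arc_measure. w z * z ^ Suc n - a * (w z * z ^ n) = f z * z ^ n"
        using eq
      proof eventually_elim
        case (elim z)
        have "w z * z ^ Suc n - a * (w z * z ^ n) = ((z - a) * w z) * z ^ n" by (simp add: algebra_simps)
        then show ?case using elim by simp
      qed
    qed measurable
    also have "\<dots> = 0" by (rule hardy_negative_coeff[OF p hb n])
    finally show ?thesis by simp
  qed
  have "c 1 = 0"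
  proof -
    have ci: "c (Suc n) = a ^ n * c 1" for n
      by (induction n) (auto simp: rec)
    have "(\<integral>z. (w z * z) * (z / a) ^ n \<partial>arc_measure) = c 1" for n
    proof -
      have "(\<integral>z. (w z * z) * (z / a) ^ n \<partial>arc_measure) = (\<integral>z. (w z * z ^ Suc n) / a ^ n \<partial>arc_measure)"
        by (simp add: power_divide mult.assoc)
      also have "\<dots> = c (Suc n) / a ^ n" unfolding c_def by (rule integral_divide_zero)
      finally show ?thesis using ci[of n] a0 by simp
    qed
    then show ?thesis
      by (rule integral_arc_mult_power_const_imp_0[rotated -1])
         (use wn[of 1] a AE_arc_neq[of a] a0 in \<open>auto simp: norm_divide\<close>)
  qed
  have neg: "(\<integral>z. w z * z ^ n \<partial>arc_measure) = 0" if "n \<ge> 1" for n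
    using that unfolding c_def[symmetric]
    by (induction n rule: nat_induct_at_least) (auto simp: rec \<open>c 1 = 0\<close>[simplified])
  \<comment> \<open>On the circle z - a = (b - a) + z * (1 - b * cnj z). Division by 1 - b * cnj z
    splits the Cauchy integral of f into b - a times that of w and the moment \<open>c 1\<close>,
    which is 0.\<close>
  have FW: "F b / (b - a) = (\<integral>x. w x / (1 - b * cnj x) \<partial>arc_measure)" if b: "norm b < 1" for b
  proof -
    have "F b = (\<integral>z. f z / (1 - b * cnj z) \<partial>arc_measure)"
      by (rule hardy_cauchy[OF p hb b, symmetric])
    also have "\<dots> = (\<integral>z. (b - a) * (w z / (1 - b * cnj z)) + w z * z \<partial>arc_measure)"
    proof (rule integral_cong_AE)
      show "AE z in arc_measure. f z / (1 - b * cnj z) = (b - a) * (w z / (1 - b * cnj z)) + w z * z"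
        using eq AE_arc_norm
      proof eventually_elim
        case (elim z)
        have "1 - b * cnj z \<noteq> 0" using arc_cauchy_denom_ge[OF elim(2), of b] b by auto
        moreover have "cnj z * z = 1" using elim complex_norm_square[of z] by (simp add: mult.commute)
        then have "(b - a) * w z + w z * z * (1 - b * cnj z) = (z - a) * w z"
          by (simp add: algebra_simps)
        ultimately show ?case unfolding elim(1)[symmetric]
          by (metis add_divide_distrib nonzero_mult_div_cancel_right times_divide_eq_right)
      qed
    qed measurable
    also have "\<dots> = (b - a) * (\<integral>z. w z / (1 - b * cnj z) \<partial>arc_measure) + (\<integral>z. w z * z ^ 1 \<partial>arc_measure)"
      using wn[of 1] by (subst Bochner_Integration.integral_add)
        (simp_all only: integrable_arc_cauchy[OF wi b] integrable_mult_right integral_mult_right_zero power_one_right)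
    also have "(\<integral>z. w z * z ^ 1 \<partial>arc_measure) = 0" by (rule neg) simp
    finally show ?thesis using b a by auto
  qed
  show ?thesis
  proof (rule hardy_boundaryI[OF w intw])
    show "(\<lambda>z. F z / (z - a)) holomorphic_on ball 0 1"
      using a by (intro holomorphic_intros F) auto
    show "\<forall>r\<in>{0..<1}. (\<integral>z. norm (F (of_real r * z) / (of_real r * z - a)) powr p \<partial>arc_measure)
             \<le> (\<integral>z. norm (w z) powr p \<partial>arc_measure)"
    proof
      fix r :: real assume "r \<in> {0..<1}"
      then have r: "0 \<le> r" "r < 1" by auto
      have "(\<integral>z. norm (F (of_real r * z) / (of_real r * z - a)) powr p \<partial>arc_measure)
        = (\<integral>z. norm (\<integral>x. w x / (1 - of_real r * z * cnj x) \<partial>arc_measure) powr p \<partial>arc_measure)"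
        using r by (intro Bochner_Integration.integral_cong) (auto simp: FW space_arc_measure norm_mult)
      also have "\<dots> \<le> (\<integral>z. norm (w z) powr p \<partial>arc_measure)"
        using p by (intro cauchy_transform_means_le[OF _ w intw neg r]) auto
      finally show "(\<integral>z. norm (F (of_real r * z) / (of_real r * z - a)) powr p \<partial>arc_measure)
             \<le> (\<integral>z. norm (w z) powr p \<partial>arc_measure)" .
    qed
    show "AE z in arc_measure. ((\<lambda>r. F (of_real r * z) / (of_real r * z - a)) \<longlongrightarrow> w z) (at_left (1::real))"
      using eq lim AE_arc_neq[of a]
    proof eventually_elim
      case (elim z)
      have "((\<lambda>r. F (of_real r * z) / (of_real r * z - a)) \<longlongrightarrow> f z / (of_real 1 * z - a)) (at_left (1::real))"
        using elim by (intro tendsto_intros) auto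
      moreover have "f z / (of_real 1 * z - a) = w z" using elim(1,3) by (simp add: field_simps)
      ultimately show ?case by simp
    qed
  qed
qed


section \<open>Multiplication by rational functions\<close>

text \<open>A total constructor for classes: every class has this form by
  \<open>circ_of_cases\<close>, so later arguments choose representatives instead of transferring.
  Nonmeasurable functions, which have no class, are sent to 0.\<close>

lift_definition circ_of :: "(complex \<Rightarrow> complex) \<Rightarrow> circ_fun" is
  "\<lambda>f. if f \<in> borel_measurable arc_measure then f else (\<lambda>_. 0)"
  by (auto simp: ae_eq_def)

lemma circ_of_cases:
  obtains f where "f \<in> borel_measurable arc_measure" "x = circ_of f"
proof -
  have "\<exists>f. f \<in> borel_measurable arc_measure \<and> x = circ_of f"
  proof (transfer)
    fix x assume "ae_eq x x"
    then show "\<exists>f. f \<in> borel_measurable arc_measure \<and> ae_eq x (if f \<in> borel_measurable arc_measure then f else (\<lambda>_. 0))"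
      by (intro exI[of _ x]) (auto simp: ae_eq_def)
  qed
  then show ?thesis using that by blast
qed

context
  fixes f g :: "complex \<Rightarrow> complex"
  assumes f [measurable]: "f \<in> borel_measurable arc_measure"
    and g [measurable]: "g \<in> borel_measurable arc_measure"
begin

lemma circ_of_eq_iff: "circ_of f = circ_of g \<longleftrightarrow> (AE z in arc_measure. f z = g z)"
  using f g by transfer (simp add: ae_eq_def)

lemma circ_of_add: "circ_of f + circ_of g = circ_of (\<lambda>z. f z + g z)"
  using f g by transfer (auto simp: ae_eq_def)

lemma circ_of_diff: "circ_of f - circ_of g = circ_of (\<lambda>z. f z - g z)"
  using f g by transfer (auto simp: ae_eq_def)

lemma circ_of_mult: "circ_of f * circ_of g = circ_of (\<lambda>z. f z * g z)"
  using f g by transfer (auto simp: ae_eq_def)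

end

lemma zero_circ_of: "0 = circ_of (\<lambda>_. 0)"
  by transfer (simp add: ae_eq_def)

context
  fixes f :: "complex \<Rightarrow> complex"
  assumes f [measurable]: "f \<in> borel_measurable arc_measure"
begin

lemma circ_of_scale: "scale_circ c (circ_of f) = circ_of (\<lambda>z. c * f z)"
  using f by transfer (auto simp: ae_eq_def)

lemma circ_of_in_Lp: "circ_of f \<in> Lp p \<longleftrightarrow> integrable arc_measure (\<lambda>z. norm (f z) powr p)"
  unfolding Lp_def mem_Collect_eq using f by transfer auto

lemma Lp_norm_circ_of: "Lp_norm p (circ_of f) = (\<integral>z. norm (f z) powr p \<partial>arc_measure) powr (1 / p)"
  using f by transfer auto

lemma fourier_coeff_circ_of: "fourier_coeff (circ_of f) n = (\<integral>z. f z * z powi (- n) \<partial>arc_measure)"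
  using f by transfer auto

lemma boundary_value_circ_of:
  "boundary_value F (circ_of f) \<longleftrightarrow>
     (AE z in arc_measure. ((\<lambda>r. F (of_real r * z)) \<longlongrightarrow> f z) (at_left (1::real)))"
  using f by transfer auto

end

lemma measurable_poly_arc [measurable]: "poly P \<in> borel_measurable arc_measure"
  by (intro measurable_arc_continuous continuous_intros)

lemma measurable_rat_eval [measurable]: "rat_eval r \<in> borel_measurable arc_measure"
  unfolding rat_eval_def[abs_def] by measurable

lemma rat_circ_circ_of: "rat_circ r = circ_of (rat_eval r)"
  using measurable_rat_eval[of r] by transfer (simp add: ae_eq_def)

lemma AE_arc_poly_neq_0: "P \<noteq> 0 \<Longrightarrow> AE z in arc_measure. poly P z \<noteq> 0"
  using AE_arc_notin[OF poly_roots_finite[of P]] by simp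

section \<open>Rational functions as elements of the ring of circle functions\<close>

lemma rat_num_den: "to_fract (rat_num r) / to_fract (rat_den r) = r" "rat_den r \<noteq> 0"
  by (simp_all add: rat_num_def rat_den_def flip: Fract_conv_to_fract)

lemma rat_num_den_cross:
  assumes "D \<noteq> 0"
  shows "rat_num (to_fract N / to_fract D) * D = N * rat_den (to_fract N / to_fract D)"
proof -
  have "to_fract (rat_num (to_fract N / to_fract D)) * to_fract D = to_fract N * to_fract (rat_den (to_fract N / to_fract D))"
    using rat_num_den[of "to_fract N / to_fract D"] assms by (metis frac_eq_eq to_fract_eq_0_iff)
  then show ?thesis by (simp flip: to_fract_mult)
qed

lemma coprime_rat_num_den: "coprime (rat_num r) (rat_den r)"
  unfolding rat_num_def rat_den_def by (rule coprime_quot_of_fract)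

lemma rat_den_dvd: "D \<noteq> 0 \<Longrightarrow> rat_den (to_fract N / to_fract D) dvd D"
  using rat_num_den_cross[of D N] coprime_rat_num_den[of "to_fract N / to_fract D"]
  by (metis coprime_commute coprime_dvd_mult_right_iff dvd_triv_right)

lemma rat_eval_quotient:
  assumes "poly D z \<noteq> 0"
  shows "rat_eval (to_fract N / to_fract D) z = poly N z / poly D z"
proof -
  let ?r = "to_fract N / to_fract D"
  have D: "D \<noteq> 0" using assms by auto
  from rat_den_dvd[OF D] have "poly (rat_den ?r) z \<noteq> 0"
    using assms by (metis dvd_def mult_eq_0_iff poly_mult)
  moreover have "poly (rat_num ?r) z * poly D z = poly N z * poly (rat_den ?r) z"
    by (metis D poly_mult rat_num_den_cross)
  ultimately show ?thesis using assms by (simp add: rat_eval_def frac_eq_eq)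
qed

lemma rat_eval_to_fract: "rat_eval (to_fract N) z = poly N z"
  using rat_eval_quotient[of 1 z N] by simp

lemma rat_cases:
  obtains N D where "r = to_fract N / to_fract D" "D \<noteq> (0 :: complex poly)"
  using rat_num_den[of r] by metis

abbreviation poly_circ :: "complex poly \<Rightarrow> circ_fun" where
  "poly_circ P \<equiv> rat_circ (to_fract P)"

lemma poly_circ_eq: "poly_circ P = circ_of (poly P)"
  by (simp add: rat_circ_circ_of rat_eval_to_fract[abs_def] ext)

text \<open>Additivity of \<open>rat_eval\<close> can fail at poles, where its value is 0 by
  convention. There are finitely many of them, so they form a null set, and \<open>rat_circ\<close>
  is a ring homomorphism on the field of fractions.\<close>

lemma rat_circ_add: "rat_circ (r + s) = rat_circ r + rat_circ s"
proof -
  obtain N D N' D' where *: "r = to_fract N / to_fract D" "D \<noteq> 0" "s = to_fract N' / to_fract D'" "D' \<noteq> 0"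
    by (metis rat_cases)
  have rs: "r + s = to_fract (N * D' + N' * D) / to_fract (D * D')"
    using * by (simp add: add_frac_eq)
  have "AE z in arc_measure. rat_eval (r + s) z = rat_eval r z + rat_eval s z"
    using AE_arc_poly_neq_0[OF *(2)] AE_arc_poly_neq_0[OF *(4)]
    unfolding rs unfolding *
    by eventually_elim (simp add: rat_eval_quotient add_frac_eq del: to_fract_mult to_fract_add)
  then show ?thesis
    by (simp add: rat_circ_circ_of circ_of_add circ_of_eq_iff)
qed

lemma rat_circ_mult: "rat_circ (r * s) = rat_circ r * rat_circ s"
proof -
  obtain N D N' D' where *: "r = to_fract N / to_fract D" "D \<noteq> 0" "s = to_fract N' / to_fract D'" "D' \<noteq> 0"
    by (metis rat_cases)
  have rs: "r * s = to_fract (N * N') / to_fract (D * D')"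
    using * by simp
  have "AE z in arc_measure. rat_eval (r * s) z = rat_eval r z * rat_eval s z"
    using AE_arc_poly_neq_0[OF *(2)] AE_arc_poly_neq_0[OF *(4)]
    unfolding rs unfolding *
    by eventually_elim (simp add: rat_eval_quotient del: to_fract_mult)
  then show ?thesis
    by (simp add: rat_circ_circ_of circ_of_mult circ_of_eq_iff)
qed

lemma rat_circ_0 [simp]: "rat_circ 0 = 0"
  using rat_circ_add[of 0 0] by simp

lemma rat_circ_minus: "rat_circ (- r) = - rat_circ r"
  using rat_circ_add[of r "- r"] by (simp add: eq_neg_iff_add_eq_0 add.commute)

lemma rat_circ_diff: "rat_circ (r - s) = rat_circ r - rat_circ s"
  using rat_circ_add[of r "- s"] by (simp add: rat_circ_minus)

lemma rat_circ_1_mult [simp]: "rat_circ 1 * x = x"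
proof -
  obtain f where [measurable]: "f \<in> borel_measurable arc_measure" and x: "x = circ_of f" by (rule circ_of_cases)
  have "rat_eval 1 z = 1" for z using rat_eval_to_fract[of 1 z] by simp
  then show ?thesis by (simp add: x rat_circ_circ_of circ_of_mult)
qed

lemma rat_circ_mult_assoc: "rat_circ r * (rat_circ s * x) = rat_circ (r * s) * x"
  by (simp add: rat_circ_mult mult.assoc)

text \<open>Zeros and poles on the circle are no obstruction here, as x and y range over all classes
  of measurable functions. Only membership in L^p or H^p can be lost by such a division.\<close>

lemma rat_circ_mult_eq_iff:
  assumes "r \<noteq> 0"
  shows "rat_circ r * x = y \<longleftrightarrow> x = rat_circ (1 / r) * y"
proof -
  have "rat_circ (1 / r) * (rat_circ r * x) = x" "rat_circ r * (rat_circ (1 / r) * y) = y"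
    using assms by (simp_all add: rat_circ_mult_assoc)
  then show ?thesis by metis
qed

lemma rat_circ_mult_cancel:
  "r \<noteq> 0 \<Longrightarrow> rat_circ r * x = rat_circ r * y \<longleftrightarrow> x = y"
  by (simp add: rat_circ_mult_eq_iff rat_circ_mult_assoc)

lemma rat_circ_mult_eq_0_iff: "r \<noteq> 0 \<Longrightarrow> rat_circ r * x = 0 \<longleftrightarrow> x = 0"
  using rat_circ_mult_cancel[of r x 0] by simp

lemma rat_circ_eq_iff [simp]: "rat_circ r = rat_circ s \<longleftrightarrow> r = s"
proof
  assume "rat_circ r = rat_circ s"
  then have 0: "rat_circ (r - s) * rat_circ 1 = 0" by (simp add: rat_circ_diff mult.commute)
  have "rat_circ 1 \<noteq> 0"
  proof
    assume "rat_circ 1 = 0"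
    moreover have "rat_eval 1 = (\<lambda>_. 1)" using rat_eval_to_fract[of 1] by auto
    ultimately have "circ_of (\<lambda>_. 1) = circ_of (\<lambda>_. 0)" by (simp add: rat_circ_circ_of zero_circ_of)
    then have "AE z in arc_measure. (1::complex) = 0" by (subst (asm) circ_of_eq_iff) auto
    then show False by (simp add: arc_measure.AE_False)
  qed
  with 0 show "r = s" using rat_circ_mult_eq_0_iff[of "r - s"] by force
qed simp

lemma scale_circ_eq: "scale_circ c x = poly_circ [:c:] * x"
proof -
  obtain f where [measurable]: "f \<in> borel_measurable arc_measure" and x: "x = circ_of f" by (rule circ_of_cases)
  show ?thesis by (simp add: x poly_circ_eq circ_of_mult circ_of_scale)
qed

lemma rat_poles_quotient:
  assumes "poly D z \<noteq> 0"
  shows "z \<notin> rat_poles (to_fract N / to_fract D)"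
  unfolding rat_poles_def mem_Collect_eq using rat_den_dvd[of D N] assms
  by (metis dvd_trans poly_0 poly_eq_0_iff_dvd)


section \<open>Closure properties of \<open>L\<^sup>p\<close> and \<open>H\<^sup>p\<close>\<close>

lemma Lp_dominated:
  assumes [measurable]: "f \<in> borel_measurable arc_measure" "g \<in> borel_measurable arc_measure"
    and p: "p \<ge> 1" and B: "B \<ge> 0" and g: "circ_of g \<in> Lp p"
    and le: "AE z in arc_measure. norm (f z) \<le> B * norm (g z)"
  shows "circ_of f \<in> Lp p" and "Lp_norm p (circ_of f) \<le> B * Lp_norm p (circ_of g)"
proof -
  have ig: "integrable arc_measure (\<lambda>z. norm (g z) powr p)" using g by (simp add: circ_of_in_Lp)
  have le': "AE z in arc_measure. norm (f z) powr p \<le> B powr p * norm (g z) powr p"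
    using le
  proof eventually_elim
    case (elim z)
    then have "norm (f z) powr p \<le> (B * norm (g z)) powr p" using p by (intro powr_mono2) auto
    then show ?case using B by (simp add: powr_mult)
  qed
  have if': "integrable arc_measure (\<lambda>z. norm (f z) powr p)"
    by (rule Bochner_Integration.integrable_bound[of _ "\<lambda>z. B powr p * norm (g z) powr p"])
       (use ig le' in auto)
  then show "circ_of f \<in> Lp p" by (simp add: circ_of_in_Lp)
  have "(\<integral>z. norm (f z) powr p \<partial>arc_measure) \<le> (\<integral>z. B powr p * norm (g z) powr p \<partial>arc_measure)"
    using if' ig le' by (intro integral_mono_AE) auto
  then have "(\<integral>z. norm (f z) powr p \<partial>arc_measure) powr (1 / p)
      \<le> (B powr p * (\<integral>z. norm (g z) powr p \<partial>arc_measure)) powr (1 / p)"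
    using p by (intro powr_mono2) auto
  also have "\<dots> = B * (\<integral>z. norm (g z) powr p \<partial>arc_measure) powr (1 / p)"
    using B p by (simp add: powr_mult powr_powr)
  finally show "Lp_norm p (circ_of f) \<le> B * Lp_norm p (circ_of g)" by (simp add: Lp_norm_circ_of)
qed

lemma Lp_mult_bounded:
  assumes [measurable]: "\<phi> \<in> borel_measurable arc_measure" and p: "p \<ge> 1" and x: "x \<in> Lp p"
    and B: "AE z in arc_measure. norm (\<phi> z) \<le> B" "B \<ge> 0"
  shows "circ_of \<phi> * x \<in> Lp p" and "Lp_norm p (circ_of \<phi> * x) \<le> B * Lp_norm p x"
proof -
  obtain f where f [measurable]: "f \<in> borel_measurable arc_measure" and xf: "x = circ_of f" by (rule circ_of_cases)
  have "AE z in arc_measure. norm (\<phi> z * f z) \<le> B * norm (f z)"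
    using B(1) by eventually_elim (simp add: norm_mult mult_right_mono)
  from Lp_dominated[OF _ f p B(2) _ this] x
  show "circ_of \<phi> * x \<in> Lp p" "Lp_norm p (circ_of \<phi> * x) \<le> B * Lp_norm p x"
    by (simp_all add: xf circ_of_mult)
qed

lemma zero_in_Lp [simp]: "p \<ge> 1 \<Longrightarrow> 0 \<in> Lp p"
  by (simp add: zero_circ_of circ_of_in_Lp)

lemma Lp_norm_0 [simp]: "p \<ge> 1 \<Longrightarrow> Lp_norm p 0 = 0"
  by (simp add: Lp_norm_eq_0)

lemma Lp_add:
  assumes "p \<ge> 1" "x \<in> Lp p" "y \<in> Lp p"
  shows "x + y \<in> Lp p"
  using Lp_minus[OF assms(1,2) Lp_minus[OF assms(1) zero_in_Lp[OF assms(1)] assms(3)]] by simp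

lemma Lp_norm_diff_le:
  assumes "p \<ge> 1" "x \<in> Lp p" "y \<in> Lp p"
  shows "Lp_norm p (x - y) \<le> Lp_norm p x + Lp_norm p y"
  using Lp_norm_triangle[OF assms(1,2) Lp_minus[OF assms(1) zero_in_Lp[OF assms(1)] assms(3)]] Lp_norm_minus_self[of p y] by simp

lemma circ_of_continuous_in_Lp:
  assumes "continuous_on (sphere 0 1) \<phi>" "p \<ge> 1"
  shows "circ_of \<phi> \<in> Lp p"
  using assms integrable_arc_continuous_powr[of \<phi> p] by (simp add: circ_of_in_Lp measurable_arc_continuous)

lemma rat_eval_continuous:
  assumes "rat_poles r \<inter> S = {}"
  shows "continuous_on S (rat_eval r)"
  unfolding rat_eval_def[abs_def] using assms by (intro continuous_intros) (auto simp: rat_poles_def)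

lemma rat_circ_Lp_bounded:
  assumes "rat_poles r \<inter> sphere 0 1 = {}" "p \<ge> 1"
  obtains B where "B \<ge> 0" "\<And>x. x \<in> Lp p \<Longrightarrow> rat_circ r * x \<in> Lp p \<and> Lp_norm p (rat_circ r * x) \<le> B * Lp_norm p x"
proof -
  obtain B where B: "B \<ge> 0" "\<And>z. norm z = 1 \<Longrightarrow> norm (rat_eval r z) \<le> B"
    using arc_continuous_bounded[OF rat_eval_continuous[OF assms(1)]] by blast
  have "AE z in arc_measure. norm (rat_eval r z) \<le> B" using AE_arc_norm B(2) by (auto elim: eventually_mono)
  from that[OF B(1)] Lp_mult_bounded[OF measurable_rat_eval assms(2) _ this B(1)]
  show ?thesis by (simp add: rat_circ_circ_of)
qed

lemma rat_circ_mult_in_Lp: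
  "rat_poles r \<inter> sphere 0 1 = {} \<Longrightarrow> p \<ge> 1 \<Longrightarrow> x \<in> Lp p \<Longrightarrow> rat_circ r * x \<in> Lp p"
  by (meson rat_circ_Lp_bounded)

lemma rat_circ_in_Lp: "rat_poles r \<inter> sphere 0 1 = {} \<Longrightarrow> p \<ge> 1 \<Longrightarrow> rat_circ r \<in> Lp p"
  by (simp add: rat_circ_circ_of circ_of_continuous_in_Lp rat_eval_continuous)

lemma rat_poles_to_fract [simp]: "rat_poles (to_fract P) = {}"
  using rat_poles_quotient[of 1 _ P] by auto

text \<open>For \<open>x\<close> in \<open>H\<^sup>p\<close> this is the value at \<open>a\<close> of the holomorphic extension of \<open>x\<close>.\<close>

lift_definition cauchy_at :: "circ_fun \<Rightarrow> complex \<Rightarrow> complex" is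
  "\<lambda>f a. \<integral>z. f z / (1 - a * cnj z) \<partial>arc_measure"
  by (intro ext integral_cong_AE) (auto simp: ae_eq_def)

lemma cauchy_at_circ_of:
  "f \<in> borel_measurable arc_measure \<Longrightarrow> cauchy_at (circ_of f) a = (\<integral>z. f z / (1 - a * cnj z) \<partial>arc_measure)"
  by transfer auto

lemma Hp_in_Lp: "x \<in> Hp p \<Longrightarrow> x \<in> Lp p"
  by (simp add: Hp_def)

lemma Hp_cases:
  assumes "x \<in> Hp p"
  obtains f F C where "x = circ_of f" "hardy_boundary p C F f"
proof -
  obtain f where f: "f \<in> borel_measurable arc_measure" and x: "x = circ_of f" by (rule circ_of_cases)
  from assms obtain F where F: "F \<in> hardy_disc p" "boundary_value F x" by (auto simp: Hp_def)
  then obtain C where "hardy_boundary p C F f"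
    using assms f by (auto simp: hardy_boundary_def hardy_disc_def Hp_def x circ_of_in_Lp boundary_value_circ_of)
  then show ?thesis by (rule that[OF x])
qed

lemma HpI: "hardy_boundary p C F f \<Longrightarrow> circ_of f \<in> Hp p"
  by (auto simp: hardy_boundary_def Hp_def circ_of_in_Lp hardy_disc_def boundary_value_circ_of intro!: bexI[of _ F])

text \<open>The Cauchy integral equals the extension in the disc, and the extension determines the
  boundary function through its radial limits.\<close>

lemma Hp_eqI:
  assumes p: "p > 1" and x: "x \<in> Hp p" and y: "y \<in> Hp p"
    and eq: "\<And>a. norm a < 1 \<Longrightarrow> cauchy_at x a = cauchy_at y a"
  shows "x = y"
proof -
  from x obtain f F C where f_eq: "x = circ_of f" and f_hb: "hardy_boundary p C F f" by (rule Hp_cases)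
  note f = hardy_boundaryD[OF f_hb]
  from y obtain g G D where g_eq: "y = circ_of g" and g_hb: "hardy_boundary p D G g" by (rule Hp_cases)
  note g = hardy_boundaryD[OF g_hb]
  have FG: "F a = G a" if "norm a < 1" for a
    using eq[OF that] hardy_cauchy[OF p f_hb that] hardy_cauchy[OF p g_hb that] f(1) f_eq g(1) g_eq
    by (simp add: cauchy_at_circ_of)
  have "AE z in arc_measure. f z = g z"
    using f(5) g(5) AE_arc_norm
  proof eventually_elim
    case (elim z)
    have "\<forall>\<^sub>F r in at_left (1::real). G (of_real r * z) = F (of_real r * z)"
      using eventually_at_left_real[of 0 "1::real"]
      by (auto elim!: eventually_mono simp: FG elim norm_mult)
    with elim(2) have "((\<lambda>r. F (of_real r * z)) \<longlongrightarrow> g z) (at_left (1::real))"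
      by (simp cong: tendsto_cong add: tendsto_cong)
    with elim(1) show ?case by (intro tendsto_unique) auto
  qed
  then show ?thesis using f(1) f_eq g(1) g_eq by (simp add: circ_of_eq_iff)
qed

section \<open>Fourier coefficients and the Riesz projection\<close>

lemma cauchy_at_sums:
  assumes x: "x \<in> Lp p" and p: "p \<ge> 1" and a: "norm a < 1"
  shows "(\<lambda>n. a ^ n * fourier_coeff x (int n)) sums cauchy_at x a"
proof -
  obtain f where f: "f \<in> borel_measurable arc_measure" and xf: "x = circ_of f" by (rule circ_of_cases)
  have "integrable arc_measure f"
    using x p f by (intro integrable_arc_of_powr[where p = p]) (auto simp: xf circ_of_in_Lp)
  from integral_arc_geometric[OF this measurable_arc_cnj _ a]
  have "(\<lambda>n. a ^ n * (\<integral>z. f z * cnj z ^ n \<partial>arc_measure)) sums cauchy_at x a"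
    by (simp add: xf cauchy_at_circ_of f)
  moreover have "(\<integral>z. f z * cnj z ^ n \<partial>arc_measure) = fourier_coeff x (int n)" for n
    unfolding xf fourier_coeff_circ_of[OF f]
    by (rule Bochner_Integration.integral_cong) (auto simp: space_arc_measure arc_powi_minus)
  ultimately show ?thesis by simp
qed

lemma fourier_coeff_add:
  assumes "x \<in> Lp p" "y \<in> Lp p" and p: "p \<ge> 1"
  shows "fourier_coeff (x + y) n = fourier_coeff x n + fourier_coeff y n"
proof -
  obtain f where f: "f \<in> borel_measurable arc_measure" and xf: "x = circ_of f" by (rule circ_of_cases)
  obtain g where g: "g \<in> borel_measurable arc_measure" and yg: "y = circ_of g" by (rule circ_of_cases)
  note [measurable] = f g
  have "integrable arc_measure f" "integrable arc_measure g"
    using assms f g by (auto intro!: integrable_arc_of_powr[where p = p] simp: xf yg circ_of_in_Lp)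
  then have "integrable arc_measure (\<lambda>z. f z * z powi (- n))" "integrable arc_measure (\<lambda>z. g z * z powi (- n))"
    by (auto intro!: integrable_arc_mult_bounded[where B = 1] simp: norm_power_int)
  then show ?thesis
    by (simp add: xf yg circ_of_add f g fourier_coeff_circ_of distrib_right)
qed

text \<open>Coefficients of index \<ge> 0 determine the Cauchy integral, hence the member of H^p.
  Any h with the right coefficients thus satisfies the definite description, so it suffices to
  exhibit h for each function that gets projected.\<close>

lemma riesz_proj_eqI:
  assumes p: "p > 1" and h: "h \<in> Hp p" and eq: "\<And>n. n \<ge> 0 \<Longrightarrow> fourier_coeff h n = fourier_coeff f n"
  shows "riesz_proj p f = h"
  unfolding riesz_proj_def
proof (rule the_equality)
  fix h' assume h': "h' \<in> Hp p \<and> (\<forall>n\<ge>0. fourier_coeff h' n = fourier_coeff f n)"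
  show "h' = h"
  proof (rule Hp_eqI[OF p])
    fix a :: complex assume a: "norm a < 1"
    show "cauchy_at h' a = cauchy_at h a"
      using cauchy_at_sums[OF Hp_in_Lp _ a, of h' p] cauchy_at_sums[OF Hp_in_Lp[OF h] _ a] h' eq p
      by (simp add: sums_unique2)
  qed (use h h' in auto)
qed (use h eq in auto)

text \<open>Continuity on the closed disc bounds the multiplier and supplies its radial limits. The
  lemma serves both for rational functions with poles outside the closed disc and for the fractional
  power in \<open>Hp_linear_infinite_codim\<close>.\<close>

lemma Hp_mult_holomorphic:
  assumes p: "p > 1" and x: "x \<in> Hp p" and hol: "\<Phi> holomorphic_on ball 0 1" and cont: "continuous_on (cball 0 1) \<Phi>"
  shows "circ_of \<Phi> * x \<in> Hp p" and "norm a < 1 \<Longrightarrow> cauchy_at (circ_of \<Phi> * x) a = \<Phi> a * cauchy_at x a"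
proof -
  from x obtain f F C where f_eq: "x = circ_of f" and f_hb: "hardy_boundary p C F f" by (rule Hp_cases)
  note f = hardy_boundaryD[OF f_hb]
  have "bounded (\<Phi> ` cball 0 1)"
    by (intro compact_imp_bounded compact_continuous_image cont) auto
  then obtain B where B: "\<And>z. norm z \<le> 1 \<Longrightarrow> norm (\<Phi> z) \<le> B"
    by (metis bounded_iff imageI mem_cball_0)
  have B0: "B \<ge> 0" using order_trans[OF norm_ge_zero B[of 0]] by simp
  have contS: "continuous_on (sphere 0 1) \<Phi>" by (rule continuous_on_subset[OF cont]) auto
  then have m [measurable]: "\<Phi> \<in> borel_measurable arc_measure" by (rule measurable_arc_continuous)
  note [measurable] = f(1)
  have prod: "circ_of \<Phi> * x = circ_of (\<lambda>z. \<Phi> z * f z)" by (simp add: f_eq circ_of_mult)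
  have "circ_of (\<lambda>z. \<Phi> z * f z) \<in> Lp p"
  proof -
    have "AE z in arc_measure. norm (\<Phi> z) \<le> B" using AE_arc_norm by eventually_elim (use B in auto)
    from Lp_mult_bounded[OF m _ Hp_in_Lp[OF x] this B0] show ?thesis using p by (simp add: prod)
  qed
  then have int: "integrable arc_measure (\<lambda>z. norm (\<Phi> z * f z) powr p)" by (simp add: circ_of_in_Lp)
  have holF: "(\<lambda>z. \<Phi> z * F z) holomorphic_on ball 0 1" by (intro holomorphic_intros hol f)
  have C: "\<forall>r\<in>{0..<1}. (\<integral>z. norm (\<Phi> (of_real r * z) * F (of_real r * z)) powr p \<partial>arc_measure) \<le> B powr p * C"
  proof
    fix r :: real assume r: "r \<in> {0..<1}"
    have "(\<integral>z. norm (\<Phi> (of_real r * z) * F (of_real r * z)) powr p \<partial>arc_measure)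
      \<le> (\<integral>z. B powr p * norm (F (of_real r * z)) powr p \<partial>arc_measure)"
    proof (rule integral_mono)
      show "integrable arc_measure (\<lambda>z. norm (\<Phi> (of_real r * z) * F (of_real r * z)) powr p)"
        using r p holomorphic_dilation_continuous_on_circle[OF holF, of r] by (intro integrable_arc_continuous_powr) auto
      show "integrable arc_measure (\<lambda>z. B powr p * norm (F (of_real r * z)) powr p)"
        using r p holomorphic_dilation_continuous_on_circle[OF f(3), of r] by (intro integrable_mult_right integrable_arc_continuous_powr) auto
      fix z assume "z \<in> space arc_measure"
      then have "norm (\<Phi> (of_real r * z)) \<le> B" using r by (intro B) (auto simp: space_arc_measure norm_mult)
      then have "norm (\<Phi> (of_real r * z) * F (of_real r * z)) powr p \<le> (B * norm (F (of_real r * z))) powr p"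
        using p by (intro powr_mono2) (auto simp: norm_mult mult_right_mono)
      then show "norm (\<Phi> (of_real r * z) * F (of_real r * z)) powr p \<le> B powr p * norm (F (of_real r * z)) powr p"
        using B0 by (simp add: powr_mult)
    qed
    also have "\<dots> \<le> B powr p * C" using f(4) r by (simp add: mult_left_mono)
    finally show "(\<integral>z. norm (\<Phi> (of_real r * z) * F (of_real r * z)) powr p \<partial>arc_measure) \<le> B powr p * C" .
  qed
  have lim: "AE z in arc_measure. ((\<lambda>r. \<Phi> (of_real r * z) * F (of_real r * z)) \<longlongrightarrow> \<Phi> z * f z) (at_left (1::real))"
    using f(5) AE_arc_norm
  proof eventually_elim
    case (elim z)
    have "((\<lambda>r. \<Phi> (of_real r * z)) \<longlongrightarrow> \<Phi> z) (at_left (1::real))"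
    proof (rule continuous_on_tendsto_compose[OF cont])
      show "((\<lambda>r. of_real r * z) \<longlongrightarrow> z) (at_left (1::real))"
        using tendsto_mult[OF tendsto_of_real[OF tendsto_ident_at, where 'a = complex] tendsto_const[of z], of 1 "{..<1}"]
        by simp
      show "\<forall>\<^sub>F r in at_left (1::real). of_real r * z \<in> cball 0 1"
        using eventually_at_left_real[of 0 "1::real"]
        by (auto elim!: eventually_mono simp: norm_mult elim)
    qed (use elim in auto)
    with elim(1) show ?case by (intro tendsto_mult)
  qed
  have hb: "hardy_boundary p (B powr p * C) (\<lambda>z. \<Phi> z * F z) (\<lambda>z. \<Phi> z * f z)"
    by (rule hardy_boundaryI[OF _ int holF _ lim]) (use C in auto)
  show "circ_of \<Phi> * x \<in> Hp p" unfolding prod by (rule HpI[OF hb])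
  assume a: "norm a < 1"
  from hardy_cauchy[OF p hb a] hardy_cauchy[OF p f_hb a]
  show "cauchy_at (circ_of \<Phi> * x) a = \<Phi> a * cauchy_at x a"
    unfolding prod by (simp add: f(1) f_eq cauchy_at_circ_of)
qed

lemma Hp_add:
  assumes p: "p > 1" and x: "x \<in> Hp p" and y: "y \<in> Hp p"
  shows "x + y \<in> Hp p" and "norm a < 1 \<Longrightarrow> cauchy_at (x + y) a = cauchy_at x a + cauchy_at y a"
proof -
  from x obtain f F C where f_eq: "x = circ_of f" and f_hb: "hardy_boundary p C F f" by (rule Hp_cases)
  note f = hardy_boundaryD[OF f_hb]
  from y obtain g G D where g_eq: "y = circ_of g" and g_hb: "hardy_boundary p D G g" by (rule Hp_cases)
  note g = hardy_boundaryD[OF g_hb]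
  note [measurable] = f(1) g(1)
  have sum: "x + y = circ_of (\<lambda>z. f z + g z)" by (simp add: f_eq g_eq circ_of_add)
  have "x + y \<in> Lp p" using Lp_add x y p by (simp add: Hp_in_Lp)
  then have int: "integrable arc_measure (\<lambda>z. norm (f z + g z) powr p)" by (simp add: sum circ_of_in_Lp)
  have i1: "integrable arc_measure f" "integrable arc_measure g"
    using integrable_arc_of_powr[OF f(1,2)] integrable_arc_of_powr[OF g(1,2)] p by auto
  have caF: "(\<integral>z. f z / (1 - a * cnj z) \<partial>arc_measure) = F a" "(\<integral>z. g z / (1 - a * cnj z) \<partial>arc_measure) = G a"
    if "norm a < 1" for a
    using hardy_cauchy[OF p f_hb that] hardy_cauchy[OF p g_hb that] by auto
  have FG: "(\<integral>z. (f z + g z) / (1 - a * cnj z) \<partial>arc_measure) = F a + G a" if a: "norm a < 1" for a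
    unfolding add_divide_distrib caF[OF a, symmetric]
    by (rule Bochner_Integration.integral_add) (intro integrable_arc_cauchy i1 a)+
  have neg: "(\<integral>z. (f z + g z) * z ^ n \<partial>arc_measure) = 0" if n: "n \<ge> 1" for n
  proof -
    have "(\<integral>z. (f z + g z) * z ^ n \<partial>arc_measure) = (\<integral>z. f z * z ^ n \<partial>arc_measure) + (\<integral>z. g z * z ^ n \<partial>arc_measure)"
      unfolding distrib_right
      by (rule Bochner_Integration.integral_add)
         (auto intro!: integrable_arc_mult_bounded[where B = 1] i1 simp: norm_power)
    then show ?thesis using hardy_negative_coeff[OF p f_hb n] hardy_negative_coeff[OF p g_hb n] by simp
  qed
  show "x + y \<in> Hp p" unfolding sum
  proof (rule HpI[OF hardy_boundaryI[OF _ int]])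
    show "(\<lambda>z. F z + G z) holomorphic_on ball 0 1" by (intro holomorphic_intros f g)
    \<comment> \<open>The bounds for F and G are not combined. The sum f + g has no coefficients of
      negative index and its Cauchy integral is F + G, so the Poisson estimate bounds the means by
      its own L^p integral.\<close>
    show "\<forall>r\<in>{0..<1}. (\<integral>z. norm (F (of_real r * z) + G (of_real r * z)) powr p \<partial>arc_measure) \<le>
       (\<integral>z. norm (f z + g z) powr p \<partial>arc_measure)"
    proof
      fix r :: real assume r: "r \<in> {0..<1}"
      then have "(\<integral>z. norm (F (of_real r * z) + G (of_real r * z)) powr p \<partial>arc_measure)
        = (\<integral>z. norm (\<integral>x. (f x + g x) / (1 - of_real r * z * cnj x) \<partial>arc_measure) powr p \<partial>arc_measure)"
        by (intro Bochner_Integration.integral_cong) (auto simp: FG space_arc_measure norm_mult)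
      also have "\<dots> \<le> (\<integral>z. norm (f z + g z) powr p \<partial>arc_measure)"
        using p r by (intro cauchy_transform_means_le int neg) auto
      finally show "(\<integral>z. norm (F (of_real r * z) + G (of_real r * z)) powr p \<partial>arc_measure) \<le>
       (\<integral>z. norm (f z + g z) powr p \<partial>arc_measure)" .
    qed
    show "AE z in arc_measure. ((\<lambda>r. F (of_real r * z) + G (of_real r * z)) \<longlongrightarrow> f z + g z) (at_left (1::real))"
      using f(5) g(5) by eventually_elim (rule tendsto_add)
  qed simp
  assume "norm a < 1"
  then show "cauchy_at (x + y) a = cauchy_at x a + cauchy_at y a"
    unfolding sum by (simp add: f(1) f_eq g(1) g_eq cauchy_at_circ_of FG caF)
qed

section \<open>Rational multipliers and linear structure of H^p\<close>

lemma rat_circ_1_eq: "rat_circ 1 = circ_of (\<lambda>_. 1)"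
proof -
  have "rat_eval 1 = (\<lambda>_. 1)" using rat_eval_to_fract[of 1] by auto
  then show ?thesis by (simp add: rat_circ_circ_of)
qed

lemma one_in_Hp:
  assumes p: "p > 1"
  shows "rat_circ 1 \<in> Hp p"
  using HpI[of p 1 "\<lambda>_. 1" "\<lambda>_. 1"]
  by (simp add: rat_circ_1_eq hardy_boundary_def arc_measure.prob_space)

lemma cauchy_at_one: "norm a < 1 \<Longrightarrow> cauchy_at (rat_circ 1) a = 1"
  using arc_cauchy_power[of a 0] by (simp add: rat_circ_1_eq cauchy_at_circ_of)

lemma rat_eval_holomorphic: "rat_poles r \<inter> S = {} \<Longrightarrow> rat_eval r holomorphic_on S"
  unfolding rat_eval_def[abs_def] by (intro holomorphic_intros) (auto simp: rat_poles_def)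

lemma
  assumes p: "p > 1" and x: "x \<in> Hp p" and r: "rat_poles r \<inter> cball 0 1 = {}"
  shows rat_circ_mult_in_Hp: "rat_circ r * x \<in> Hp p"
    and cauchy_at_rat_circ_mult: "norm a < 1 \<Longrightarrow> cauchy_at (rat_circ r * x) a = rat_eval r a * cauchy_at x a"
proof -
  have "rat_poles r \<inter> ball 0 1 = {}" using r ball_subset_cball by blast
  note * = Hp_mult_holomorphic[OF p x rat_eval_holomorphic[OF this] rat_eval_continuous[OF r]]
  show "rat_circ r * x \<in> Hp p" using *(1) by (simp add: rat_circ_circ_of)
  show "norm a < 1 \<Longrightarrow> cauchy_at (rat_circ r * x) a = rat_eval r a * cauchy_at x a"
    using *(2)[of a] by (simp add: rat_circ_circ_of)
qed

lemma rat_circ_in_Hp: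
  assumes "p > 1" "rat_poles r \<inter> cball 0 1 = {}"
  shows "rat_circ r \<in> Hp p"
  using rat_circ_mult_in_Hp[OF assms(1) one_in_Hp[OF assms(1)] assms(2)] by (simp add: mult.commute[of _ "rat_circ 1"])

lemma zero_in_Hp: "p > 1 \<Longrightarrow> 0 \<in> Hp p"
  using rat_circ_in_Hp[of p "to_fract 0"] rat_poles_to_fract[of 0] by simp

lemma Hp_scale: "p > 1 \<Longrightarrow> x \<in> Hp p \<Longrightarrow> scale_circ c x \<in> Hp p"
  by (simp add: scale_circ_eq rat_circ_mult_in_Hp)

lemma Hp_diff:
  assumes p: "p > 1" and "x \<in> Hp p" "y \<in> Hp p"
  shows "x - y \<in> Hp p"
  using Hp_add(1)[OF p assms(2) Hp_scale[OF p assms(3), of "-1"]] by simp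

lemma subspace_Hp: "p > 1 \<Longrightarrow> circ.subspace (Hp p)"
  by (rule circ.subspaceI) (auto intro: zero_in_Hp Hp_add Hp_scale)

lemma poly_circ_mult_in_Hp: "p > 1 \<Longrightarrow> x \<in> Hp p \<Longrightarrow> poly_circ P * x \<in> Hp p"
  by (rule rat_circ_mult_in_Hp) auto

lemma cauchy_at_poly_circ_mult:
  "p > 1 \<Longrightarrow> x \<in> Hp p \<Longrightarrow> norm a < 1 \<Longrightarrow> cauchy_at (poly_circ P * x) a = poly P a * cauchy_at x a"
  by (subst cauchy_at_rat_circ_mult) (auto simp: rat_eval_to_fract)

lemma cauchy_at_poly_circ:
  "norm a < 1 \<Longrightarrow> cauchy_at (poly_circ P) a = poly P a"
  using cauchy_at_poly_circ_mult[of 2 "rat_circ 1" a P] one_in_Hp[of 2]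
  by (simp add: cauchy_at_one mult.commute[of _ "rat_circ 1"])

lemma Hp_smirnov:
  assumes p: "p > 1" and x: "poly_circ [:-a, 1:] * w \<in> Hp p" and w: "w \<in> Lp p" and a: "norm a = 1"
  shows "w \<in> Hp p"
proof -
  obtain g where g: "g \<in> borel_measurable arc_measure" and wg: "w = circ_of g" by (rule circ_of_cases)
  from x obtain f F C where f_eq: "poly_circ [:-a, 1:] * w = circ_of f" and f_hb: "hardy_boundary p C F f" by (rule Hp_cases)
  note f = hardy_boundaryD[OF f_hb]
  note [measurable] = f(1) g
  have "circ_of (\<lambda>z. (z - a) * g z) = circ_of f"
    using f_eq by (simp add: wg poly_circ_eq circ_of_mult)
  then have eq: "AE z in arc_measure. (z - a) * g z = f z" by (subst (asm) circ_of_eq_iff) auto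
  have ig: "integrable arc_measure (\<lambda>z. norm (g z) powr p)" using w by (simp add: wg circ_of_in_Lp)
  note * = smirnov_linear_factor[OF p f_hb g ig a eq]
  show ?thesis unfolding wg by (rule HpI[OF *])
qed


section \<open>Division by polynomials\<close>

text \<open>Monic polynomials are indexed by their multisets of roots: divisibility is proved by
  induction on the roots, and degrees become sizes, which are the counts in the theorem.\<close>

definition roots_poly :: "complex multiset \<Rightarrow> complex poly" where
  "roots_poly A = (\<Prod>x\<in>#A. [:-x, 1:])"

lemma roots_poly_empty [simp]: "roots_poly {#} = 1"
  by (simp add: roots_poly_def)

lemma roots_poly_add [simp]: "roots_poly (add_mset a A) = [:-a, 1:] * roots_poly A"
  by (simp add: roots_poly_def)

lemma roots_poly_union: "roots_poly (A + B) = roots_poly A * roots_poly B"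
  by (simp add: roots_poly_def)

lemma roots_poly_neq_0 [simp]: "roots_poly A \<noteq> 0"
  by (induction A) (auto simp del: mult_pCons_left)

lemma degree_roots_poly [simp]: "degree (roots_poly A) = size A"
proof (induction A)
  case (add a A)
  have "degree ([:-a, 1:] * roots_poly A) = degree [:-a, 1:] + degree (roots_poly A)"
    by (rule degree_mult_eq) auto
  then show ?case using add by (simp only: roots_poly_add) simp
qed simp

lemma lead_coeff_roots_poly [simp]: "coeff (roots_poly A) (size A) = 1"
proof -
  have "lead_coeff (roots_poly A) = 1"
  proof (induction A)
    case (add a A)
    have "lead_coeff ([:-a, 1:] * roots_poly A) = lead_coeff [:-a, 1:] * lead_coeff (roots_poly A)"
      by (rule lead_coeff_mult)
    then show ?case using add by (simp only: roots_poly_add) simp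
  qed simp
  then show ?thesis by simp
qed

lemma poly_roots_poly_eq_0_iff [simp]: "poly (roots_poly A) z = 0 \<longleftrightarrow> z \<in># A"
  by (induction A) auto

lemma to_fract_linear_neq_0 [simp]: "to_fract [:-a, 1:] \<noteq> 0" for a :: complex
  by (simp del: to_fract_eq_0_iff add: to_fract_eq_0_iff)

lemma rat_poles_inverse_linear: "rat_poles (1 / to_fract [:-a, 1:]) \<subseteq> {a}"
proof
  fix z assume "z \<in> rat_poles (1 / to_fract [:-a, 1:])"
  then show "z \<in> {a}" using rat_poles_quotient[of "[:-a, 1:]" z 1] by (cases "z = a") auto
qed

lemma poly_circ_mult_linear:
  "poly_circ [:-a, 1:] * (poly_circ P * x) = poly_circ ([:-a, 1:] * P) * x"
  by (simp add: rat_circ_mult_assoc del: mult_pCons_left)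

lemma poly_circ_mult_in_Lp: "p \<ge> 1 \<Longrightarrow> x \<in> Lp p \<Longrightarrow> poly_circ P * x \<in> Lp p"
  by (rule rat_circ_mult_in_Lp) auto

lemma poly_circ_in_Lp: "p \<ge> 1 \<Longrightarrow> poly_circ P \<in> Lp p"
  by (rule rat_circ_in_Lp) auto

lemma poly_circ_in_Hp: "p > 1 \<Longrightarrow> poly_circ P \<in> Hp p"
  by (rule rat_circ_in_Hp) auto

section \<open>Bounded point evaluations and division with remainder\<close>

lemma integral_norm_le_Lp_norm:
  assumes p: "p \<ge> 1" and f [measurable]: "f \<in> borel_measurable arc_measure" and int: "integrable arc_measure (\<lambda>z. norm (f z) powr p)"
  shows "(\<integral>z. norm (f z) \<partial>arc_measure) \<le> Lp_norm p (circ_of f)"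
proof -
  have "integrable arc_measure f" by (rule integrable_arc_of_powr[OF f int p])
  then have "(\<integral>z. norm (f z) * 1 \<partial>arc_measure) powr p \<le> (\<integral>z. norm (f z) powr p * 1 \<partial>arc_measure)"
    using int p by (intro jensen_powr_weighted) (auto simp: arc_measure.prob_space)
  then have "((\<integral>z. norm (f z) \<partial>arc_measure) powr p) powr (1 / p) \<le> (\<integral>z. norm (f z) powr p \<partial>arc_measure) powr (1 / p)"
    using p by (intro powr_mono2) auto
  then show ?thesis using p f by (simp add: powr_powr Lp_norm_circ_of)
qed

lemma norm_cauchy_at_le:
  assumes p: "p \<ge> 1" and x: "x \<in> Lp p" and a: "norm a < 1"
  shows "norm (cauchy_at x a) \<le> 1 / (1 - norm a) * Lp_norm p x"
proof -
  obtain f where f: "f \<in> borel_measurable arc_measure" and xf: "x = circ_of f" by (rule circ_of_cases)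
  have int: "integrable arc_measure (\<lambda>z. norm (f z) powr p)" using x f by (simp add: xf circ_of_in_Lp)
  have fi: "integrable arc_measure f" by (rule integrable_arc_of_powr[OF f int p])
  have "norm (cauchy_at x a) \<le> (\<integral>z. norm (f z / (1 - a * cnj z)) \<partial>arc_measure)"
    unfolding xf cauchy_at_circ_of[OF f] by (rule integral_norm_bound)
  also have "\<dots> \<le> (\<integral>z. 1 / (1 - norm a) * norm (f z) \<partial>arc_measure)"
  proof (rule integral_mono)
    show "integrable arc_measure (\<lambda>z. norm (f z / (1 - a * cnj z)))"
      using integrable_arc_cauchy[OF fi a] by auto
    show "norm (f z / (1 - a * cnj z)) \<le> 1 / (1 - norm a) * norm (f z)" if "z \<in> space arc_measure" for z
      using mult_right_mono[OF arc_cauchy_kernel_bound[OF _ a], of z "norm (f z)"] that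
      by (simp add: space_arc_measure norm_divide)
  qed (use fi in auto)
  also have "\<dots> \<le> 1 / (1 - norm a) * Lp_norm p x"
    unfolding integral_mult_right_zero xf using a by (intro mult_left_mono integral_norm_le_Lp_norm p f int) auto
  finally show ?thesis .
qed

text \<open>The difference quotient H extends holomorphically across a. Its means are bounded in two
  ranges separated by the midpoint \<rho> of norm a and 1: by compactness up to radius \<rho>, and
  beyond it because the distance to a is at least \<delta>.\<close>

lemma Hp_divide_linear:
  assumes p: "p > 1" and x: "x \<in> Hp p" and a: "norm a < 1"
  shows "rat_circ (1 / to_fract [:-a, 1:]) * (x - poly_circ [:cauchy_at x a:]) \<in> Hp p"
proof -
  from x obtain f F C where f_eq: "x = circ_of f" and f_hb: "hardy_boundary p C F f" by (rule Hp_cases)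
  note f = hardy_boundaryD[OF f_hb]
  note [measurable] = f(1)
  have c: "cauchy_at x a = F a"
    using hardy_cauchy[OF p f_hb a] f(1) f_eq by (simp add: cauchy_at_circ_of)
  define H where "H = (\<lambda>z. if z = a then deriv F a else (F z - F a) / (z - a))"
  have hol: "H holomorphic_on ball 0 1" unfolding H_def by (rule pole_lemma_open[OF f(3)]) auto
  define \<rho> where "\<rho> = (1 + norm a) / 2"
  have \<rho>: "norm a < \<rho>" "\<rho> < 1" "0 < \<rho>" "\<rho> \<ge> 0" using a by (auto simp: \<rho>_def intro: add_pos_nonneg)
  have "bounded (H ` cball 0 \<rho>)"
    using \<rho> by (intro compact_imp_bounded compact_continuous_image holomorphic_on_imp_continuous_on
      holomorphic_on_subset[OF hol]) auto
  then obtain B where B: "\<And>z. norm z \<le> \<rho> \<Longrightarrow> norm (H z) \<le> B" by (metis bounded_iff imageI mem_cball_0)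
  define \<delta> where "\<delta> = \<rho> - norm a"
  have \<delta>: "\<delta> > 0" using \<rho> by (simp add: \<delta>_def)
  define K where "K = (1 / \<delta>) powr p * (2 powr p * (C + norm (F a) powr p))"
  have "C \<ge> 0" using f(4)[rule_format, of 0] order_trans[OF powr_ge_zero, of "norm (F 0)" p C]
    by (simp add: arc_measure.prob_space)
  then have K: "K \<ge> 0" by (simp add: K_def)
  have means: "\<forall>r\<in>{0..<1}. (\<integral>z. norm (H (of_real r * z)) powr p \<partial>arc_measure) \<le> B powr p + K"
  proof
    fix r :: real assume r: "r \<in> {0..<1}"
    have iH: "integrable arc_measure (\<lambda>z. norm (H (of_real r * z)) powr p)"
      using r p holomorphic_dilation_continuous_on_circle[OF hol, of r] by (intro integrable_arc_continuous_powr) auto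
    show "(\<integral>z. norm (H (of_real r * z)) powr p \<partial>arc_measure) \<le> B powr p + K"
    proof (cases "r \<le> \<rho>")
      case True
      have "(\<integral>z. norm (H (of_real r * z)) powr p \<partial>arc_measure) \<le> (\<integral>z. B powr p \<partial>arc_measure)"
        using iH B p r True by (intro integral_mono) (auto simp: space_arc_measure norm_mult intro!: powr_mono2)
      also have "\<dots> = B powr p" by (simp add: arc_measure.prob_space)
      finally show ?thesis using K by simp
    next
      case False
      have iF: "integrable arc_measure (\<lambda>z. norm (F (of_real r * z)) powr p)"
        using r p holomorphic_dilation_continuous_on_circle[OF f(3), of r] by (intro integrable_arc_continuous_powr) auto
      have "(\<integral>z. norm (H (of_real r * z)) powr p \<partial>arc_measure)
        \<le> (\<integral>z. (1 / \<delta>) powr p * (2 powr p * (norm (F (of_real r * z)) powr p + norm (F a) powr p)) \<partial>arc_measure)"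
      proof (rule integral_mono[OF iH])
        show "integrable arc_measure (\<lambda>z. (1 / \<delta>) powr p * (2 powr p * (norm (F (of_real r * z)) powr p + norm (F a) powr p)))"
          using iF by auto
        fix z assume "z \<in> space arc_measure"
        then have nz: "norm (of_real r * z) = r" using r by (simp add: space_arc_measure norm_mult)
        have d: "\<delta> \<le> norm (of_real r * z - a)"
          using norm_triangle_ineq2[of "of_real r * z" a] nz False by (simp add: \<delta>_def)
        then have "of_real r * z \<noteq> a" using \<delta> by auto
        then have "norm (H (of_real r * z)) = norm (F (of_real r * z) - F a) / norm (of_real r * z - a)"
          by (simp add: H_def norm_divide)
        also have "\<dots> \<le> norm (F (of_real r * z) - F a) / \<delta>"
          using d \<delta> by (intro divide_left_mono mult_pos_pos) auto
        finally have "norm (H (of_real r * z)) powr p \<le> (1 / \<delta> * norm (F (of_real r * z) - F a)) powr p"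
          using p by (intro powr_mono2) auto
        also have "\<dots> = (1 / \<delta>) powr p * norm (F (of_real r * z) - F a) powr p"
          using \<delta> by (intro powr_mult)
        also have "\<dots> \<le> (1 / \<delta>) powr p * (2 powr p * (norm (F (of_real r * z)) powr p + norm (F a) powr p))"
          using p by (intro mult_left_mono norm_diff_powr_le) auto
        finally show "norm (H (of_real r * z)) powr p \<le> (1 / \<delta>) powr p * (2 powr p * (norm (F (of_real r * z)) powr p + norm (F a) powr p))" .
      qed
      also have "\<dots> = (1 / \<delta>) powr p * (2 powr p * ((\<integral>z. norm (F (of_real r * z)) powr p \<partial>arc_measure) + norm (F a) powr p))"
        using iF by (simp add: arc_measure.prob_space)
      also have "\<dots> \<le> K"
        unfolding K_def using f(4) r by (intro mult_left_mono add_right_mono) auto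
      finally show ?thesis by (simp add: add_increasing)
    qed
  qed
  define h where "h z = (f z - F a) / (z - a)" for z
  have [measurable]: "h \<in> borel_measurable arc_measure" by (simp add: h_def[abs_def])
  have lim: "AE z in arc_measure. ((\<lambda>r. H (of_real r * z)) \<longlongrightarrow> h z) (at_left (1::real))"
    using f(5) AE_arc_norm
  proof eventually_elim
    case (elim z)
    have za: "z \<noteq> a" using elim a by auto
    have "((\<lambda>r. (F (of_real r * z) - F a) / (of_real r * z - a)) \<longlongrightarrow> (f z - F a) / (of_real 1 * z - a)) (at_left (1::real))"
      using za by (intro tendsto_intros elim) auto
    moreover have "\<forall>\<^sub>F r in at_left (1::real). (F (of_real r * z) - F a) / (of_real r * z - a) = H (of_real r * z)"
      using eventually_at_left_real[OF \<rho>(2)]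
    proof eventually_elim
      case (elim r)
      then have "norm (of_real r * z) \<noteq> norm a" using \<rho> \<open>norm z = 1\<close> by (simp add: norm_mult)
      then have "of_real r * z \<noteq> a" by auto
      then show ?case by (simp add: H_def)
    qed
    ultimately have "((\<lambda>r. H (of_real r * z)) \<longlongrightarrow> (f z - F a) / (of_real 1 * z - a)) (at_left (1::real))"
      by (rule Lim_transform_eventually)
    then show ?case by (simp add: h_def)
  qed
  have hx: "rat_circ (1 / to_fract [:-a, 1:]) * (x - poly_circ [:cauchy_at x a:]) = circ_of h"
  proof -
    have "poly_circ [:-a, 1:] * circ_of h = x - poly_circ [:F a:]"
      unfolding f_eq poly_circ_eq
      using AE_arc_neq[of a] by (simp add: circ_of_mult circ_of_diff circ_of_eq_iff h_def eventually_mono)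
    then show ?thesis by (subst (asm) rat_circ_mult_eq_iff) (simp_all add: c)
  qed
  have "x - poly_circ [:cauchy_at x a:] \<in> Lp p"
    using p x by (intro Lp_minus Hp_in_Lp poly_circ_in_Lp) auto
  then have "circ_of h \<in> Lp p" unfolding hx[symmetric]
    using p a rat_poles_inverse_linear[of a] by (intro rat_circ_mult_in_Lp) auto
  then have "integrable arc_measure (\<lambda>z. norm (h z) powr p)" by (simp add: circ_of_in_Lp)
  then show ?thesis unfolding hx using HpI[OF hardy_boundaryI[OF _ _ hol means lim]] by simp
qed

lemma Hp_linear_division:
  assumes p: "p > 1" and a: "norm a < 1"
  obtains B where "B \<ge> 0" "\<And>x. x \<in> Hp p \<Longrightarrow> \<exists>h\<in>Hp p. \<exists>c.
    x = poly_circ [:-a, 1:] * h + poly_circ [:c:] \<and> Lp_norm p h \<le> B * Lp_norm p x \<and> norm c \<le> B * Lp_norm p x"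
proof -
  let ?r = "1 / to_fract [:-a, 1:]"
  have "rat_poles ?r \<inter> sphere 0 1 = {}"
    using a rat_poles_inverse_linear[of a] by auto
  then obtain B1 where B1: "B1 \<ge> 0" "\<And>x. x \<in> Lp p \<Longrightarrow> Lp_norm p (rat_circ ?r * x) \<le> B1 * Lp_norm p x"
    using rat_circ_Lp_bounded[of ?r p] p by (metis less_imp_le)
  define D where "D = 1 / (1 - norm a)"
  have D: "D \<ge> 0" using a by (simp add: D_def)
  have const: "Lp_norm p (poly_circ [:c:]) = norm c" for c
  proof -
    have "Lp_norm p (circ_of (poly [:c:])) = norm c"
      using p by (subst Lp_norm_circ_of) (auto simp: arc_measure.prob_space powr_powr)
    then show ?thesis by (simp only: poly_circ_eq)
  qed
  show ?thesis
  proof (rule that)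
    \<comment> \<open>D bounds c, so x minus the constant has norm at most 1 + D times that of x,
      and division by z - a costs the factor B1. The sum bounds quotient and remainder
      alike.\<close>
    show "B1 * (1 + D) + D \<ge> 0" using B1 D by simp
    fix x assume x: "x \<in> Hp p"
    define c where "c = cauchy_at x a"
    define h where "h = rat_circ ?r * (x - poly_circ [:c:])"
    have h: "h \<in> Hp p" unfolding h_def c_def by (rule Hp_divide_linear[OF p x a])
    have "poly_circ [:-a, 1:] * h = x - poly_circ [:c:]"
      by (simp add: h_def rat_circ_mult_assoc)
    then have eq: "x = poly_circ [:-a, 1:] * h + poly_circ [:c:]" by simp
    have nc: "norm c \<le> D * Lp_norm p x"
      unfolding c_def D_def using p x a by (intro norm_cauchy_at_le Hp_in_Lp) auto
    have "Lp_norm p (x - poly_circ [:c:]) \<le> Lp_norm p x + norm c"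
      using Lp_norm_diff_le[of p x "poly_circ [:c:]"] p x by (simp add: const Hp_in_Lp poly_circ_in_Lp)
    also have "\<dots> \<le> (1 + D) * Lp_norm p x" using nc by (simp add: algebra_simps)
    finally have "B1 * Lp_norm p (x - poly_circ [:c:]) \<le> B1 * ((1 + D) * Lp_norm p x)"
      using B1 by (intro mult_left_mono)
    moreover have "Lp_norm p h \<le> B1 * Lp_norm p (x - poly_circ [:c:])"
      unfolding h_def using p x by (intro B1 Lp_minus Hp_in_Lp poly_circ_in_Lp) auto
    ultimately have nh: "Lp_norm p h \<le> B1 * (1 + D) * Lp_norm p x" by simp
    have "0 \<le> D * Lp_norm p x" "0 \<le> B1 * (1 + D) * Lp_norm p x"
      using D B1 by auto
    then have "Lp_norm p h \<le> (B1 * (1 + D) + D) * Lp_norm p x" "norm c \<le> (B1 * (1 + D) + D) * Lp_norm p x"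
      using nh nc unfolding distrib_right[of _ D] by linarith+
    with h eq show "\<exists>h\<in>Hp p. \<exists>c. x = poly_circ [:-a, 1:] * h + poly_circ [:c:] \<and>
        Lp_norm p h \<le> (B1 * (1 + D) + D) * Lp_norm p x \<and> norm c \<le> (B1 * (1 + D) + D) * Lp_norm p x" by blast
  qed
qed

text \<open>The bounds are the point: B is independent of x, so the coefficients of the remainder
  depend continuously on x. This is what makes the range closed when all roots lie in the open
  disc.\<close>

lemma Hp_division:
  assumes p: "p > 1" and A: "set_mset A \<subseteq> ball 0 1"
  shows "\<exists>B\<ge>0. \<forall>x\<in>Hp p. \<exists>h\<in>Hp p. \<exists>r. x = poly_circ (roots_poly A) * h + poly_circ r
     \<and> (\<forall>i\<ge>size A. coeff r i = 0) \<and> Lp_norm p h \<le> B * Lp_norm p x \<and> (\<forall>i. norm (coeff r i) \<le> B * Lp_norm p x)"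
  using A
proof (induction A)
  case empty
  show ?case
    by (intro exI[of _ 1] conjI ballI bexI exI[of _ 0]) (auto)
next
  case (add a A)
  then obtain B where B: "B \<ge> 0" "\<And>x. x \<in> Hp p \<Longrightarrow> \<exists>h\<in>Hp p. \<exists>r. x = poly_circ (roots_poly A) * h + poly_circ r
     \<and> (\<forall>i\<ge>size A. coeff r i = 0) \<and> Lp_norm p h \<le> B * Lp_norm p x \<and> (\<forall>i. norm (coeff r i) \<le> B * Lp_norm p x)" by auto
  from add.prems have a: "norm a < 1" by simp
  from Hp_linear_division[OF p a] obtain D where D: "D \<ge> 0" "\<And>x. x \<in> Hp p \<Longrightarrow> \<exists>h\<in>Hp p. \<exists>c.
    x = poly_circ [:-a, 1:] * h + poly_circ [:c:] \<and> Lp_norm p h \<le> D * Lp_norm p x \<and> norm c \<le> D * Lp_norm p x" by blast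
  \<comment> \<open>A coefficient of the new remainder (z - a) r + c collects two coefficients of r,
    each at most B * D times the norm of x because norm a < 1, and possibly c, which costs
    D.\<close>
  define E where "E = 2 * B * D + D"
  show ?case
  proof (intro exI[of _ E] conjI ballI)
    show "E \<ge> 0" using B D by (simp add: E_def)
    fix x assume x: "x \<in> Hp p"
    from D(2)[OF x] obtain h1 c where h1: "h1 \<in> Hp p" "x = poly_circ [:-a, 1:] * h1 + poly_circ [:c:]"
      "Lp_norm p h1 \<le> D * Lp_norm p x" "norm c \<le> D * Lp_norm p x" by blast
    from B(2)[OF h1(1)] obtain h r where h: "h \<in> Hp p" "h1 = poly_circ (roots_poly A) * h + poly_circ r"
      "\<forall>i\<ge>size A. coeff r i = 0" "Lp_norm p h \<le> B * Lp_norm p h1" "\<forall>i. norm (coeff r i) \<le> B * Lp_norm p h1" by blast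
    define r' where "r' = [:-a, 1:] * r + [:c:]"
    have Bh1: "B * Lp_norm p h1 \<le> B * D * Lp_norm p x"
      using mult_left_mono[OF h1(3) B(1)] by (simp add: mult.assoc)
    have nn: "0 \<le> B * D * Lp_norm p x" "0 \<le> D * Lp_norm p x" using B D by auto
    have Ex: "E * Lp_norm p x = 2 * (B * D * Lp_norm p x) + D * Lp_norm p x" by (simp add: E_def algebra_simps)
    have "x = poly_circ [:-a, 1:] * (poly_circ (roots_poly A) * h) + poly_circ [:-a, 1:] * poly_circ r + poly_circ [:c:]"
      unfolding h1(2) h(2) distrib_left ..
    then have eq: "x = poly_circ (roots_poly (add_mset a A)) * h + poly_circ r'"
      unfolding r'_def roots_poly_add to_fract_add to_fract_mult rat_circ_add rat_circ_mult by (simp add: algebra_simps)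
    have cr: "coeff r' i = (case i of 0 \<Rightarrow> 0 | Suc j \<Rightarrow> coeff r j) - a * coeff r i + (if i = 0 then c else 0)" for i
      by (simp add: r'_def coeff_pCons split: nat.split)
    have "\<forall>i\<ge>size (add_mset a A). coeff r' i = 0"
      unfolding cr using h(3) by (auto split: nat.split)
    moreover have "norm (coeff r' i) \<le> E * Lp_norm p x" for i
    proof -
      have "norm (case i of 0 \<Rightarrow> 0 | Suc j \<Rightarrow> coeff r j) \<le> B * D * Lp_norm p x"
        using h(5) Bh1 nn by (auto split: nat.split intro: order_trans)
      moreover have "norm (a * coeff r i) \<le> B * D * Lp_norm p x"
      proof -
        have "norm (a * coeff r i) \<le> 1 * norm (coeff r i)"
          unfolding norm_mult using a by (intro mult_right_mono) auto
        then show ?thesis using h(5) Bh1 by (auto intro: order_trans)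
      qed
      moreover have "norm (if i = 0 then c else 0) \<le> D * Lp_norm p x" using h1(4) nn by auto
      ultimately show ?thesis unfolding cr Ex
        by (intro order_trans[OF norm_triangle_ineq] order_trans[OF add_right_mono[OF norm_triangle_ineq4]]) linarith
    qed
    moreover have "Lp_norm p h \<le> E * Lp_norm p x" using h(4) Bh1 nn Ex by linarith
    ultimately show "\<exists>h\<in>Hp p. \<exists>r. x = poly_circ (roots_poly (add_mset a A)) * h + poly_circ r
     \<and> (\<forall>i\<ge>size (add_mset a A). coeff r i = 0) \<and> Lp_norm p h \<le> E * Lp_norm p x \<and> (\<forall>i. norm (coeff r i) \<le> E * Lp_norm p x)"
      using h(1) eq by blast
  qed
qed

section \<open>Divisibility of polynomials from membership in H^p and L^p\<close>

lemma dvd_of_mult_Hp_eq_poly: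
  assumes p: "p > 1" and A: "set_mset A \<subseteq> ball 0 1" and x: "x \<in> Hp p"
    and eq: "poly_circ (roots_poly A) * x = poly_circ r"
  shows "roots_poly A dvd r"
  using A eq
proof (induction A arbitrary: r)
  case (add a A)
  from add.prems have a: "norm a < 1" by simp
  let ?y = "poly_circ (roots_poly A) * x"
  have y: "?y \<in> Hp p" by (rule poly_circ_mult_in_Hp[OF p x])
  have eq: "poly_circ [:-a, 1:] * ?y = poly_circ r"
    using add.prems(2) unfolding poly_circ_mult_linear roots_poly_add .
  then have "poly r a = 0"
    using cauchy_at_poly_circ_mult[OF p y a, of "[:-a, 1:]"] cauchy_at_poly_circ[OF a, of r] by simp
  then obtain r' where r': "r = [:-a, 1:] * r'" by (auto simp: poly_eq_0_iff_dvd)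
  have "poly_circ [:-a, 1:] * ?y = poly_circ [:-a, 1:] * poly_circ r'"
    unfolding eq r' to_fract_mult rat_circ_mult ..
  then have "?y = poly_circ r'" by (subst (asm) rat_circ_mult_cancel) simp_all
  from add.IH[OF _ this] add.prems(1) show ?case unfolding r' roots_poly_add by (intro mult_dvd_mono) auto
qed simp

lemma const_eq_0_of_linear_mult_Lp:
  assumes p: "p \<ge> 1" and a: "norm a = 1" and u: "u \<in> Lp p"
    and eq: "poly_circ [:-a, 1:] * u = poly_circ [:c:]"
  shows "c = 0"
proof (rule ccontr)
  assume c: "c \<noteq> 0"
  obtain f where f [measurable]: "f \<in> borel_measurable arc_measure" and uf: "u = circ_of f" by (rule circ_of_cases)
  have "integrable arc_measure f"
    using u p by (intro integrable_arc_of_powr[OF f, of p]) (auto simp: uf circ_of_in_Lp f)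
  then have "integrable arc_measure (\<lambda>z. f z / c)" by auto
  moreover have "AE z in arc_measure. (z - a) * f z = c"
    using eq by (simp add: uf poly_circ_eq circ_of_mult circ_of_eq_iff)
  then have "AE z in arc_measure. f z / c = 1 / (z - a)"
    using AE_arc_neq[of a] by eventually_elim (use c in \<open>auto simp: field_simps\<close>)
  ultimately have "integrable arc_measure (\<lambda>z. 1 / (z - a))"
    by (subst (asm) integrable_cong_AE) auto
  then show False using not_integrable_arc_inverse[OF a] by blast
qed

text \<open>The counterpart of \<open>dvd_of_mult_Hp_eq_poly\<close> on the circle, where x cannot
  be evaluated. Instead the remainder of r at a root a is a constant that equals z - a times a
  member of L^p, hence is 0 because 1 / (z - a) is not integrable.\<close>

lemma dvd_of_mult_Lp_eq_poly:
  assumes p: "p \<ge> 1" and A: "set_mset A \<subseteq> sphere 0 1" and x: "x \<in> Lp p"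
    and eq: "poly_circ (roots_poly A) * x = poly_circ r"
  obtains r' where "r = roots_poly A * r'" "x = poly_circ r'"
proof -
  have "\<exists>r'. r = roots_poly A * r'"
    using A eq
  proof (induction A arbitrary: r)
    case (add a A)
    from add.prems have a: "norm a = 1" by simp
    let ?y = "poly_circ (roots_poly A) * x"
    have y: "?y \<in> Lp p" by (rule poly_circ_mult_in_Lp[OF p x])
    have eq: "poly_circ [:-a, 1:] * ?y = poly_circ r"
      using add.prems(2) unfolding poly_circ_mult_linear roots_poly_add .
    define q where "q = synthetic_div r a"
    have r: "r = [:-a, 1:] * q + [:poly r a:]" unfolding q_def by (rule synthetic_div_correct'[symmetric])
    have "poly_circ [:-a, 1:] * (?y - poly_circ q) = poly_circ (r - [:-a, 1:] * q)"
      unfolding right_diff_distrib eq to_fract_diff to_fract_mult rat_circ_diff rat_circ_mult ..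
    also have "r - [:-a, 1:] * q = [:poly r a:]" using r by (metis add_diff_cancel_left')
    finally have "poly r a = 0"
      using a p y by (intro const_eq_0_of_linear_mult_Lp[OF p a, of "?y - poly_circ q"] Lp_minus poly_circ_in_Lp) auto
    then have r': "r = [:-a, 1:] * q" using r by simp
    have "poly_circ [:-a, 1:] * ?y = poly_circ [:-a, 1:] * poly_circ q"
      unfolding eq r' to_fract_mult rat_circ_mult ..
    then have "?y = poly_circ q" by (subst (asm) rat_circ_mult_cancel) simp_all
    from add.IH[OF _ this] add.prems(1) show ?case unfolding r' roots_poly_add by (auto simp: mult.assoc simp del: mult_pCons_left)
  qed simp
  then obtain r' where r': "r = roots_poly A * r'" by blast
  have "poly_circ (roots_poly A) * x = poly_circ (roots_poly A) * poly_circ r'"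
    unfolding eq r' to_fract_mult rat_circ_mult ..
  then have "x = poly_circ r'" by (subst (asm) rat_circ_mult_cancel) simp_all
  with r' show ?thesis by (rule that)
qed

lemma Hp_smirnov_roots:
  assumes p: "p > 1" and A: "set_mset A \<subseteq> sphere 0 1" and w: "w \<in> Lp p"
    and x: "poly_circ (roots_poly A) * w \<in> Hp p"
  shows "w \<in> Hp p"
  using A x
proof (induction A)
  case empty
  then show ?case by (simp)
next
  case (add a A)
  from add.prems have a: "norm a = 1" by simp
  have "poly_circ [:-a, 1:] * (poly_circ (roots_poly A) * w) \<in> Hp p"
    using add.prems(2) unfolding poly_circ_mult_linear roots_poly_add .
  from Hp_smirnov[OF p this _ a] have "poly_circ (roots_poly A) * w \<in> Hp p"
    using p w by (simp add: poly_circ_mult_in_Lp)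
  then show ?case using add by simp
qed


section \<open>Density and codimension of \<open>(z - a) H\<^sup>p\<close>\<close>

lemma norm_fourier_coeff_le:
  assumes p: "p \<ge> 1" and x: "x \<in> Lp p"
  shows "norm (fourier_coeff x n) \<le> Lp_norm p x"
proof -
  obtain f where f: "f \<in> borel_measurable arc_measure" and xf: "x = circ_of f" by (rule circ_of_cases)
  have int: "integrable arc_measure (\<lambda>z. norm (f z) powr p)" using x f by (simp add: xf circ_of_in_Lp)
  have "norm (fourier_coeff x n) \<le> (\<integral>z. norm (f z * z powi (- n)) \<partial>arc_measure)"
    unfolding xf fourier_coeff_circ_of[OF f] by (rule integral_norm_bound)
  also have "\<dots> = (\<integral>z. norm (f z) \<partial>arc_measure)"
    by (rule Bochner_Integration.integral_cong) (auto simp: space_arc_measure norm_mult norm_power_int)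
  also have "\<dots> \<le> Lp_norm p x" unfolding xf by (rule integral_norm_le_Lp_norm[OF p f int])
  finally show ?thesis .
qed

lemma fourier_coeff_mult_linear:
  assumes p: "p \<ge> 1" and x: "x \<in> Lp p"
  shows "fourier_coeff (poly_circ [:-a, 1:] * x) n = fourier_coeff x (n - 1) - a * fourier_coeff x n"
proof -
  obtain f where f [measurable]: "f \<in> borel_measurable arc_measure" and xf: "x = circ_of f" by (rule circ_of_cases)
  have "integrable arc_measure f"
    using x p f by (intro integrable_arc_of_powr[where p = p]) (auto simp: xf circ_of_in_Lp)
  then have int: "integrable arc_measure (\<lambda>z. f z * z powi n)" for n
    by (rule integrable_arc_mult_bounded[where B = 1]) (auto simp: norm_power_int)
  have "fourier_coeff (poly_circ [:-a, 1:] * x) n = (\<integral>z. (z - a) * f z * z powi (- n) \<partial>arc_measure)"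
    by (simp add: xf poly_circ_eq circ_of_mult fourier_coeff_circ_of)
  also have "\<dots> = (\<integral>z. f z * z powi (- (n - 1)) - a * (f z * z powi (- n)) \<partial>arc_measure)"
  proof (rule Bochner_Integration.integral_cong[OF refl])
    fix z assume "z \<in> space arc_measure"
    then have "z \<noteq> 0" by (auto simp: space_arc_measure)
    then have "z powi (- (n - 1)) = z * z powi (- n)" using power_int_add[of z 1 "- n"] by simp
    then show "(z - a) * f z * z powi (- n) = f z * z powi (- (n - 1)) - a * (f z * z powi (- n))"
      by (simp add: algebra_simps)
  qed
  also have "\<dots> = fourier_coeff x (n - 1) - a * fourier_coeff x n"
    unfolding xf fourier_coeff_circ_of[OF f] integral_mult_right_zero[symmetric]
    by (rule Bochner_Integration.integral_diff) (intro int integrable_mult_right)+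
  finally show ?thesis .
qed

lemma fourier_coeff_const: "fourier_coeff (poly_circ [:c:]) n = (if n = 0 then c else 0)"
  using integral_arc_powi[of "- n"] by (simp add: poly_circ_eq fourier_coeff_circ_of)

lemma rat_circ_quotient_in_Lp:
  assumes p: "p \<ge> 1" and A: "set_mset A \<inter> sphere 0 1 = {}"
  shows "rat_circ (to_fract r / to_fract (roots_poly A)) \<in> Lp p"
proof (rule rat_circ_in_Lp[OF _ p])
  have "z \<notin> rat_poles (to_fract r / to_fract (roots_poly A))" if "z \<in> sphere 0 1" for z
    using A that by (intro rat_poles_quotient) auto
  then show "rat_poles (to_fract r / to_fract (roots_poly A)) \<inter> sphere 0 1 = {}" by auto
qed

text \<open>Such a function is a power series in 1 / z without constant term. The induction removes
  one root a: multiplied by z - a, the function w has no coefficients of index m \<ge> 1, so w_(m-1)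
  = a w_m. Iterating outwards, bounded coefficients and norm a < 1 force w_n = 0. The case m = 1 is
  what reaches index 0.\<close>

lemma fourier_coeff_strictly_proper:
  assumes A: "set_mset A \<subseteq> ball 0 1" and r: "\<forall>i\<ge>size A. coeff r i = 0" and n: "n \<ge> 0"
  shows "fourier_coeff (rat_circ (to_fract r / to_fract (roots_poly A))) n = 0"
  using A r n
proof (induction A arbitrary: r n)
  case empty
  then have "r = 0" by (intro poly_eqI) auto
  then show ?case using fourier_coeff_const[of 0 n] by simp
next
  case (add a A)
  from add.prems have a: "norm a < 1" and A: "set_mset A \<subseteq> ball 0 1" by auto
  define w where "w = rat_circ (to_fract r / to_fract (roots_poly (add_mset a A)))"
  have "set_mset (add_mset a A) \<inter> sphere 0 1 = {}" "set_mset A \<inter> sphere 0 1 = {}" using add.prems(1) by auto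
  note Lp = rat_circ_quotient_in_Lp[of 1, OF _ this(1)] rat_circ_quotient_in_Lp[of 1, OF _ this(2)]
  have w: "w \<in> Lp 1" unfolding w_def by (rule Lp) simp
  \<comment> \<open>r may have degree \<open>size A\<close>, one too many for the induction
    hypothesis. Subtracting c times the monic \<open>roots_poly A\<close> lowers the degree; the
    resulting constant only affects the coefficient of index 0.\<close>
  define c where "c = coeff r (size A)"
  define r1 where "r1 = r - smult c (roots_poly A)"
  have r1: "\<forall>i\<ge>size A. coeff r1 i = 0"
  proof (intro allI impI)
    fix i assume i: "i \<ge> size A"
    show "coeff r1 i = 0"
    proof (cases "i = size A")
      case False
      then have "coeff r i = 0" "coeff (roots_poly A) i = 0"
        using i add.prems(2) by (auto intro: coeff_eq_0)
      then show ?thesis by (simp add: r1_def)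
    qed (simp add: r1_def c_def)
  qed
  have frac: "L * ((s + y * P) / (L * P)) = s / P + y" if "L \<noteq> 0" "P \<noteq> 0" for L s y P :: rat_fun
    using that by (simp add: field_simps)
  have "r = r1 + [:c:] * roots_poly A" by (simp add: r1_def)
  have "to_fract [:-a, 1:] * (to_fract r / to_fract (roots_poly (add_mset a A))) = to_fract r1 / to_fract (roots_poly A) + to_fract [:c:]"
    unfolding roots_poly_add by (subst \<open>r = _\<close>, unfold to_fract_add to_fract_mult, intro frac) simp_all
  then have eq: "poly_circ [:-a, 1:] * w = rat_circ (to_fract r1 / to_fract (roots_poly A)) + poly_circ [:c:]"
    unfolding w_def by (simp only: rat_circ_mult[symmetric] rat_circ_add[symmetric])
  have rec: "fourier_coeff w (m - 1) = a * fourier_coeff w m" if m: "m \<ge> 1" for m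
  proof -
    have "fourier_coeff w (m - 1) - a * fourier_coeff w m = fourier_coeff (poly_circ [:-a, 1:] * w) m"
      by (rule fourier_coeff_mult_linear[symmetric, OF _ w]) simp
    also have "\<dots> = fourier_coeff (rat_circ (to_fract r1 / to_fract (roots_poly A))) m + fourier_coeff (poly_circ [:c:]) m"
      unfolding eq by (rule fourier_coeff_add[of _ 1]) (auto intro: Lp poly_circ_in_Lp)
    also have "\<dots> = 0" using add.IH[OF A r1, of m] m by (simp add: fourier_coeff_const)
    finally show ?thesis by simp
  qed
  have pw: "fourier_coeff w n = a ^ k * fourier_coeff w (n + int k)" for k
  proof (induction k)
    case (Suc k)
    then show ?case using rec[of "n + int (Suc k)"] \<open>n \<ge> 0\<close> by (simp add: algebra_simps)
  qed simp
  have "(\<lambda>k. norm a ^ k * Lp_norm 1 w) \<longlonglongrightarrow> 0"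
    using a by (intro tendsto_mult_left_zero LIMSEQ_power_zero) auto
  moreover have "norm (fourier_coeff w n) \<le> norm a ^ k * Lp_norm 1 w" for k
    using pw[of k] norm_fourier_coeff_le[OF _ w, of "n + int k"] by (simp add: norm_mult norm_power mult_left_mono)
  ultimately have "norm (fourier_coeff w n) \<le> 0"
    by (intro LIMSEQ_le_const) auto
  then show ?case by (simp add: w_def)
qed

text \<open>Dividing by z - b with b = \<rho> a just outside the disc stays in H^p. For u = g / (z -
  b) the error g - (z - a) u equals g (a - b) / (z - b), which is dominated by g and tends to 0 off
  a as b tends to a.\<close>

lemma Hp_linear_dense:
  assumes p: "p > 1" and g: "g \<in> Hp p" and a: "norm a = 1" and e: "e > 0"
  shows "\<exists>u\<in>Hp p. Lp_norm p (g - poly_circ [:-a, 1:] * u) < e"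
proof -
  obtain f where f [measurable]: "f \<in> borel_measurable arc_measure" and gf: "g = circ_of f" by (rule circ_of_cases)
  have int: "integrable arc_measure (\<lambda>z. norm (f z) powr p)" using Hp_in_Lp[OF g] f by (simp add: gf circ_of_in_Lp)
  define \<rho> where "\<rho> k = 1 + inverse (real (Suc k))" for k
  have \<rho>: "\<rho> k > 1" for k by (simp add: \<rho>_def)
  have \<rho>_lim: "\<rho> \<longlonglongrightarrow> 1"
    using tendsto_add[OF tendsto_const[of 1] LIMSEQ_inverse_real_of_nat] by (simp add: \<rho>_def[abs_def])
  define b where "b k = of_real (\<rho> k) * a" for k
  have nb: "norm (b k) = \<rho> k" for k using \<rho>[of k] a by (simp add: b_def norm_mult)
  define u where "u k = rat_circ (1 / to_fract [:- b k, 1:]) * g" for k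
  have u: "u k \<in> Hp p" for k unfolding u_def
  proof (rule rat_circ_mult_in_Hp[OF p g])
    have "b k \<notin> cball 0 1" using nb[of k] \<rho>[of k] by simp
    then show "rat_poles (1 / to_fract [:- b k, 1:]) \<inter> cball 0 1 = {}"
      using rat_poles_inverse_linear[of "b k"] by blast
  qed
  define v where "v k z = (a - b k) / (z - b k) * f z" for k z
  have [measurable]: "v k \<in> borel_measurable arc_measure" for k by (simp add: v_def[abs_def])
  have zb: "norm (z - b k) \<ge> \<rho> k - 1" "z \<noteq> b k" if "norm z = 1" for z k
    using norm_triangle_ineq2[of "b k" z] that nb[of k] \<rho>[of k] by (auto simp: norm_minus_commute)
  have diff: "g - poly_circ [:-a, 1:] * u k = circ_of (v k)" for k
  proof -
    define h where "h z = 1 / (z - b k) * f z" for z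
    have [measurable]: "h \<in> borel_measurable arc_measure" by (simp add: h_def[abs_def])
    have h: "(z - b k) * h z = f z" if "norm z = 1" for z using zb(2)[OF that, of k] by (simp add: h_def)
    have "poly_circ [:- b k, 1:] * circ_of h = circ_of (\<lambda>z. (z - b k) * h z)"
      by (simp add: poly_circ_eq circ_of_mult)
    also have "\<dots> = g" unfolding gf
      using AE_arc_norm h by (subst circ_of_eq_iff) (auto elim: eventually_mono)
    finally have uf: "u k = circ_of h"
      by (subst (asm) rat_circ_mult_eq_iff) (auto simp: u_def)
    have v: "v k z = f z - (z - a) * h z" if "norm z = 1" for z
    proof -
      have "z - b k \<noteq> 0" using zb(2)[OF that, of k] by simp
      moreover have "(a - b k) / w * y = y - (z - a) * (1 / w * y)" if "w = z - b k" "w \<noteq> 0" for w y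
        using that(2) by (simp add: field_simps) (simp add: that(1) algebra_simps)
      ultimately show ?thesis unfolding v_def h_def by blast
    qed
    have "g - poly_circ [:-a, 1:] * u k = circ_of (\<lambda>z. f z - (z - a) * h z)"
      unfolding uf gf by (simp add: poly_circ_eq circ_of_mult circ_of_diff)
    also have "\<dots> = circ_of (v k)"
      using AE_arc_norm v by (subst circ_of_eq_iff) (auto elim: eventually_mono)
    finally show ?thesis .
  qed
  have ab: "norm (a - b k) = \<rho> k - 1" for k
  proof -
    have "a - b k = of_real (1 - \<rho> k) * a" by (simp add: b_def algebra_simps)
    then show ?thesis using \<rho>[of k] by (simp only: norm_mult norm_of_real a) simp
  qed
  have "(\<lambda>k. \<integral>z. norm (v k z) powr p \<partial>arc_measure) \<longlonglongrightarrow> (\<integral>z. 0 \<partial>arc_measure)"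
  proof (rule integral_dominated_convergence[OF _ _ int])
    show "AE z in arc_measure. (\<lambda>k. norm (v k z) powr p) \<longlonglongrightarrow> 0"
      using AE_arc_neq[of a]
    proof eventually_elim
      case (elim z)
      have b_lim: "b \<longlonglongrightarrow> a"
        using tendsto_mult[OF tendsto_of_real[OF \<rho>_lim] tendsto_const[of a]] by (simp add: b_def[abs_def])
      have "(\<lambda>k. v k z) \<longlonglongrightarrow> (a - a) / (z - a) * f z"
        unfolding v_def using elim by (intro tendsto_intros b_lim) auto
      then have "(\<lambda>k. norm (v k z)) \<longlonglongrightarrow> 0" by (simp add: tendsto_norm_zero)
      from tendsto_powr'[OF this tendsto_const[of p]] p show ?case by simp
    qed
    show "AE z in arc_measure. norm (norm (v k z) powr p) \<le> norm (f z) powr p" for k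
      using AE_arc_norm
    proof eventually_elim
      case (elim z)
      \<comment> \<open>Among the points of the circle a is the nearest to b, at distance \<rho> -
        1.\<close>
      have "norm ((a - b k) / (z - b k)) \<le> 1"
        using zb[OF elim, of k] \<rho>[of k] by (simp add: norm_divide ab)
      then have "norm (v k z) \<le> norm (f z)" unfolding v_def norm_mult by (intro mult_left_le_one_le) auto
      then show ?case using p by (simp add: powr_mono2)
    qed
  qed auto
  then have "(\<lambda>k. (\<integral>z. norm (v k z) powr p \<partial>arc_measure)) \<longlonglongrightarrow> 0" by simp
  from tendsto_powr'[OF this tendsto_const[of "1 / p"]] p
  have "(\<lambda>k. (\<integral>z. norm (v k z) powr p \<partial>arc_measure) powr (1 / p)) \<longlonglongrightarrow> 0" by simp
  then have "(\<lambda>k. Lp_norm p (circ_of (v k))) \<longlonglongrightarrow> 0" by (simp add: Lp_norm_circ_of)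
  then have "eventually (\<lambda>k. Lp_norm p (circ_of (v k)) < e) sequentially" using e by (rule order_tendstoD)
  then obtain k where "Lp_norm p (circ_of (v k)) < e" by (auto simp: eventually_sequentially)
  then show ?thesis using u[of k] by (intro bexI[of _ "u k"]) (simp_all only: diff)
qed

lemma Hp_roots_dense:
  assumes p: "p > 1" and A: "set_mset A \<subseteq> sphere 0 1" and g: "g \<in> Hp p" and e: "e > 0"
  shows "\<exists>u\<in>Hp p. Lp_norm p (g - poly_circ (roots_poly A) * u) < e"
  using A g e
proof (induction A arbitrary: g e)
  case empty
  then show ?case using p by (intro bexI[of _ g]) auto
next
  case (add a A)
  from add.prems have a: "norm a = 1" by simp
  let ?L = "poly_circ [:-a, 1:]" and ?P = "poly_circ (roots_poly A)"
  obtain B where B: "B \<ge> 0" "\<And>x. x \<in> Lp p \<Longrightarrow> Lp_norm p (?L * x) \<le> B * Lp_norm p x"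
    using rat_circ_Lp_bounded[of "to_fract [:-a, 1:]" p] p by (metis inf_bot_left less_imp_le rat_poles_to_fract)
  obtain u1 where u1: "u1 \<in> Hp p" "Lp_norm p (g - ?L * u1) < e / 2"
    using Hp_linear_dense[OF p add.prems(2) a, of "e / 2"] add.prems(3) by auto
  \<comment> \<open>Adding 1 keeps the denominator positive and the bound B * d < e / 2 strict, also
    for B = 0.\<close>
  define d where "d = (e / 2) / (B + 1)"
  have d: "d > 0" "B * d < e / 2"
  proof -
    show "d > 0" using add.prems(3) B(1) by (simp add: d_def)
    then have "B * d < (B + 1) * d" by simp
    also have "(B + 1) * d = e / 2" unfolding d_def using B(1) by (intro nonzero_mult_div_cancel_left[of "B + 1", folded times_divide_eq_right]) simp
    finally show "B * d < e / 2" .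
  qed
  obtain u where u: "u \<in> Hp p" "Lp_norm p (u1 - ?P * u) < d"
    using add.IH[OF _ u1(1) d(1)] add.prems(1) by fastforce
  have Lp: "g - ?L * u1 \<in> Lp p" "u1 - ?P * u \<in> Lp p" "?L * (u1 - ?P * u) \<in> Lp p"
    using p add.prems(2) u u1 by (auto intro!: Hp_in_Lp Hp_diff poly_circ_mult_in_Hp)
  have "poly_circ (roots_poly (add_mset a A)) * u = ?L * (?P * u)"
    unfolding roots_poly_add poly_circ_mult_linear ..
  then have split: "g - poly_circ (roots_poly (add_mset a A)) * u = (g - ?L * u1) + ?L * (u1 - ?P * u)"
    by (simp add: right_diff_distrib)
  have "Lp_norm p (g - poly_circ (roots_poly (add_mset a A)) * u)
      \<le> Lp_norm p (g - ?L * u1) + Lp_norm p (?L * (u1 - ?P * u))"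
    unfolding split using p by (intro Lp_norm_triangle Lp) auto
  also have "Lp_norm p (?L * (u1 - ?P * u)) \<le> B * Lp_norm p (u1 - ?P * u)" by (rule B(2)[OF Lp(2)])
  also have "\<dots> \<le> B * d" using u(2) B by (intro mult_left_mono) auto
  finally have "Lp_norm p (g - poly_circ (roots_poly (add_mset a A)) * u) < e"
    using u1(2) d(2) by linarith
  then show ?case using u(1) by blast
qed

text \<open>The witness vanishes at \<open>a\<close> to order \<open>1 - 1 / p\<close>; the quotient by \<open>z - a\<close> then has modulus
  \<open>\<bar>z - a\<bar> powr (- 1 / p)\<close>, which just fails to be in \<open>L\<^sup>p\<close>.\<close>

lemma Hp_linear_infinite_codim:
  assumes p: "p > 1" and a: "norm a = 1"
  obtains x where "x \<in> Hp p" "\<And>u c. u \<in> Lp p \<Longrightarrow> x \<noteq> poly_circ [:-a, 1:] * u + poly_circ [:c:]"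
proof -
  define \<epsilon> where "\<epsilon> = 1 - 1 / p"
  have \<epsilon>: "\<epsilon> > 0" using p by (simp add: \<epsilon>_def)
  define \<phi> where "\<phi> z = (1 - z * cnj a) powr (of_real \<epsilon>)" for z
  have Re: "Re (z * cnj a) \<le> norm z" for z
    using complex_Re_le_cmod[of "z * cnj a"] a by (simp add: norm_mult)
  have aa: "a * cnj a = 1" using complex_norm_square[of a] a by simp
  \<comment> \<open>1 - z * cnj a stays in the closed right half-plane, away from the branch cut
    except at z = a, where the power is still continuous because \<epsilon> > 0.\<close>
  have cont: "continuous_on (cball 0 1) \<phi>" unfolding \<phi>_def
  proof (rule continuous_on_powr_complex)
    have "0 \<le> Re (1 - z * cnj a)" if "z \<in> cball 0 1" for z using Re[of z] that by simp
    then show "cball 0 1 \<subseteq> {z. 0 \<le> Re (1 - z * cnj a) \<or> Im (1 - z * cnj a) \<noteq> 0}" by blast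
  qed (use \<epsilon> in \<open>auto intro!: continuous_intros\<close>)
  have hol: "\<phi> holomorphic_on ball 0 1" unfolding \<phi>_def
  proof (intro holomorphic_intros)
    fix z :: complex assume "z \<in> ball 0 1"
    then have "Re (1 - z * cnj a) > 0" using Re[of z] by simp
    then show "1 - z * cnj a \<notin> \<real>\<^sub>\<le>\<^sub>0" by (auto simp: complex_nonpos_Reals_iff)
  qed
  have nphi: "norm (\<phi> z) = norm (z - a) powr \<epsilon>" if "norm z = 1" for z
  proof -
    have "1 - z * cnj a = (a - z) * cnj a" using aa by (simp add: algebra_simps)
    then have "norm (1 - z * cnj a) = norm (z - a)" using a by (simp add: norm_mult norm_minus_commute)
    then show ?thesis by (simp add: \<phi>_def norm_powr_real_powr')
  qed
  have m [measurable]: "\<phi> \<in> borel_measurable arc_measure"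
    by (intro measurable_arc_continuous continuous_on_subset[OF cont]) auto
  show ?thesis
  proof (rule that)
    show "circ_of \<phi> \<in> Hp p"
      using Hp_mult_holomorphic(1)[OF p one_in_Hp[OF p] hol cont] by (simp add: mult.commute[of _ "rat_circ 1"])
    fix u c assume u: "u \<in> Lp p"
    show "circ_of \<phi> \<noteq> poly_circ [:-a, 1:] * u + poly_circ [:c:]"
    proof
      assume eq: "circ_of \<phi> = poly_circ [:-a, 1:] * u + poly_circ [:c:]"
      obtain f where f [measurable]: "f \<in> borel_measurable arc_measure" and uf: "u = circ_of f" by (rule circ_of_cases)
      have int: "integrable arc_measure (\<lambda>z. norm (f z) powr p)" using u f by (simp add: uf circ_of_in_Lp)
      have AE: "AE z in arc_measure. \<phi> z = (z - a) * f z + c"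
        using eq by (simp add: uf poly_circ_eq circ_of_mult circ_of_add circ_of_eq_iff)
      have "integrable arc_measure (\<lambda>z. 1 / (z - a))"
      proof (cases "c = 0")
        case True
        show ?thesis
        proof (rule Bochner_Integration.integrable_bound[OF int])
          show "AE z in arc_measure. norm (1 / (z - a)) \<le> norm (norm (f z) powr p)"
            using AE AE_arc_norm AE_arc_neq[of a]
          proof eventually_elim
            case (elim z)
            define t where "t = norm (z - a)"
            have t: "t > 0" using elim by (simp add: t_def)
            have "t powr \<epsilon> = t * norm (f z)"
              using nphi[OF elim(2)] elim(1) True by (simp add: t_def norm_mult)
            then have "norm (f z) = t powr \<epsilon> / t" using t by (simp add: field_simps)
            also have "\<dots> = t powr (\<epsilon> - 1)" using t by (simp add: powr_diff)
            finally have "norm (f z) powr p = t powr ((\<epsilon> - 1) * p)" by (simp add: powr_powr)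
            also have "(\<epsilon> - 1) * p = -1" using p by (simp add: \<epsilon>_def)
            finally show ?case using t by (simp add: powr_minus_divide norm_divide t_def)
          qed
        qed measurable
      next
        case False
        \<comment> \<open>Near a the witness is smaller than half of norm c, so (z - a) f has
          modulus at least norm c / 2 there and f dominates a multiple of 1 / (z - a); farther than
          d from a the quotient is at most 1 / d.\<close>
        have "((\<lambda>t. t powr \<epsilon>) \<longlongrightarrow> 0 powr \<epsilon>) (at_right (0::real))"
          using \<epsilon> by (intro tendsto_powr' tendsto_ident_at tendsto_const) (auto simp: eventually_at_filter)
        then have "eventually (\<lambda>t. t powr \<epsilon> < norm c / 2) (at_right (0::real))"
          using False by (intro order_tendstoD) auto
        then obtain d where d: "d > 0" "\<And>t. 0 < t \<Longrightarrow> t < d \<Longrightarrow> t powr \<epsilon> < norm c / 2"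
          by (auto simp: eventually_at_right_field)
        have fi: "integrable arc_measure f" using p by (intro integrable_arc_of_powr[OF f int]) auto
        show ?thesis
        proof (rule Bochner_Integration.integrable_bound)
          show "integrable arc_measure (\<lambda>z. 2 / norm c * norm (f z) + 1 / d)" using fi by auto
          show "AE z in arc_measure. norm (1 / (z - a)) \<le> norm (2 / norm c * norm (f z) + 1 / d)"
            using AE AE_arc_norm AE_arc_neq[of a]
          proof eventually_elim
            case (elim z)
            define t where "t = norm (z - a)"
            have t: "t > 0" using elim by (simp add: t_def)
            have "1 / t \<le> 2 / norm c * norm (f z) + 1 / d"
            proof (cases "t < d")
              case True
              then have "norm (\<phi> z) < norm c / 2" using nphi[OF elim(2)] d(2)[OF t] by (simp add: t_def)
              moreover have "norm c \<le> norm (\<phi> z) + norm ((z - a) * f z)"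
                using norm_triangle_ineq4[of "\<phi> z" "(z - a) * f z"] elim(1) by simp
              ultimately have "norm c / 2 \<le> t * norm (f z)" by (simp add: norm_mult t_def)
              then have "1 / t \<le> 2 / norm c * norm (f z)" using t False by (simp add: field_simps)
              then show ?thesis using d(1) by (simp add: add_increasing2)
            next
              case False
              then have "1 / t \<le> 1 / d" using d(1) by (intro divide_left_mono) auto
              then show ?thesis by (simp add: add_increasing)
            qed
            then show ?case by (simp add: norm_divide t_def)
          qed
        qed measurable
      qed
      then show False using not_integrable_arc_inverse[OF a] by blast
    qed
  qed
qed


section \<open>Partial fractions\<close>

text \<open>Stated by coefficients, so as to be a subspace for every n: a strict degree bound would
  exclude the zero polynomial at n = 0, since \<open>degree 0 = 0\<close>.\<close>

definition poly_below :: "nat \<Rightarrow> complex poly \<Rightarrow> bool" where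
  "poly_below n r \<longleftrightarrow> (\<forall>i\<ge>n. coeff r i = 0)"

lemma poly_below_iff: "poly_below n r \<longleftrightarrow> r = 0 \<or> degree r < n"
proof
  assume "poly_below n r"
  then show "r = 0 \<or> degree r < n"
    unfolding poly_below_def by (metis leading_coeff_0_iff not_less)
qed (auto simp: poly_below_def intro: coeff_eq_0)

lemma poly_below_0 [simp]: "poly_below n 0"
  and poly_below_add: "poly_below n r \<Longrightarrow> poly_below n s \<Longrightarrow> poly_below n (r + s)"
  and poly_below_diff: "poly_below n r \<Longrightarrow> poly_below n s \<Longrightarrow> poly_below n (r - s)"
  and poly_below_uminus: "poly_below n (- r) \<longleftrightarrow> poly_below n r"
  and poly_below_mono: "poly_below n r \<Longrightarrow> n \<le> m \<Longrightarrow> poly_below m r"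
  by (auto simp: poly_below_def)

lemma poly_below_mult:
  assumes "P \<noteq> 0"
  shows "poly_below (degree P + n) (P * r) \<longleftrightarrow> poly_below n r"
  using assms by (cases "r = 0") (auto simp: poly_below_iff degree_mult_eq)

lemma poly_below_mod: "P \<noteq> 0 \<Longrightarrow> poly_below (degree P) (r mod P)"
  unfolding poly_below_iff by (rule degree_mod_less)

lemma poly_below_dvd_imp_0: "poly_below n r \<Longrightarrow> P dvd r \<Longrightarrow> n \<le> degree P \<Longrightarrow> r = 0"
  unfolding poly_below_iff by (metis dvd_imp_degree_le leD order_less_le_trans)

lemma coprime_no_common_root:
  fixes P R :: "complex poly"
  shows "coprime P R \<Longrightarrow> poly P z = 0 \<Longrightarrow> poly R z \<noteq> 0"
  using coprime_poly_0[of P R z] by blast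

lemma coprimeI_no_common_root:
  fixes P R :: "complex poly"
  assumes "P \<noteq> 0" "\<And>z. poly P z = 0 \<Longrightarrow> poly R z \<noteq> 0"
  shows "coprime P R"
proof (rule coprimeI)
  fix c assume c: "c dvd P" "c dvd R"
  then have c0: "c \<noteq> 0" using assms(1) by auto
  have "degree c = 0"
  proof (rule ccontr)
    assume "degree c \<noteq> 0"
    then obtain z where "poly c z = 0" using alg_closed_imp_poly_has_root by blast
    then have "poly P z = 0" "poly R z = 0" using c by (auto elim!: dvdE)
    then show False using assms(2) by blast
  qed
  then show "c dvd 1" using c0 by (simp add: is_unit_iff_degree)
qed

lemma coprime_poly_solve:
  fixes P R w :: "complex poly"
  assumes "coprime P R"
  obtains v u where "w = P * v + R * u"
proof -
  have "fst (bezout_coefficients P R) * P + snd (bezout_coefficients P R) * R = 1"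
    using assms by (simp add: bezout_coefficients_fst_snd)
  then have "w = (fst (bezout_coefficients P R) * P + snd (bezout_coefficients P R) * R) * w" by simp
  also have "\<dots> = P * (fst (bezout_coefficients P R) * w) + R * (snd (bezout_coefficients P R) * w)"
    by (simp add: algebra_simps)
  finally show ?thesis by (rule that)
qed

text \<open>A Bezout representation has no degree control. Reducing one numerator modulo P settles
  a, and the degree of b is then forced by P * b = r - R * a.\<close>

lemma poly_partial_fractions:
  assumes c: "coprime P R" and P: "P \<noteq> 0" and R: "R \<noteq> 0" and r: "poly_below (degree P + degree R) r"
  obtains a b where "poly_below (degree P) a" "poly_below (degree R) b"
    "to_fract r / (to_fract P * to_fract R) = to_fract a / to_fract P + to_fract b / to_fract R"
proof -
  obtain v u where vu: "r = R * v + P * u" using coprime_poly_solve[of R P r] c by (metis coprime_commute)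
  define a where "a = v mod P"
  define b where "b = u + R * (v div P)"
  have r': "r = R * a + P * b"
  proof -
    have "R * v = R * (v mod P + P * (v div P))" by simp
    also have "\<dots> = R * (v mod P) + P * (R * (v div P))" by (simp only: distrib_left mult.left_commute)
    finally show ?thesis unfolding vu a_def b_def distrib_left by (simp only: add_ac)
  qed
  have a: "poly_below (degree P) a" unfolding a_def by (rule poly_below_mod[OF P])
  have "poly_below (degree R + degree P) (R * a)" using a by (simp add: poly_below_mult[OF R])
  then have "poly_below (degree P + degree R) (r - R * a)"
    using r by (intro poly_below_diff) (simp_all add: add.commute)
  then have b: "poly_below (degree R) b" by (simp add: r' poly_below_mult[OF P])
  have "to_fract r / (to_fract P * to_fract R) = to_fract a / to_fract P + to_fract b / to_fract R"
    using P R unfolding r' to_fract_add to_fract_mult by (simp add: field_simps)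
  with a b show ?thesis by (rule that)
qed

lemma poly_split_roots:
  assumes "P \<noteq> (0 :: complex poly)"
  obtains R where "P = roots_poly {#z \<in># proots P. z \<in> X#} * R" "\<And>z. z \<in> X \<Longrightarrow> poly R z \<noteq> 0" "R \<noteq> 0"
proof -
  define R where "R = smult (lead_coeff P) (roots_poly {#z \<in># proots P. z \<notin> X#})"
  have "P = smult (lead_coeff P) (roots_poly (proots P))"
    unfolding roots_poly_def by (rule complex_poly_decompose_multiset[symmetric])
  also have "roots_poly (proots P) = roots_poly {#z \<in># proots P. z \<in> X#} * roots_poly {#z \<in># proots P. z \<notin> X#}"
    unfolding roots_poly_union[symmetric] by (simp flip: multiset_partition)
  finally have "P = roots_poly {#z \<in># proots P. z \<in> X#} * R" by (simp add: R_def)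
  moreover have "poly R z \<noteq> 0" if "z \<in> X" for z using that assms by (auto simp: R_def)
  ultimately show ?thesis using that assms by (metis mult_zero_right)
qed

section \<open>Strictly proper rational functions with poles on the circle\<close>

lemma Rat0_circleI:
  assumes A: "set_mset A \<subseteq> sphere 0 1" and b: "poly_below (size A) b"
  shows "to_fract b / to_fract (roots_poly A) \<in> Rat0_circle"
proof -
  let ?r = "to_fract b / to_fract (roots_poly A)"
  have "rat_poles ?r \<subseteq> sphere 0 1"
  proof
    fix z assume "z \<in> rat_poles ?r"
    then have "z \<in># A" using rat_poles_quotient[of "roots_poly A" z b] by auto
    then show "z \<in> sphere 0 1" using A by auto
  qed
  moreover have "degree (rat_num ?r) < degree (rat_den ?r)" if "?r \<noteq> 0"
  proof -
    have cross: "rat_num ?r * roots_poly A = b * rat_den ?r" by (rule rat_num_den_cross) simp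
    have b0: "b \<noteq> 0" using that by auto
    then have "rat_num ?r \<noteq> 0" using cross rat_num_den(2)[of ?r] by auto
    then have "degree (rat_num ?r) + size A = degree b + degree (rat_den ?r)"
      using arg_cong[OF cross, of degree] b0 rat_num_den(2)[of ?r] by (simp add: degree_mult_eq)
    moreover have "degree b < size A" using b b0 by (simp add: poly_below_iff)
    ultimately show ?thesis by simp
  qed
  ultimately show ?thesis by (auto simp: Rat0_circle_def)
qed

lemma Rat0_circle_cases:
  assumes "\<rho> \<in> Rat0_circle"
  obtains A b where "set_mset A \<subseteq> sphere 0 1" "poly_below (size A) b" "\<rho> = to_fract b / to_fract (roots_poly A)"
proof -
  obtain R where R: "rat_den \<rho> = roots_poly {#z \<in># proots (rat_den \<rho>). z \<in> UNIV#} * R" "\<And>z. poly R z \<noteq> 0"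
    by (rule poly_split_roots[of "rat_den \<rho>" UNIV]) (use rat_num_den(2) in auto)
  define A where "A = proots (rat_den \<rho>)"
  have "degree R = 0" using R(2) alg_closed_imp_poly_has_root[of R] by auto
  then obtain c where c: "R = [:c:]" by (rule degree_eq_zeroE)
  have c0: "c \<noteq> 0" using R(2)[of 0] c by auto
  have den: "rat_den \<rho> = smult c (roots_poly A)" using R(1) c by (simp add: A_def)
  show ?thesis
  proof (rule that)
    show "set_mset A \<subseteq> sphere 0 1" using assms by (auto simp: A_def Rat0_circle_def rat_poles_def rat_num_den(2))
    have "poly_below (degree (rat_den \<rho>)) (rat_num \<rho>)"
      using assms by (auto simp: Rat0_circle_def poly_below_iff rat_num_def)
    then show "poly_below (size A) (smult (inverse c) (rat_num \<rho>))"
      using c0 by (simp add: den poly_below_iff)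
    have "\<rho> = to_fract (rat_num \<rho>) / to_fract (rat_den \<rho>)" by (rule rat_num_den(1)[symmetric])
    also have "\<dots> = to_fract (smult (inverse c) (rat_num \<rho>)) / to_fract (roots_poly A)"
    proof (subst frac_eq_eq)
      show "to_fract (rat_num \<rho>) * to_fract (roots_poly A) = to_fract (smult (inverse c) (rat_num \<rho>)) * to_fract (rat_den \<rho>)"
        using c0 by (simp add: den flip: to_fract_mult)
    qed (simp_all add: rat_num_den(2))
    finally show "\<rho> = to_fract (smult (inverse c) (rat_num \<rho>)) / to_fract (roots_poly A)" .
  qed
qed

text \<open>The difference of the rational parts lies in L^p, so its denominator on the circle
  divides its numerator; a strictly proper fraction that is a polynomial vanishes. This makes the
  definite description in \<open>toeplitz\<close> well defined.\<close>

lemma Rat0_circle_decomp_unique: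
  assumes p: "p \<ge> 1" and f: "f1 \<in> Lp p" "f2 \<in> Lp p" and \<rho>: "\<rho>1 \<in> Rat0_circle" "\<rho>2 \<in> Rat0_circle"
    and eq: "f1 + rat_circ \<rho>1 = f2 + rat_circ \<rho>2"
  shows "f1 = f2"
proof -
  obtain A1 b1 where 1: "set_mset A1 \<subseteq> sphere 0 1" "poly_below (size A1) b1" "\<rho>1 = to_fract b1 / to_fract (roots_poly A1)"
    using \<rho>(1) by (rule Rat0_circle_cases)
  obtain A2 b2 where 2: "set_mset A2 \<subseteq> sphere 0 1" "poly_below (size A2) b2" "\<rho>2 = to_fract b2 / to_fract (roots_poly A2)"
    using \<rho>(2) by (rule Rat0_circle_cases)
  define N where "N = b2 * roots_poly A1 - b1 * roots_poly A2"
  have "rat_circ (\<rho>2 - \<rho>1) = f1 - f2" using eq by (simp add: rat_circ_diff algebra_simps)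
  then have x: "rat_circ (\<rho>2 - \<rho>1) \<in> Lp p" using Lp_minus[OF p f] by simp
  have "to_fract (roots_poly (A1 + A2)) * (\<rho>2 - \<rho>1) = to_fract N"
    unfolding 1 2 N_def roots_poly_union to_fract_mult to_fract_diff by (simp add: field_simps)
  then have "poly_circ (roots_poly (A1 + A2)) * rat_circ (\<rho>2 - \<rho>1) = poly_circ N"
    by (simp flip: rat_circ_mult)
  then obtain r' where "N = roots_poly (A1 + A2) * r'"
    using dvd_of_mult_Lp_eq_poly[OF p _ x, of "A1 + A2"] 1 2 by (metis set_mset_union sup.bounded_iff)
  then have "roots_poly (A1 + A2) dvd N" by simp
  moreover have "poly_below (size A1 + size A2) N"
    using 1(2) 2(2) poly_below_mult[of "roots_poly A1" "size A2" b2] poly_below_mult[of "roots_poly A2" "size A1" b1]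
    unfolding N_def by (intro poly_below_diff) (simp_all add: ac_simps)
  ultimately have "N = 0" by (intro poly_below_dvd_imp_0) auto
  then have "\<rho>2 - \<rho>1 = 0" using \<open>to_fract (roots_poly (A1 + A2)) * (\<rho>2 - \<rho>1) = to_fract N\<close> by simp
  then show ?thesis using eq by simp
qed


section \<open>The graph of the Toeplitz-like operator\<close>

lemma toeplitz_eqI:
  assumes p: "p > 1" and f: "f \<in> Lp p" and \<rho>: "\<rho> \<in> Rat0_circle" and eq: "rat_circ \<omega> * g = f + rat_circ \<rho>"
  shows "toeplitz p \<omega> g = riesz_proj p f"
proof -
  have "(THE f. f \<in> Lp p \<and> (\<exists>\<rho>\<in>Rat0_circle. rat_circ \<omega> * g = f + rat_circ \<rho>)) = f"
  proof (rule the_equality)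
    fix f' assume "f' \<in> Lp p \<and> (\<exists>\<rho>\<in>Rat0_circle. rat_circ \<omega> * g = f' + rat_circ \<rho>)"
    then obtain \<rho>' where "f' \<in> Lp p" "\<rho>' \<in> Rat0_circle" "rat_circ \<omega> * g = f' + rat_circ \<rho>'" by blast
    then show "f' = f" using p f \<rho> eq by (intro Rat0_circle_decomp_unique[of p f' f \<rho>' \<rho>]) auto
  qed (use f \<rho> eq in blast)
  then show ?thesis by (simp add: toeplitz_def)
qed

lemma rat_poles_quotient_disjoint:
  "(\<And>z. z \<in> X \<Longrightarrow> poly D z \<noteq> 0) \<Longrightarrow> rat_poles (to_fract N / to_fract D) \<inter> X = {}"
  using rat_poles_quotient by blast

context
  fixes p :: real and A A0 :: "complex multiset" and s q1 :: "complex poly"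
  assumes p: "p > 1" and A: "set_mset A \<subseteq> ball 0 1" and A0: "set_mset A0 \<subseteq> sphere 0 1"
    and q1: "\<And>z. z \<in> cball 0 1 \<Longrightarrow> poly q1 z \<noteq> 0"
begin

lemma coprime_interior_circle: "coprime (roots_poly A) (roots_poly A0)"
  using A A0 by (intro coprimeI_no_common_root) fastforce+

lemma q1_neq_0: "q1 \<noteq> 0"
  using q1[of 0] by auto

text \<open>Division of the equation by q leaves h plus a strictly proper fraction, which partial
  fractions split by the location of its poles. The circle part is the function \<rho> of the
  definition; the disc part belongs to f and has no coefficients of index \<ge> 0, so the projection
  leaves h.\<close>

lemma toeplitz_graph_intro:
  assumes g: "g \<in> Hp p" and h: "h \<in> Hp p" and r: "poly_below (size (A + A0)) r"
    and eq: "poly_circ s * g = poly_circ (roots_poly (A + A0) * q1) * h + poly_circ (q1 * r)"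
  shows "g \<in> toeplitz_dom p (to_fract s / to_fract (roots_poly (A + A0) * q1))"
    and "toeplitz p (to_fract s / to_fract (roots_poly (A + A0) * q1)) g = h"
proof -
  let ?\<omega> = "to_fract s / to_fract (roots_poly (A + A0) * q1)" and ?q = "to_fract (roots_poly (A + A0) * q1)"
  obtain a b where ab: "poly_below (size A) a" "poly_below (size A0) b"
    "to_fract r / (to_fract (roots_poly A) * to_fract (roots_poly A0)) = to_fract a / to_fract (roots_poly A) + to_fract b / to_fract (roots_poly A0)"
    using poly_partial_fractions[OF coprime_interior_circle, of r] r by auto
  have qn: "?q \<noteq> 0" using q1_neq_0 by simp
  let ?a = "rat_circ (to_fract a / to_fract (roots_poly A))" and ?\<rho> = "to_fract b / to_fract (roots_poly A0)"
  have "rat_circ ?\<omega> * g = rat_circ (1 / ?q) * (poly_circ s * g)"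
    by (simp add: rat_circ_mult_assoc)
  also have "\<dots> = h + rat_circ (to_fract (q1 * r) / ?q)"
    unfolding eq distrib_left using qn by (simp only: rat_circ_mult_assoc rat_circ_mult[symmetric]) (simp del: to_fract_mult)
  also have "to_fract (q1 * r) / ?q = to_fract a / to_fract (roots_poly A) + ?\<rho>"
    using q1_neq_0 unfolding ab(3)[symmetric] by (simp add: roots_poly_union field_simps)
  finally have eq': "rat_circ ?\<omega> * g = (h + ?a) + rat_circ ?\<rho>"
    by (simp add: rat_circ_add add.assoc)
  have disj: "set_mset A \<inter> sphere 0 1 = {}" using A by fastforce
  have aLp: "?a \<in> Lp p" using p by (intro rat_circ_quotient_in_Lp disj) auto
  have Lp: "h + ?a \<in> Lp p" using Lp_add[OF _ Hp_in_Lp[OF h] aLp] p by simp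
  have \<rho>: "?\<rho> \<in> Rat0_circle" by (rule Rat0_circleI[OF A0 ab(2)])
  show "g \<in> toeplitz_dom p ?\<omega>" unfolding toeplitz_dom_def using g Lp \<rho> eq' by blast
  have "toeplitz p ?\<omega> g = riesz_proj p (h + ?a)" by (rule toeplitz_eqI[OF p Lp \<rho> eq'])
  also have "\<dots> = h"
  proof (rule riesz_proj_eqI[OF p h])
    fix n :: int assume n: "n \<ge> 0"
    have "fourier_coeff ?a n = 0"
      using fourier_coeff_strictly_proper[OF A _ n] ab(1) by (simp add: poly_below_def)
    then show "fourier_coeff h n = fourier_coeff (h + ?a) n"
      using fourier_coeff_add[OF Hp_in_Lp[OF h] aLp, of n] p by simp
  qed
  finally show "toeplitz p ?\<omega> g = h" .
qed

text \<open>Division with remainder by the roots in the disc and Smirnov's principle for the roots on the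
  circle show that \<open>f\<close> differs from a member of \<open>H\<^sup>p\<close> by a strictly proper rational function with
  poles in the disc, which the projection annihilates.\<close>

lemma toeplitz_graph_exists:
  assumes g: "g \<in> toeplitz_dom p (to_fract s / to_fract (roots_poly (A + A0) * q1))"
  shows "\<exists>h\<in>Hp p. \<exists>r. poly_below (size (A + A0)) r \<and>
    poly_circ s * g = poly_circ (roots_poly (A + A0) * q1) * h + poly_circ (q1 * r)"
proof -
  let ?Q = "to_fract (roots_poly A)" and ?R = "to_fract (roots_poly A0)" and ?u = "to_fract q1" and ?s = "to_fract s"
  have nz: "?Q \<noteq> 0" "?R \<noteq> 0" "?u \<noteq> 0" using q1_neq_0 by auto
  from g obtain f \<rho> where gH: "g \<in> Hp p" and f: "f \<in> Lp p" and \<rho>: "\<rho> \<in> Rat0_circle"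
    and eq: "rat_circ (?s / (?Q * ?R * ?u)) * g = f + rat_circ \<rho>"
    unfolding toeplitz_dom_def roots_poly_union to_fract_mult by blast
  obtain B b where B: "set_mset B \<subseteq> sphere 0 1" and b: "poly_below (size B) b" and \<rho>b: "\<rho> = to_fract b / to_fract (roots_poly B)"
    using \<rho> by (rule Rat0_circle_cases)
  let ?D = "to_fract (roots_poly B)" and ?b = "to_fract b"
  have Dn: "?D \<noteq> 0" by simp
  \<comment> \<open>Multiplication by the circle factors of q and of \<rho> clears all poles on the
    circle; a further factor Q then yields a member of H^p.\<close>
  define y where "y = rat_circ (?R * ?D) * f"
  have "rat_circ ?Q * y = rat_circ (?Q * (?R * ?D)) * (rat_circ (?s / (?Q * ?R * ?u)) * g - rat_circ \<rho>)"
    unfolding y_def eq by (simp add: rat_circ_mult_assoc)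
  also have "\<dots> = rat_circ (?Q * (?R * ?D) * (?s / (?Q * ?R * ?u))) * g - rat_circ (?Q * (?R * ?D) * \<rho>)"
    by (simp only: right_diff_distrib rat_circ_mult_assoc rat_circ_mult[symmetric])
  also have "?Q * (?R * ?D) * (?s / (?Q * ?R * ?u)) = to_fract (roots_poly B * s) / ?u"
    using nz by (simp add: field_simps)
  also have "?Q * (?R * ?D) * \<rho> = to_fract (roots_poly A * roots_poly A0 * b)"
    using Dn by (simp add: \<rho>b)
  also have "rat_circ (to_fract (roots_poly B * s) / ?u) * g - poly_circ (roots_poly A * roots_poly A0 * b) \<in> Hp p"
    by (intro Hp_diff[OF p] rat_circ_mult_in_Hp[OF p gH] poly_circ_in_Hp[OF p] rat_poles_quotient_disjoint q1)
  finally have v: "rat_circ ?Q * y \<in> Hp p" .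
  obtain h1 r1 where h1: "h1 \<in> Hp p" "rat_circ ?Q * y = rat_circ ?Q * h1 + poly_circ r1" "poly_below (size A) r1"
    using Hp_division[OF p A] v unfolding poly_below_def by meson
  have y: "y = h1 + rat_circ (to_fract r1 / ?Q)"
  proof -
    have "rat_circ ?Q * (h1 + rat_circ (to_fract r1 / ?Q)) = rat_circ ?Q * y"
      unfolding h1(2) using nz by (simp add: distrib_left flip: rat_circ_mult)
    then show ?thesis using rat_circ_mult_cancel[OF nz(1)] by metis
  qed
  \<comment> \<open>The remainder r1 is spread over disc and circle factors so that the disc part a
    / Q can be subtracted from f itself. What is left, multiplied by the circle factors, equals h1 +
    b1 and lies in H^p.\<close>
  have cop: "coprime (roots_poly A) (roots_poly (A0 + B))"
    using A A0 B by (intro coprimeI_no_common_root) fastforce+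
  have bel: "poly_below (degree (roots_poly A) + degree (roots_poly (A0 + B))) r1"
    using h1(3) by (rule poly_below_mono) simp
  obtain a b1 where ab: "poly_below (size A) a"
    "to_fract r1 / (?Q * to_fract (roots_poly (A0 + B))) = to_fract a / ?Q + to_fract b1 / to_fract (roots_poly (A0 + B))"
    by (rule poly_partial_fractions[OF cop roots_poly_neq_0 roots_poly_neq_0 bel]) (use that in simp)
  let ?a = "rat_circ (to_fract a / ?Q)"
  have disj: "set_mset A \<inter> sphere 0 1 = {}" using A by fastforce
  have aLp: "?a \<in> Lp p" using p by (intro rat_circ_quotient_in_Lp disj) auto
  define h where "h = f - ?a"
  have hLp: "h \<in> Lp p" unfolding h_def using p f aLp by (intro Lp_minus) auto
  have "poly_circ (roots_poly (A0 + B)) * h = h1 + poly_circ b1"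
  proof -
    have "to_fract r1 / ?Q = to_fract (roots_poly (A0 + B)) * (to_fract r1 / (?Q * to_fract (roots_poly (A0 + B))))"
      using nz by simp
    also have "\<dots> = to_fract (roots_poly (A0 + B)) * (to_fract a / ?Q) + to_fract b1"
      unfolding ab(2) using nz by (simp add: field_simps)
    finally have 1: "to_fract r1 / ?Q = to_fract (roots_poly (A0 + B)) * (to_fract a / ?Q) + to_fract b1" .
    have "poly_circ (roots_poly (A0 + B)) * h = y - rat_circ (to_fract (roots_poly (A0 + B)) * (to_fract a / ?Q))"
      unfolding h_def right_diff_distrib y_def roots_poly_union to_fract_mult rat_circ_mult ..
    then show ?thesis unfolding y 1 rat_circ_add by simp
  qed
  then have "poly_circ (roots_poly (A0 + B)) * h \<in> Hp p"
    using Hp_add(1)[OF p h1(1) poly_circ_in_Hp[OF p]] by simp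
  then have h: "h \<in> Hp p" using A0 B by (intro Hp_smirnov_roots[OF p _ hLp, of "A0 + B"]) auto
  \<comment> \<open>The denominator of \<rho> could a priori exceed the circle part of q, and r
    would then have no degree bound. Solving the equation for \<rho> shows that its product with
    that circle part lies in L^p, hence is a polynomial b'.\<close>
  define x where "x = rat_circ (?R * (?b / ?D))"
  have "rat_circ (?s / (?Q * ?R * ?u)) * g = h + ?a + rat_circ \<rho>" unfolding eq h_def by simp
  then have "rat_circ \<rho> = rat_circ (?s / (?Q * ?R * ?u)) * g - h - ?a" by simp
  then have "x = rat_circ ?R * (rat_circ (?s / (?Q * ?R * ?u)) * g - h - ?a)"
    unfolding x_def \<rho>b[symmetric] rat_circ_mult[of ?R \<rho>] by (simp only:)
  also have "\<dots> = rat_circ (?R * (?s / (?Q * ?R * ?u))) * g - rat_circ ?R * h - rat_circ ?R * ?a"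
    by (simp only: right_diff_distrib rat_circ_mult_assoc)
  also have "?R * (?s / (?Q * ?R * ?u)) = ?s / to_fract (roots_poly A * q1)"
    using nz by (simp add: field_simps)
  also have "rat_circ (?s / to_fract (roots_poly A * q1)) * g - rat_circ ?R * h - rat_circ ?R * ?a \<in> Lp p"
  proof (intro Lp_minus poly_circ_mult_in_Lp hLp aLp)
    have "poly (roots_poly A * q1) z \<noteq> 0" if "z \<in> sphere 0 1" for z
      using that disj q1[of z] by auto
    then show "rat_circ (?s / to_fract (roots_poly A * q1)) * g \<in> Lp p"
      using p by (intro rat_circ_mult_in_Lp rat_poles_quotient_disjoint Hp_in_Lp[OF gH]) auto
  qed (use p in auto)
  finally have x: "x \<in> Lp p" .
  have "rat_circ ?D * x = poly_circ (roots_poly A0 * b)"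
    unfolding x_def rat_circ_mult[symmetric] using Dn by simp
  then obtain b' where b': "roots_poly A0 * b = roots_poly B * b'" "x = poly_circ b'"
    using dvd_of_mult_Lp_eq_poly[OF _ B x] p by (metis less_imp_le)
  have "poly_below (size B + size A0) (roots_poly A0 * b)"
    using b poly_below_mult[of "roots_poly A0" "size B" b] by (simp add: add.commute)
  then have below: "poly_below (size A0) b'"
    unfolding b' using poly_below_mult[of "roots_poly B" "size A0" b'] by simp
  have \<rho>b': "\<rho> = to_fract b' / ?R"
  proof -
    have "?R * ?b = ?D * to_fract b'" using b'(1) by (simp flip: to_fract_mult)
    then show ?thesis using Dn nz by (simp add: \<rho>b frac_eq_eq mult.commute)
  qed
  define r where "r = roots_poly A0 * a + roots_poly A * b'"
  have "poly_below (size (A + A0)) r"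
    unfolding r_def using ab(1) below poly_below_mult[of "roots_poly A0" "size A" a] poly_below_mult[of "roots_poly A" "size A0" b']
    by (intro poly_below_add) (simp_all add: add.commute)
  moreover have "poly_circ s * g = poly_circ (roots_poly (A + A0) * q1) * h + poly_circ (q1 * r)"
  proof -
    have "poly_circ s * g = rat_circ (?Q * ?R * ?u) * (rat_circ (?s / (?Q * ?R * ?u)) * g)"
      using nz by (simp add: rat_circ_mult_assoc)
    also have "\<dots> = rat_circ (?Q * ?R * ?u) * (h + rat_circ (to_fract a / ?Q + \<rho>))"
      unfolding eq h_def by (simp add: rat_circ_add)
    also have "\<dots> = rat_circ (?Q * ?R * ?u) * h + rat_circ ((?Q * ?R * ?u) * (to_fract a / ?Q + \<rho>))"
      by (simp only: distrib_left[of _ h] rat_circ_mult[symmetric])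
    also have "(?Q * ?R * ?u) * (to_fract a / ?Q + \<rho>) = to_fract (q1 * r)"
      using nz unfolding \<rho>b' r_def by (simp add: field_simps)
    finally show ?thesis by (simp add: roots_poly_union)
  qed
  ultimately show ?thesis using h by blast
qed

lemma toeplitz_graph:
  "g \<in> toeplitz_dom p (to_fract s / to_fract (roots_poly (A + A0) * q1)) \<and>
     toeplitz p (to_fract s / to_fract (roots_poly (A + A0) * q1)) g = h \<longleftrightarrow>
   g \<in> Hp p \<and> h \<in> Hp p \<and> (\<exists>r. poly_below (size (A + A0)) r \<and>
     poly_circ s * g = poly_circ (roots_poly (A + A0) * q1) * h + poly_circ (q1 * r))"
  (is "?L \<longleftrightarrow> ?R")
proof
  assume L: ?L
  then have gH: "g \<in> Hp p" by (simp add: toeplitz_dom_def)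
  from L toeplitz_graph_exists obtain h' r where h': "h' \<in> Hp p" "poly_below (size (A + A0)) r"
    "poly_circ s * g = poly_circ (roots_poly (A + A0) * q1) * h' + poly_circ (q1 * r)" by blast
  from toeplitz_graph_intro(2)[OF gH this] L have "h' = h" by simp
  then show ?R using gH h' by blast
next
  assume ?R
  then show ?L using toeplitz_graph_intro by blast
qed

end


section \<open>The range\<close>

text \<open>The range with the factors t1 and q1 removed. C is kept as a single argument because the
  disc roots alone and all roots of l q - s in the closed disc are both inserted for it.\<close>

definition symbol_range :: "real \<Rightarrow> complex multiset \<Rightarrow> complex multiset \<Rightarrow> circ_fun set" where
  "symbol_range p A C = {h \<in> Hp p. \<exists>u\<in>Hp p. \<exists>r. poly_below (size A) r \<and>
     poly_circ (roots_poly C) * u = poly_circ (roots_poly A) * h + poly_circ r}"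

lemma symbol_rangeI:
  "h \<in> Hp p \<Longrightarrow> u \<in> Hp p \<Longrightarrow> poly_below (size A) r \<Longrightarrow>
    poly_circ (roots_poly C) * u = poly_circ (roots_poly A) * h + poly_circ r \<Longrightarrow>
    h \<in> symbol_range p A C"
  unfolding symbol_range_def by blast

lemma symbol_rangeE:
  assumes "h \<in> symbol_range p A C"
  obtains u r where "h \<in> Hp p" "u \<in> Hp p" "poly_below (size A) r"
    "poly_circ (roots_poly C) * u = poly_circ (roots_poly A) * h + poly_circ r"
  using assms unfolding symbol_range_def by blast

lemma symbol_range_add:
  assumes p: "p > 1" and h: "h \<in> symbol_range p A C" "h' \<in> symbol_range p A C"
  shows "h + h' \<in> symbol_range p A C"
proof -
  obtain u r where 1: "h \<in> Hp p" "u \<in> Hp p" "poly_below (size A) r"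
    "poly_circ (roots_poly C) * u = poly_circ (roots_poly A) * h + poly_circ r"
    using h(1) by (rule symbol_rangeE)
  obtain u' r' where 2: "h' \<in> Hp p" "u' \<in> Hp p" "poly_below (size A) r'"
    "poly_circ (roots_poly C) * u' = poly_circ (roots_poly A) * h' + poly_circ r'"
    using h(2) by (rule symbol_rangeE)
  show ?thesis
  proof (rule symbol_rangeI)
    show "poly_circ (roots_poly C) * (u + u') =
      poly_circ (roots_poly A) * (h + h') + poly_circ (r + r')"
      unfolding distrib_left 1(4) 2(4) to_fract_add rat_circ_add by simp
  qed (use 1 2 p in \<open>auto intro: Hp_add poly_below_add\<close>)
qed

lemma symbol_range_union_subset:
  assumes p: "p > 1"
  shows "symbol_range p A (C + C0) \<subseteq> symbol_range p A C"
proof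
  fix h assume "h \<in> symbol_range p A (C + C0)"
  then obtain u r where 1: "h \<in> Hp p" "u \<in> Hp p" "poly_below (size A) r"
    "poly_circ (roots_poly (C + C0)) * u = poly_circ (roots_poly A) * h + poly_circ r"
    by (rule symbol_rangeE)
  show "h \<in> symbol_range p A C"
  proof (rule symbol_rangeI[OF 1(1) _ 1(3)])
    show "poly_circ (roots_poly C) * (poly_circ (roots_poly C0) * u) =
      poly_circ (roots_poly A) * h + poly_circ r"
      unfolding 1(4)[symmetric] by (simp add: rat_circ_mult_assoc roots_poly_union)
  qed (rule poly_circ_mult_in_Hp[OF p 1(2)])
qed

lemma mult_in_symbol_range:
  assumes p: "p > 1" and u: "u \<in> Hp p"
  shows "poly_circ (roots_poly C) * u \<in> symbol_range p A C"
proof (rule symbol_rangeI)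
  show "poly_circ (roots_poly C) * (poly_circ (roots_poly A) * u) =
    poly_circ (roots_poly A) * (poly_circ (roots_poly C) * u) + poly_circ 0"
    by (simp add: mult.left_commute)
qed (auto intro: poly_circ_mult_in_Hp p u)

text \<open>Divide \<open>roots_poly A\<close> times h by \<open>roots_poly C\<close>. Remainders
  are unique, so h lies in the range exactly if the coefficients of index \<ge>
  \<open>size A\<close> of its remainder vanish. By \<open>Hp_division\<close> these coefficients
  are continuous in h, and closedness follows.\<close>

lemma symbol_range_closed:
  assumes p: "p > 1" and C: "set_mset C \<subseteq> ball 0 1" and le: "size A \<le> size C" and h: "h \<in> Hp p"
    and lim: "\<And>e. e > 0 \<Longrightarrow> \<exists>h'\<in>symbol_range p A C. Lp_norm p (h - h') < e"
  shows "h \<in> symbol_range p A C"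
proof -
  let ?C = "poly_circ (roots_poly C)" and ?A = "poly_circ (roots_poly A)"
  obtain B where B: "B \<ge> 0" "\<And>x. x \<in> Hp p \<Longrightarrow> \<exists>h\<in>Hp p. \<exists>r. x = ?C * h + poly_circ r
     \<and> (\<forall>i\<ge>size C. coeff r i = 0) \<and> Lp_norm p h \<le> B * Lp_norm p x \<and> (\<forall>i. norm (coeff r i) \<le> B * Lp_norm p x)"
    using Hp_division[OF p C] by blast
  obtain D where D: "D \<ge> 0" "\<And>x. x \<in> Lp p \<Longrightarrow> Lp_norm p (?A * x) \<le> D * Lp_norm p x"
    using rat_circ_Lp_bounded[of "to_fract (roots_poly A)" p] p by (metis inf_bot_left less_imp_le rat_poles_to_fract)
  obtain u r where u: "u \<in> Hp p" "?A * h = ?C * u + poly_circ r" "poly_below (size C) r"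
    using B(2)[OF poly_circ_mult_in_Hp[OF p h]] unfolding poly_below_def by metis
  have small: "norm (coeff r i) \<le> B * D * e" if i: "i \<ge> size A" and e: "e > 0" for i e
  proof -
    obtain h' where h': "h' \<in> symbol_range p A C" "Lp_norm p (h - h') < e" using lim[OF e] by blast
    obtain u' r' where u': "h' \<in> Hp p" "u' \<in> Hp p" "poly_below (size A) r'" "?C * u' = ?A * h' + poly_circ r'"
      using h'(1) by (rule symbol_rangeE)
    have hh: "h - h' \<in> Hp p" by (rule Hp_diff[OF p h u'(1)])
    obtain v r1 where v: "v \<in> Hp p" "?A * (h - h') = ?C * v + poly_circ r1" "poly_below (size C) r1"
      "\<And>i. norm (coeff r1 i) \<le> B * Lp_norm p (?A * (h - h'))"
      using B(2)[OF poly_circ_mult_in_Hp[OF p hh]] unfolding poly_below_def by metis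
    have "?C * (u - u' - v) = ?C * u - ?C * u' - ?C * v" by (simp add: right_diff_distrib)
    also have "\<dots> = poly_circ (r1 - r - r')"
    proof -
      have "?C * u = ?A * h - poly_circ r" "?C * v = ?A * (h - h') - poly_circ r1"
        using u(2) v(2) by simp_all
      then show ?thesis unfolding u'(4) by (simp add: right_diff_distrib rat_circ_diff)
    qed
    finally have "roots_poly C dvd r1 - r - r'"
      by (intro dvd_of_mult_Hp_eq_poly[OF p C, of "u - u' - v"] Hp_diff p u u' v)
    moreover have "poly_below (size C) (r1 - r - r')"
      using u(3) v(3) poly_below_mono[OF u'(3) le] by (intro poly_below_diff)
    ultimately have "r1 - r - r' = 0" by (intro poly_below_dvd_imp_0) auto
    moreover have "r1 - r' = r + (r1 - r - r')" by simp
    ultimately have "r = r1 - r'" by simp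
    then have "coeff r i = coeff r1 i" using u'(3) i by (simp add: poly_below_def)
    then have "norm (coeff r i) \<le> B * Lp_norm p (?A * (h - h'))" using v(4) by simp
    also have "\<dots> \<le> B * (D * Lp_norm p (h - h'))" using B D Hp_in_Lp[OF hh] by (intro mult_left_mono) auto
    also have "\<dots> \<le> B * (D * e)" using B D h'(2) by (intro mult_left_mono) auto
    finally show ?thesis by (simp add: mult.assoc)
  qed
  have "coeff r i = 0" if i: "i \<ge> size A" for i
  proof (rule ccontr)
    assume nz: "coeff r i \<noteq> 0"
    \<comment> \<open>Chosen so that B * D * e is smaller than the coefficient, also when B * D =
      0.\<close>
    define e where "e = norm (coeff r i) / (2 * (B * D + 1))"
    have BD: "B * D \<ge> 0" using B D by simp
    have e: "e > 0" using nz BD by (simp add: e_def add_nonneg_pos)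
    have "norm (coeff r i) = 2 * (B * D + 1) * e" using BD by (simp add: e_def add_nonneg_eq_0_iff)
    also have "\<dots> > B * D * e" using BD e mult_nonneg_nonneg[of "B * D" e] by (simp add: algebra_simps)
    finally show False using small[OF i e] by simp
  qed
  then have "poly_below (size A) (- r)" by (simp add: poly_below_def)
  moreover have "?C * u = ?A * h + poly_circ (- r)" using u(2) by (simp add: rat_circ_minus)
  ultimately show ?thesis using h u(1) by (intro symbol_rangeI)
qed

text \<open>\<open>roots_poly A\<close> is invertible modulo \<open>roots_poly C\<close>, so some
  polynomial h produces the remainder z ^ \<open>size A\<close>. No r of lower degree can cancel it,
  and as \<open>size A < size C\<close> the sum is too small to be divisible by
  \<open>roots_poly C\<close>.\<close>

lemma symbol_range_neq_Hp:
  assumes p: "p > 1" and C: "set_mset C \<subseteq> ball 0 1" and disj: "set_mset A \<inter> set_mset C = {}"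
    and less: "size A < size C"
  shows "symbol_range p A C \<noteq> Hp p"
proof
  assume eq: "symbol_range p A C = Hp p"
  let ?C = "poly_circ (roots_poly C)" and ?A = "poly_circ (roots_poly A)"
  have "coprime (roots_poly A) (roots_poly C)"
    using disj by (intro coprimeI_no_common_root) auto
  then obtain h v where hv: "monom 1 (size A) = roots_poly A * h + roots_poly C * v" by (rule coprime_poly_solve)
  have "poly_circ h \<in> symbol_range p A C" unfolding eq by (rule poly_circ_in_Hp[OF p])
  then obtain u r where u: "u \<in> Hp p" "poly_below (size A) r" "?C * u = ?A * poly_circ h + poly_circ r"
    by (rule symbol_rangeE)
  have "?C * (u + poly_circ v) = poly_circ (monom 1 (size A) + r)"
    unfolding distrib_left u(3) hv to_fract_add to_fract_mult rat_circ_add rat_circ_mult by (simp add: add_ac)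
  then have "roots_poly C dvd monom 1 (size A) + r"
    by (rule dvd_of_mult_Hp_eq_poly[OF p C, rotated]) (intro Hp_add p u poly_circ_in_Hp)
  moreover have "poly_below (size C) (monom 1 (size A) + r)"
    using less poly_below_mono[OF u(2), of "size C"] by (intro poly_below_add) (auto simp: poly_below_def)
  ultimately have "monom 1 (size A) + r = 0" by (intro poly_below_dvd_imp_0) auto
  then have "coeff (monom 1 (size A) + r) (size A) = 0" by simp
  then show False using u(2) by (simp add: poly_below_def)
qed

text \<open>The remainder of division by \<open>roots_poly C\<close> has degree below
  \<open>size C\<close> and so is small enough to be absorbed by r.\<close>

lemma symbol_range_eq_Hp:
  assumes p: "p > 1" and C: "set_mset C \<subseteq> ball 0 1" and le: "size C \<le> size A"
  shows "symbol_range p A C = Hp p"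
proof
  show "Hp p \<subseteq> symbol_range p A C"
  proof
    fix h assume h: "h \<in> Hp p"
    let ?C = "poly_circ (roots_poly C)" and ?A = "poly_circ (roots_poly A)"
    obtain u r where u: "u \<in> Hp p" "?A * h = ?C * u + poly_circ r" "poly_below (size C) r"
      using Hp_division[OF p C] poly_circ_mult_in_Hp[OF p h] unfolding poly_below_def by meson
    show "h \<in> symbol_range p A C"
    proof (rule symbol_rangeI[OF h u(1)])
      show "poly_below (size A) (- r)" using poly_below_mono[OF u(3) le] by (simp add: poly_below_uminus)
      show "?C * u = ?A * h + poly_circ (- r)" using u(2) by (simp add: rat_circ_minus)
    qed
  qed
qed (auto simp: symbol_range_def)

lemma mult_approx_symbol_range:
  assumes p: "p > 1" and C0: "set_mset C0 \<subseteq> sphere 0 1" and u: "u \<in> Hp p" and e: "e > 0"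
  shows "\<exists>y\<in>symbol_range p A (C + C0). Lp_norm p (poly_circ (roots_poly C) * u - y) < e"
proof -
  let ?C = "poly_circ (roots_poly C)"
  obtain B where B: "B \<ge> 0" "\<And>x. x \<in> Lp p \<Longrightarrow> Lp_norm p (?C * x) \<le> B * Lp_norm p x"
    using rat_circ_Lp_bounded[of "to_fract (roots_poly C)" p] p by (metis inf_bot_left less_imp_le rat_poles_to_fract)
  define d where "d = e / (B + 1)"
  have d: "d > 0" using e B by (simp add: d_def)
  have "B * d < (B + 1) * d" using d by simp
  also have "(B + 1) * d = e" using B by (simp add: d_def add_nonneg_eq_0_iff)
  finally have Bd: "B * d < e" .
  obtain v where v: "v \<in> Hp p" "Lp_norm p (u - poly_circ (roots_poly C0) * v) < d"
    using Hp_roots_dense[OF p C0 u d] by blast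
  have "?C * u - poly_circ (roots_poly (C + C0)) * v = ?C * (u - poly_circ (roots_poly C0) * v)"
    by (simp add: right_diff_distrib roots_poly_union rat_circ_mult mult.assoc)
  then have "Lp_norm p (?C * u - poly_circ (roots_poly (C + C0)) * v) \<le> B * Lp_norm p (u - poly_circ (roots_poly C0) * v)"
    using B(2) u v p by (auto intro!: Hp_in_Lp Hp_diff poly_circ_mult_in_Hp)
  also have "\<dots> \<le> B * d" using v B by (intro mult_left_mono) auto
  also note Bd
  finally show ?thesis using mult_in_symbol_range[OF p v(1), of "C + C0" A] by blast
qed

text \<open>Density of circle multiples only approximates members of \<open>roots_poly C\<close>
  times H^p, while h also has a polynomial remainder r0. A multiple of \<open>roots_poly C\<close>
  is moved between the two parts until the polynomial part y1 lies exactly in the range.\<close>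

lemma symbol_range_dense:
  assumes p: "p > 1" and C: "set_mset C \<subseteq> ball 0 1" and C0: "set_mset C0 \<subseteq> sphere 0 1"
    and disj: "set_mset A \<inter> set_mset C0 = {}" and le: "size C \<le> size A" and h: "h \<in> Hp p" and e: "e > 0"
  shows "\<exists>y\<in>symbol_range p A (C + C0). Lp_norm p (h - y) < e"
proof -
  let ?C = "poly_circ (roots_poly C)" and ?A = "poly_circ (roots_poly A)"
  obtain h1 r0 where h1: "h1 \<in> Hp p" "h = ?C * h1 + poly_circ r0"
    using Hp_division[OF p C] h by meson
  \<comment> \<open>r removes the residue modulo \<open>roots_poly C\<close>, which
    \<open>size C \<le> size A\<close> permits. The cofactor w is then made divisible by
    \<open>roots_poly C0\<close>: coprimality with \<open>roots_poly A\<close> provides v, and r0 is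
    replaced by r0 - \<open>roots_poly C\<close> * v.\<close>
  define r where "r = - ((roots_poly A * r0) mod roots_poly C)"
  define w where "w = (roots_poly A * r0) div roots_poly C"
  have w: "roots_poly A * r0 + r = roots_poly C * w"
    unfolding r_def w_def by (metis add.right_inverse add_diff_eq div_mult_mod_eq add.commute add.right_neutral
      diff_add_cancel mult.commute uminus_add_conv_diff)
  have r: "poly_below (size A) r"
    using poly_below_mod[of "roots_poly C" "roots_poly A * r0"] le unfolding r_def poly_below_uminus
    by (auto intro: poly_below_mono)
  have "coprime (roots_poly A) (roots_poly C0)"
    using disj by (intro coprimeI_no_common_root) auto
  then obtain v w' where vw: "w = roots_poly A * v + roots_poly C0 * w'" by (rule coprime_poly_solve)
  define y1 where "y1 = r0 - roots_poly C * v"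
  have "roots_poly (C + C0) * w' = roots_poly A * y1 + r"
  proof -
    have "roots_poly A * y1 + r = roots_poly C * w - roots_poly A * (roots_poly C * v)"
      unfolding y1_def w[symmetric] by (simp add: right_diff_distrib)
    also have "\<dots> = roots_poly C * (roots_poly C0 * w')" unfolding vw by (simp add: algebra_simps)
    finally show ?thesis by (simp add: roots_poly_union mult.assoc)
  qed
  then have "poly_circ (roots_poly (C + C0)) * poly_circ w' = ?A * poly_circ y1 + poly_circ r"
    by (metis rat_circ_add rat_circ_mult to_fract_add to_fract_mult)
  then have y1: "poly_circ y1 \<in> symbol_range p A (C + C0)"
    by (rule symbol_rangeI[OF poly_circ_in_Hp[OF p] poly_circ_in_Hp[OF p] r])
  have hv: "h1 + poly_circ v \<in> Hp p" by (intro Hp_add p h1 poly_circ_in_Hp)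
  obtain y2 where y2: "y2 \<in> symbol_range p A (C + C0)" "Lp_norm p (?C * (h1 + poly_circ v) - y2) < e"
    using mult_approx_symbol_range[OF p C0 hv e] by blast
  have "h - (poly_circ y1 + y2) = ?C * (h1 + poly_circ v) - y2"
    unfolding h1(2) y1_def by (simp add: rat_circ_diff rat_circ_mult distrib_left)
  then show ?thesis using y2 symbol_range_add[OF p y1 y2(1)] by metis
qed

text \<open>Modulo z - a with a in C0, the polynomial P = \<open>roots_poly A * roots_poly C\<close>
  acts as the number P(a), nonzero because a is a root of neither factor. Membership would write
  P(a) x as z - a times a member of H^p plus a constant, against the choice of x.\<close>

lemma mult_not_subset_symbol_range:
  assumes p: "p > 1" and C: "set_mset C \<subseteq> ball 0 1" and C0: "set_mset C0 \<subseteq> sphere 0 1"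
    and disj: "set_mset A \<inter> set_mset C0 = {}" and ne: "C0 \<noteq> {#}"
  obtains x where "x \<in> Hp p" "poly_circ (roots_poly C) * x \<notin> symbol_range p A (C + C0)"
proof -
  obtain a where a: "a \<in># C0" using ne by blast
  then obtain C1 where C1: "C0 = add_mset a C1" by (metis mset_add)
  have na: "norm a = 1" using a C0 by auto
  obtain x where x: "x \<in> Hp p" "\<And>u c. u \<in> Lp p \<Longrightarrow> x \<noteq> poly_circ [:-a, 1:] * u + poly_circ [:c:]"
    using Hp_linear_infinite_codim[OF p na] by blast
  show ?thesis
  proof (rule that[OF x(1)], rule notI)
    assume "poly_circ (roots_poly C) * x \<in> symbol_range p A (C + C0)"
    then obtain u r where u: "u \<in> Hp p" "poly_circ (roots_poly (C + C0)) * u =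
      poly_circ (roots_poly A) * (poly_circ (roots_poly C) * x) + poly_circ r"
      by (rule symbol_rangeE)
    define P where "P = roots_poly A * roots_poly C"
    define k where "k = poly P a"
    have "a \<notin># C" using na C by auto
    then have k: "k \<noteq> 0" using a disj by (auto simp: k_def P_def)
    define P1 where "P1 = synthetic_div P a"
    define r1 where "r1 = synthetic_div r a"
    let ?L = "to_fract [:-a, 1:]"
    have P1: "P = [:-a, 1:] * P1 + [:k:]" unfolding k_def P1_def by (rule synthetic_div_correct'[symmetric])
    have r1: "r = [:-a, 1:] * r1 + [:poly r a:]" unfolding r1_def by (rule synthetic_div_correct'[symmetric])
    have "rat_circ ?L * (poly_circ (roots_poly (C + C1)) * u) = poly_circ P * x + poly_circ r"
      using u(2) by (simp only: C1 P_def to_fract_mult roots_poly_add union_mset_add_mset_right rat_circ_mult mult.assoc)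
    also have "\<dots> = (rat_circ ?L * poly_circ P1 + poly_circ [:k:]) * x
       + (rat_circ ?L * poly_circ r1 + poly_circ [:poly r a:])"
      by (subst P1, subst r1) (simp only: to_fract_add to_fract_mult rat_circ_add rat_circ_mult)
    finally have "poly_circ [:k:] * x = rat_circ ?L * (poly_circ (roots_poly (C + C1)) * u
       - poly_circ P1 * x - poly_circ r1) - poly_circ [:poly r a:]"
      by (simp add: algebra_simps)
    then have "x = poly_circ [:1 / k:] * (rat_circ ?L * (poly_circ (roots_poly (C + C1)) * u
       - poly_circ P1 * x - poly_circ r1) - poly_circ [:poly r a:])"
      (is "x = _ * (_ * ?y - _)")
    proof -
      have "to_fract [:1 / k:] * to_fract [:k:] = 1" using k by (simp flip: to_fract_mult one_pCons)
      then have "poly_circ [:1 / k:] * (poly_circ [:k:] * x) = x" by (simp add: rat_circ_mult_assoc)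
      then show ?thesis unfolding \<open>poly_circ [:k:] * x = _\<close> by simp
    qed
    also have "\<dots> = rat_circ ?L * (poly_circ [:1 / k:] * ?y) + poly_circ [:- poly r a / k:]"
    proof -
      have "[:- poly r a / k:] = - ([:1 / k:] * [:poly r a:])" by simp
      then have "poly_circ [:- poly r a / k:] = - (poly_circ [:1 / k:] * poly_circ [:poly r a:])"
        by (simp only: to_fract_uminus to_fract_mult rat_circ_minus rat_circ_mult)
      then show ?thesis by (simp add: right_diff_distrib mult.left_commute)
    qed
    finally show False using x(2)[of "poly_circ [:1 / k:] * ?y" "- poly r a / k"] u(1) x(1) p
      by (auto intro!: Hp_in_Lp poly_circ_mult_in_Hp Hp_diff poly_circ_in_Hp)
  qed
qed

section \<open>Codimension of the range and topology of H^p\<close>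

lemma rat_circ_sum: "rat_circ (sum f I) = (\<Sum>i\<in>I. rat_circ (f i))"
  by (induction I rule: infinite_finite_induct) (simp_all add: rat_circ_add)

lemma poly_below_sum:
  assumes "poly_below n r"
  shows "r = (\<Sum>i<n. [:coeff r i:] * monom 1 i)"
proof (rule poly_eqI)
  fix j
  have "coeff (\<Sum>i<n. [:coeff r i:] * monom 1 i) j = (\<Sum>i<n. if i = j then coeff r i else 0)"
    by (simp add: coeff_sum smult_monom)
  also have "\<dots> = coeff r j" using assms by (auto simp: poly_below_def)
  finally show "coeff r j = coeff (\<Sum>i<n. [:coeff r i:] * monom 1 i) j" by simp
qed

text \<open>By division with remainder, H^p is the sum of \<open>roots_poly C\<close> times H^p,
  which lies in the range, and the polynomials of degree below \<open>size C\<close>.\<close>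

lemma Hp_eq_span_symbol_range:
  assumes p: "p > 1" and C: "set_mset C \<subseteq> ball 0 1"
  shows "Hp p = circ_span (symbol_range p A C \<union> (\<lambda>i. poly_circ (monom 1 i)) ` {..<size C})"
    (is "_ = circ_span (_ \<union> ?B)")
proof
  show "circ_span (symbol_range p A C \<union> ?B) \<subseteq> Hp p"
    using poly_circ_in_Hp[OF p] by (intro circ.span_minimal subspace_Hp[OF p]) (auto simp: symbol_range_def)
  show "Hp p \<subseteq> circ_span (symbol_range p A C \<union> ?B)"
  proof
    fix h assume h: "h \<in> Hp p"
    obtain u r where u: "u \<in> Hp p" "h = poly_circ (roots_poly C) * u + poly_circ r" "poly_below (size C) r"
      using Hp_division[OF p C] h unfolding poly_below_def by meson
    have "r = (\<Sum>i<size C. [:coeff r i:] * monom 1 i)" using u(3) by (rule poly_below_sum)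
    then have "poly_circ r = rat_circ (\<Sum>i<size C. to_fract [:coeff r i:] * to_fract (monom 1 i))"
      by (metis (no_types, lifting) sum.cong to_fract_mult to_fract_sum)
    also have "\<dots> = (\<Sum>i<size C. scale_circ (coeff r i) (poly_circ (monom 1 i)))"
      by (simp add: rat_circ_sum rat_circ_mult scale_circ_eq)
    also have "\<dots> \<in> circ_span (symbol_range p A C \<union> ?B)"
      by (intro circ.span_sum circ.span_scale circ.span_base) auto
    finally have "poly_circ r \<in> circ_span (symbol_range p A C \<union> ?B)" .
    moreover have "poly_circ (roots_poly C) * u \<in> circ_span (symbol_range p A C \<union> ?B)"
      using mult_in_symbol_range[OF p u(1)] by (intro circ.span_base) auto
    ultimately show "h \<in> circ_span (symbol_range p A C \<union> ?B)" unfolding u(2) by (rule circ.span_add[rotated])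
  qed
qed

lemma Hp_topology_closure_of:
  assumes p: "p > 1"
  shows "X \<subseteq> Hp p \<Longrightarrow> Hp_topology p closure_of X = {x \<in> Hp p. \<forall>e>0. \<exists>y\<in>X. Lp_norm p (x - y) < e}"
proof -
  interpret Metric_space "Hp p" "\<lambda>f g. Lp_norm p (f - g)" by (rule Metric_space_Hp) (use p in simp)
  show "X \<subseteq> Hp p \<Longrightarrow> Hp_topology p closure_of X = {x \<in> Hp p. \<forall>e>0. \<exists>y\<in>X. Lp_norm p (x - y) < e}"
    unfolding Hp_topology_def metric_closure_of by (auto simp: mball_def) blast+
qed

lemma topspace_Hp_topology: "p > 1 \<Longrightarrow> topspace (Hp_topology p) = Hp p"
  using Metric_space.topspace_mtopology[OF Metric_space_Hp[of p]] by (simp add: Hp_topology_def)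

lemma closedin_Hp_topology:
  assumes "p > 1"
  shows "closedin (Hp_topology p) X \<longleftrightarrow>
    X \<subseteq> Hp p \<and> (\<forall>x\<in>Hp p. (\<forall>e>0. \<exists>y\<in>X. Lp_norm p (x - y) < e) \<longrightarrow> x \<in> X)"
proof (cases "X \<subseteq> Hp p")
  case True
  have "closedin (Hp_topology p) X \<longleftrightarrow> Hp_topology p closure_of X \<subseteq> X"
    using True assms by (simp add: closure_of_subset_eq[symmetric] topspace_Hp_topology)
  then show ?thesis using True by (auto simp: Hp_topology_closure_of[OF assms True])
next
  case False
  then show ?thesis using closedin_subset[of "Hp_topology p" X] topspace_Hp_topology[OF assms] by auto
qed


section \<open>Kernel, range and Fredholm property of the resolvent map\<close>

context
  fixes p :: real and A A0 C C0 :: "complex multiset" and s q1 t1 :: "complex poly" and l :: complex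
  assumes p: "p > 1" and A: "set_mset A \<subseteq> ball 0 1" and A0: "set_mset A0 \<subseteq> sphere 0 1"
    and q1: "\<And>z. z \<in> cball 0 1 \<Longrightarrow> poly q1 z \<noteq> 0"
    and C: "set_mset C \<subseteq> ball 0 1" and C0: "set_mset C0 \<subseteq> sphere 0 1"
    and t1: "\<And>z. z \<in> cball 0 1 \<Longrightarrow> poly t1 z \<noteq> 0"
    and t: "smult l (roots_poly (A + A0) * q1) - s = roots_poly (C + C0) * t1"
    and disj: "set_mset (A + A0) \<inter> set_mset (C + C0) = {}"
begin

private abbreviation "Q \<equiv> to_fract (roots_poly (A + A0))"
private abbreviation "S \<equiv> to_fract (roots_poly (C + C0))"
private abbreviation "Dom \<equiv> toeplitz_dom p (to_fract s / to_fract (roots_poly (A + A0) * q1))"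
private abbreviation "T \<equiv> resolvent_map l (toeplitz p (to_fract s / to_fract (roots_poly (A + A0) * q1)))"

text \<open>T g = h says that the Toeplitz operator sends g to l g - h. Substituted into
  \<open>toeplitz_graph\<close>, this replaces s by l q - s = S t1 and changes the sign of r, which
  the degree bound does not see.\<close>

lemma resolvent_graph:
  "g \<in> Dom \<and> T g = h \<longleftrightarrow> g \<in> Hp p \<and> h \<in> Hp p \<and> (\<exists>r. poly_below (size (A + A0)) r \<and>
     rat_circ (S * to_fract t1) * g = rat_circ (Q * to_fract q1) * h + rat_circ (to_fract q1 * to_fract r))"
proof -
  let ?h = "scale_circ l g - h"
  have T: "T g = h \<longleftrightarrow> toeplitz p (to_fract s / to_fract (roots_poly (A + A0) * q1)) g = ?h"
    by (auto simp: resolvent_map_def algebra_simps)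
  have hH: "?h \<in> Hp p \<longleftrightarrow> h \<in> Hp p" if g: "g \<in> Hp p"
    using Hp_diff[OF p Hp_scale[OF p g, of l], of h] Hp_diff[OF p Hp_scale[OF p g, of l], of ?h] by auto
  have "S * to_fract t1 = to_fract [:l:] * (Q * to_fract q1) - to_fract s"
    using arg_cong[OF t, of to_fract] by (simp flip: to_fract_mult)
  then have "rat_circ (S * to_fract t1) * g = rat_circ (to_fract [:l:] * (Q * to_fract q1) - to_fract s) * g" by (simp only:)
  then have St: "rat_circ (S * to_fract t1) * g = rat_circ (Q * to_fract q1) * scale_circ l g - poly_circ s * g"
    unfolding rat_circ_diff left_diff_distrib scale_circ_eq by (simp only: rat_circ_mult mult_ac)
  have eq: "poly_circ s * g = poly_circ (roots_poly (A + A0) * q1) * ?h + poly_circ (q1 * r) \<longleftrightarrow>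
    rat_circ (S * to_fract t1) * g = rat_circ (Q * to_fract q1) * h + rat_circ (to_fract q1 * to_fract (- r))" for r
    unfolding St by (auto simp: right_diff_distrib rat_circ_minus algebra_simps)
  have ex: "(\<exists>r. poly_below n r \<and> P (- r)) \<longleftrightarrow> (\<exists>r. poly_below n r \<and> P r)" for n P
    by (metis minus_minus poly_below_uminus)
  have "g \<in> Dom \<and> toeplitz p (to_fract s / to_fract (roots_poly (A + A0) * q1)) g = ?h \<longleftrightarrow>
    g \<in> Hp p \<and> ?h \<in> Hp p \<and> (\<exists>r. poly_below (size (A + A0)) r \<and>
      poly_circ s * g = poly_circ (roots_poly (A + A0) * q1) * ?h + poly_circ (q1 * r))"
    by (rule toeplitz_graph[OF p A A0]) (rule q1)
  then show ?thesis unfolding T eq using hH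
    ex[of "size (A + A0)" "\<lambda>r. rat_circ (S * to_fract t1) * g = rat_circ (Q * to_fract q1) * h + rat_circ (to_fract q1 * to_fract r)"]
    by blast
qed

text \<open>Neither t1 nor q1 has roots in the closed disc, so multiplication by t1 / q1 is a
  bijection of H^p onto itself. This justifies passing from g to u.\<close>

lemma outer_factor_facts: "to_fract q1 \<noteq> 0" "to_fract t1 \<noteq> 0"
  "x \<in> Hp p \<Longrightarrow> rat_circ (to_fract t1 / to_fract q1) * x \<in> Hp p"
  "x \<in> Hp p \<Longrightarrow> rat_circ (to_fract q1 / to_fract t1) * x \<in> Hp p"
  using q1[of 0] t1[of 0] by (auto intro!: rat_circ_mult_in_Hp p rat_poles_quotient_disjoint q1 t1)

lemma resolvent_graph_normalized:
  "rat_circ (S * to_fract t1) * g = rat_circ (Q * to_fract q1) * h + rat_circ (to_fract q1 * to_fract r) \<longleftrightarrow>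
   rat_circ S * (rat_circ (to_fract t1 / to_fract q1) * g) = rat_circ Q * h + poly_circ r"
proof -
  let ?u = "to_fract q1"
  have 1: "rat_circ (S * to_fract t1) * g = rat_circ ?u * (rat_circ S * (rat_circ (to_fract t1 / ?u) * g))"
  proof -
    have "?u * S * (to_fract t1 / ?u) = S * to_fract t1" using outer_factor_facts(1) by simp
    then show ?thesis by (simp only: rat_circ_mult_assoc mult.assoc)
  qed
  have 2: "rat_circ (Q * ?u) * h + rat_circ (?u * to_fract r) = rat_circ ?u * (rat_circ Q * h + poly_circ r)"
    by (simp add: rat_circ_mult algebra_simps)
  show ?thesis unfolding 1 2 by (rule rat_circ_mult_cancel[OF outer_factor_facts(1)])
qed

lemma resolvent_range: "T ` Dom = symbol_range p (A + A0) (C + C0)"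
proof (intro equalityI subsetI)
  fix h assume "h \<in> T ` Dom"
  then obtain g where "g \<in> Dom \<and> T g = h" by blast
  then obtain r where g: "g \<in> Hp p" "h \<in> Hp p" "poly_below (size (A + A0)) r"
    "rat_circ S * (rat_circ (to_fract t1 / to_fract q1) * g) = rat_circ Q * h + poly_circ r"
    unfolding resolvent_graph resolvent_graph_normalized by blast
  show "h \<in> symbol_range p (A + A0) (C + C0)"
    by (rule symbol_rangeI[OF g(2) outer_factor_facts(3)[OF g(1)] g(3,4)])
next
  fix h assume "h \<in> symbol_range p (A + A0) (C + C0)"
  then obtain u r where u: "h \<in> Hp p" "u \<in> Hp p" "poly_below (size (A + A0)) r"
    "rat_circ S * u = rat_circ Q * h + poly_circ r" by (rule symbol_rangeE)
  define g where "g = rat_circ (to_fract q1 / to_fract t1) * u"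
  have "rat_circ (to_fract t1 / to_fract q1) * g = u"
    using outer_factor_facts(1,2) by (simp add: g_def rat_circ_mult_assoc)
  moreover have "g \<in> Hp p" unfolding g_def by (rule outer_factor_facts(4)[OF u(2)])
  ultimately have "g \<in> Dom \<and> T g = h" unfolding resolvent_graph resolvent_graph_normalized using u by auto
  then show "h \<in> T ` Dom" by blast
qed

lemma resolvent_inj_iff: "inj_on T Dom \<longleftrightarrow> size (A + A0) \<le> size (C + C0)"
proof
  assume inj: "inj_on T Dom"
  show "size (A + A0) \<le> size (C + C0)"
  proof (rule ccontr)
    assume less: "\<not> size (A + A0) \<le> size (C + C0)"
    \<comment> \<open>The kernel element that belongs to u = 1, with r = S itself; its degree is
      below k_q in this case.\<close>
    define g where "g = rat_circ (to_fract q1 / to_fract t1) * rat_circ 1"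
    have g1: "rat_circ (to_fract t1 / to_fract q1) * g = rat_circ 1"
      using outer_factor_facts(1,2) by (simp add: g_def rat_circ_mult_assoc)
    have "g \<in> Dom \<and> T g = 0"
      unfolding resolvent_graph resolvent_graph_normalized g1
    proof (intro conjI exI[of _ "roots_poly (C + C0)"])
      show "g \<in> Hp p" unfolding g_def by (intro outer_factor_facts one_in_Hp p)
      show "poly_below (size (A + A0)) (roots_poly (C + C0))" using less by (simp add: poly_below_iff)
    qed (simp_all add: zero_in_Hp p mult.commute[of _ "rat_circ 1"])
    moreover have "0 \<in> Dom \<and> T 0 = 0"
      unfolding resolvent_graph resolvent_graph_normalized by (auto intro!: exI[of _ 0] zero_in_Hp p)
    ultimately have "g = 0" using inj by (metis inj_onD)
    then show False using g1 rat_circ_eq_iff[of 1 0] by simp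
  qed
next
  assume le: "size (A + A0) \<le> size (C + C0)"
  show "inj_on T Dom"
  proof (rule inj_onI)
    fix g g' assume "g \<in> Dom" "g' \<in> Dom" "T g = T g'"
    then have "g \<in> Dom \<and> T g = T g'" "g' \<in> Dom \<and> T g' = T g'" by auto
    then obtain r r' where g: "g \<in> Hp p" "poly_below (size (A + A0)) r"
      "rat_circ S * (rat_circ (to_fract t1 / to_fract q1) * g) = rat_circ Q * T g' + poly_circ r"
      and g': "g' \<in> Hp p" "poly_below (size (A + A0)) r'"
      "rat_circ S * (rat_circ (to_fract t1 / to_fract q1) * g') = rat_circ Q * T g' + poly_circ r'"
      unfolding resolvent_graph resolvent_graph_normalized by blast
    define u where "u = rat_circ (to_fract t1 / to_fract q1) * (g - g')"
    have u: "u \<in> Hp p" unfolding u_def by (intro outer_factor_facts Hp_diff p g g')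
    have Su: "rat_circ S * u = poly_circ (r - r')"
      unfolding u_def right_diff_distrib g(3) g'(3) to_fract_diff rat_circ_diff by simp
    have eq0: "poly_circ (roots_poly C0) * (poly_circ (roots_poly C) * u) = poly_circ (r - r')"
      unfolding Su[symmetric] rat_circ_mult_assoc roots_poly_union to_fract_mult by (simp only: mult.commute)
    have LpC: "poly_circ (roots_poly C) * u \<in> Lp p" by (intro Hp_in_Lp poly_circ_mult_in_Hp p u)
    \<comment> \<open>The circle factor is cancelled first, for which L^p membership of the cofactor
      suffices. The cofactor is then a polynomial, and evaluation at the disc roots applies to
      it.\<close>
    obtain r1 where r1: "r - r' = roots_poly C0 * r1" "poly_circ (roots_poly C) * u = poly_circ r1"
      by (rule dvd_of_mult_Lp_eq_poly[OF less_imp_le[OF p] C0 LpC eq0])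
    have "roots_poly C dvd r1" by (rule dvd_of_mult_Hp_eq_poly[OF p C u r1(2)])
    then have "roots_poly (C + C0) dvd r - r'" unfolding r1(1) roots_poly_union by (simp add: mult.commute mult_dvd_mono)
    then have "r - r' = 0"
      using poly_below_diff[OF g(2) g'(2)] le by (elim poly_below_dvd_imp_0[rotated]) auto
    then have "u = 0" using Su rat_circ_mult_eq_0_iff[of S u] by simp
    then have "g - g' = 0" unfolding u_def using outer_factor_facts(1,2) by (subst (asm) rat_circ_mult_eq_0_iff) auto
    then show "g = g'" by simp
  qed
qed

lemma resolvent_surj_iff: "T ` Dom = Hp p \<longleftrightarrow> C0 = {#} \<and> size C \<le> size (A + A0)"
proof (cases "C0 = {#}")
  case True
  then show ?thesis
    using symbol_range_eq_Hp[OF p C, of "A + A0"] symbol_range_neq_Hp[OF p C, of "A + A0"] disj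
    unfolding resolvent_range by fastforce
next
  case False
  have "set_mset (A + A0) \<inter> set_mset C0 = {}" using disj by auto
  then obtain x where "x \<in> Hp p" "poly_circ (roots_poly C) * x \<notin> symbol_range p (A + A0) (C + C0)"
    by (rule mult_not_subset_symbol_range[OF p C C0 _ False])
  then show ?thesis using False poly_circ_mult_in_Hp[OF p] unfolding resolvent_range by blast
qed

text \<open>For necessity the circle roots are dropped: this enlarges the range to a set that is
  closed when k_q is smaller than the number of disc roots. Density would make that set all of H^p,
  contrary to \<open>symbol_range_neq_Hp\<close>.\<close>

lemma resolvent_dense_iff: "dense_range p Dom T \<longleftrightarrow> size C \<le> size (A + A0)"
proof -
  have sub: "symbol_range p (A + A0) X \<subseteq> Hp p" for X by (auto simp: symbol_range_def)
  show ?thesis unfolding dense_range_def resolvent_range Hp_topology_closure_of[OF p sub]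
  proof
    assume eq: "{x \<in> Hp p. \<forall>e>0. \<exists>y\<in>symbol_range p (A + A0) (C + C0). Lp_norm p (x - y) < e} = Hp p"
    show "size C \<le> size (A + A0)"
    proof (rule ccontr)
      assume "\<not> size C \<le> size (A + A0)"
      then have less: "size (A + A0) < size C" by simp
      have "h \<in> symbol_range p (A + A0) C" if h: "h \<in> Hp p" for h
      proof (rule symbol_range_closed[OF p C _ h])
        fix e :: real assume "e > 0"
        then show "\<exists>h'\<in>symbol_range p (A + A0) C. Lp_norm p (h - h') < e"
          using eq h symbol_range_union_subset[OF p, of "A + A0" C C0] by blast
      qed (use less in simp)
      then have "symbol_range p (A + A0) C = Hp p" using sub by blast
      then show False using symbol_range_neq_Hp[OF p C _ less] disj by auto
    qed
  next
    assume le: "size C \<le> size (A + A0)"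
    have "set_mset (A + A0) \<inter> set_mset C0 = {}" using disj by auto
    then show "{x \<in> Hp p. \<forall>e>0. \<exists>y\<in>symbol_range p (A + A0) (C + C0). Lp_norm p (x - y) < e} = Hp p"
      using symbol_range_dense[OF p C C0 _ le] by blast
  qed
qed

lemma resolvent_kernel_finite: "\<exists>B. finite B \<and> {g \<in> Dom. T g = 0} = circ_span B"
proof -
  let ?K = "{g \<in> Dom. T g = 0}" and ?w = "to_fract q1 / (S * to_fract t1)"
  let ?F = "(\<lambda>i. rat_circ (?w * to_fract (monom 1 i))) ` {..<size (A + A0)}"
  have K: "g \<in> ?K \<longleftrightarrow> g \<in> Hp p \<and> (\<exists>r. poly_below (size (A + A0)) r \<and> rat_circ (S * to_fract t1) * g = rat_circ (to_fract q1 * to_fract r))" for g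
    using resolvent_graph[of g 0] zero_in_Hp[OF p] by simp
  have nz: "S * to_fract t1 \<noteq> 0" using outer_factor_facts by simp
  have "?K \<subseteq> circ_span ?F"
  proof
    fix g assume "g \<in> ?K"
    then obtain r where r: "poly_below (size (A + A0)) r" "rat_circ (S * to_fract t1) * g = rat_circ (to_fract q1 * to_fract r)"
      unfolding K by blast
    have "g = rat_circ (1 / (S * to_fract t1)) * rat_circ (to_fract q1 * to_fract r)"
      using r(2) by (simp add: rat_circ_mult_eq_iff[OF nz])
    also have "\<dots> = rat_circ (?w * to_fract r)" by (simp flip: rat_circ_mult)
    also have "r = (\<Sum>i<size (A + A0). [:coeff r i:] * monom 1 i)"
      using r(1) by (rule poly_below_sum)
    also have "rat_circ (?w * to_fract (\<Sum>i<size (A + A0). [:coeff r i:] * monom 1 i))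
       = (\<Sum>i<size (A + A0). scale_circ (coeff r i) (rat_circ (?w * to_fract (monom 1 i))))"
      by (simp only: to_fract_sum sum_distrib_left rat_circ_sum scale_circ_eq to_fract_mult rat_circ_mult[symmetric] mult.left_commute)
    also have "\<dots> \<in> circ_span ?F"
      by (intro circ.span_sum circ.span_scale circ.span_base) auto
    finally show "g \<in> circ_span ?F" .
  qed
  \<comment> \<open>The functions in \<open>?F\<close> span the kernel but need not belong to it,
    since division by S can lead out of H^p. A basis is therefore taken inside the kernel, and the
    finite set \<open>?F\<close> bounds its size.\<close>
  moreover obtain B where B: "B \<subseteq> ?K" "circ.independent B" "?K \<subseteq> circ_span B"
    by (rule circ.maximal_independent_subset)
  ultimately have "B \<subseteq> circ_span ?F" by blast
  then have "finite B" using circ.independent_span_bound[of ?F B] B(2) by blast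
  moreover have "circ.subspace ?K"
  proof (rule circ.subspaceI)
    show "0 \<in> ?K" unfolding K by (auto intro!: exI[of _ 0] zero_in_Hp p)
  next
    fix x y assume "x \<in> ?K" "y \<in> ?K"
    then obtain r r' where "x \<in> Hp p" "y \<in> Hp p" "poly_below (size (A + A0)) r" "poly_below (size (A + A0)) r'"
      "rat_circ (S * to_fract t1) * x = rat_circ (to_fract q1 * to_fract r)"
      "rat_circ (S * to_fract t1) * y = rat_circ (to_fract q1 * to_fract r')" unfolding K by blast
    then show "x + y \<in> ?K" unfolding K
      by (intro conjI exI[of _ "r + r'"] Hp_add p poly_below_add) (simp_all add: distrib_left rat_circ_add)
  next
    fix c x assume "x \<in> ?K"
    then obtain r where r: "x \<in> Hp p" "poly_below (size (A + A0)) r"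
      "rat_circ (S * to_fract t1) * x = rat_circ (to_fract q1 * to_fract r)" unfolding K by blast
    show "scale_circ c x \<in> ?K" unfolding K
    proof (intro conjI exI[of _ "smult c r"] Hp_scale p)
      have "to_fract (smult c r) = to_fract [:c:] * to_fract r" by (simp flip: to_fract_mult)
      then show "rat_circ (S * to_fract t1) * scale_circ c x = rat_circ (to_fract q1 * to_fract (smult c r))"
        using r(3) by (simp add: scale_circ_eq rat_circ_mult mult.left_commute[of _ "poly_circ [:c:]"])
    qed (use r in \<open>auto simp: poly_below_def\<close>)
  qed
  then have "circ_span B = ?K" using B(1,3) circ.span_minimal by blast
  ultimately show ?thesis by blast
qed

text \<open>A circle root destroys closedness: \<open>roots_poly C\<close> times H^p lies in the
  closure of the range but not in the range. Without circle roots, the range is either all of H^p or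
  cut out by the continuous conditions of \<open>symbol_range_closed\<close>.\<close>

lemma resolvent_fredholm_iff: "fredholm p Dom T \<longleftrightarrow> C0 = {#}"
proof
  assume fr: "fredholm p Dom T"
  show "C0 = {#}"
  proof (rule ccontr)
    assume ne: "C0 \<noteq> {#}"
    have cl: "closedin (Hp_topology p) (symbol_range p (A + A0) (C + C0))"
      using fr unfolding fredholm_def resolvent_range by blast
    have "set_mset (A + A0) \<inter> set_mset C0 = {}" using disj by auto
    then obtain x where x: "x \<in> Hp p" "poly_circ (roots_poly C) * x \<notin> symbol_range p (A + A0) (C + C0)"
      by (rule mult_not_subset_symbol_range[OF p C C0 _ ne])
    have "poly_circ (roots_poly C) * x \<in> symbol_range p (A + A0) (C + C0)"
      using cl mult_approx_symbol_range[OF p C0 x(1)] poly_circ_mult_in_Hp[OF p x(1)]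
      unfolding closedin_Hp_topology[OF p] by blast
    with x(2) show False by blast
  qed
next
  assume C0: "C0 = {#}"
  show "fredholm p Dom T" unfolding fredholm_def
  proof (intro conjI)
    show "\<exists>B. finite B \<and> {g \<in> Dom. T g = 0} = circ_span B" by (rule resolvent_kernel_finite)
    show "closedin (Hp_topology p) (T ` Dom)"
    proof (cases "size C \<le> size (A + A0)")
      case True
      then have "T ` Dom = Hp p" using C0 resolvent_surj_iff by simp
      then show ?thesis by (simp add: closedin_Hp_topology[OF p])
    next
      case False
      then have "x \<in> symbol_range p (A + A0) C" if "x \<in> Hp p" "\<forall>e>0. \<exists>y\<in>symbol_range p (A + A0) C. Lp_norm p (x - y) < e" for x
        using that by (intro symbol_range_closed[OF p C]) auto
      then show ?thesis unfolding resolvent_range C0 closedin_Hp_topology[OF p]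
        by (auto simp: symbol_range_def)
    qed
    show "\<exists>B. finite B \<and> B \<subseteq> Hp p \<and> Hp p = circ_span (T ` Dom \<union> B)"
      using Hp_eq_span_symbol_range[OF p C, of "A + A0"] poly_circ_in_Hp[OF p] unfolding resolvent_range C0
      by (intro exI[of _ "(\<lambda>i. poly_circ (monom 1 i)) ` {..<size C}"]) auto
  qed
qed

end


section \<open>The spectrum\<close>

lemma count_roots_smult: "c \<noteq> 0 \<Longrightarrow> count_roots X (smult c P) = count_roots X P"
  by (simp add: count_roots_def)

lemma count_roots_pos_iff: "P \<noteq> 0 \<Longrightarrow> count_roots X P > 0 \<longleftrightarrow> (\<exists>z\<in>X. poly P z = 0)"
  unfolding count_roots_def nonempty_has_size[symmetric] set_mset_eq_empty_iff[symmetric] by auto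

text \<open>Two coprime representations differ by a unit, here a nonzero constant, which leaves root
  counts unchanged. Hence the counts for q and l q - s are those of poles and zeros of the rational
  function.\<close>

lemma rat_num_den_lowest_terms:
  assumes q: "q \<noteq> 0" and c: "coprime t q"
  obtains c where "c \<noteq> 0" "t = smult c (rat_num (Fract t q))" "q = smult c (rat_den (Fract t q))"
proof -
  let ?r = "to_fract t / to_fract q"
  have cross: "rat_num ?r * q = t * rat_den ?r" by (rule rat_num_den_cross[OF q])
  have "q dvd rat_den ?r"
    using cross c by (metis coprime_commute coprime_dvd_mult_right_iff dvd_triv_right)
  then obtain x where x: "rat_den ?r = q * x" ..
  moreover obtain y where y: "q = rat_den ?r * y" using rat_den_dvd[OF q] by blast
  ultimately have "q * (x * y) = q * 1" by (metis mult.assoc mult.right_neutral)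
  then have "x * y = 1" using q by (metis mult_cancel_left)
  then have "y dvd 1" by (metis dvd_triv_right)
  then obtain c where yc: "y = [:c:]" "c dvd 1" by (rule is_unit_polyE)
  then have c0: "c \<noteq> 0" by auto
  have den: "q = smult c (rat_den ?r)" using y yc by simp
  have "t * rat_den ?r = smult c (rat_num ?r) * rat_den ?r"
    using cross by (subst (asm) den) simp
  then have "t = smult c (rat_num ?r)" using rat_num_den(2)[of ?r] by (metis mult_cancel_right)
  with c0 den show ?thesis using that by (simp add: Fract_conv_to_fract)
qed

lemma sphere_eq_cis_image: "norm z = 1 \<Longrightarrow> \<exists>\<theta>. 0 \<le> \<theta> \<and> \<theta> \<le> 2 * pi \<and> z = cis \<theta>"
  using Arg2pi_eq[of z] Arg2pi_ge_0[of z] Arg2pi_lt_2pi[of z]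
  by (intro exI[of _ "Arg2pi z"]) (auto simp: cis_conv_exp)

lemma filter_cball_eq:
  "{#z \<in># M. z \<in> cball 0 (1::real)#} = {#z \<in># M. z \<in> ball 0 1#} + {#z \<in># M. z \<in> sphere 0 1#}"
  for M :: "complex multiset"
  by (rule multiset_eqI) auto

theorem theorem1p2:
  fixes p :: real and \<omega> :: rat_fun and s q :: "complex poly"
    and k_q :: nat and k_minus k_zero :: "complex \<Rightarrow> nat"
  assumes p: "1 < p"
    and q: "q \<noteq> 0" and coprime: "coprime s q" and \<omega>: "\<omega> = Fract s q"
    and nonconstant: "\<And>c. \<omega> \<noteq> rat_const c"
  defines "k_q \<equiv> count_roots (cball 0 1) q"
    and "k_minus \<equiv> \<lambda>l. count_roots (ball 0 1) (smult l q - s)"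
    and "k_zero \<equiv> \<lambda>l. count_roots (sphere 0 1) (smult l q - s)"
  shows "(\<forall>l. k_q = count_poles (cball 0 1) (rat_const l - \<omega>) \<and>
              k_minus l = count_zeros (ball 0 1) (rat_const l - \<omega>) \<and>
              k_zero l = count_zeros (sphere 0 1) (rat_const l - \<omega>)) \<and>
         resolvent_set p (toeplitz_dom p \<omega>) (toeplitz p \<omega>) = {l. k_zero l = 0 \<and> k_q = k_minus l} \<and>
         point_spectrum (toeplitz_dom p \<omega>) (toeplitz p \<omega>) = {l. k_q > k_minus l + k_zero l} \<and>
         residual_spectrum p (toeplitz_dom p \<omega>) (toeplitz p \<omega>) = {l. k_q < k_minus l} \<and>
         continuous_spectrum p (toeplitz_dom p \<omega>) (toeplitz p \<omega>) =
           {l. k_zero l > 0 \<and> k_minus l \<le> k_q \<and> k_q \<le> k_minus l + k_zero l} \<and>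
         essential_spectrum p (toeplitz_dom p \<omega>) (toeplitz p \<omega>) = rat_image_circle \<omega> \<and>
         rat_image_circle \<omega> = {l. k_zero l > 0}"
proof -
  define D where "D = toeplitz_dom p \<omega>"
  define T where "T l = resolvent_map l (toeplitz p \<omega>)" for l
  define t where "t l = smult l q - s" for l
  have Fract_t: "rat_const l - \<omega> = Fract (t l) q" for l
    using q by (simp add: \<omega> rat_const_def t_def)
  \<comment> \<open>If \<omega> were the constant l, then t l would be the zero polynomial; its
    multiset of roots is empty by convention and would carry no information.\<close>
  have t0: "t l \<noteq> 0" for l
  proof
    assume "t l = 0"
    then have "rat_const l - \<omega> = 0" unfolding Fract_t by (simp add: fract_collapse)
    then show False using nonconstant[of l] by simp
  qed
  have coprime_t: "coprime (t l) q" for l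
  proof (rule coprimeI)
    fix c assume c: "c dvd t l" "c dvd q"
    then have "c dvd smult l q - t l" by (intro dvd_diff dvd_smult)
    then have "c dvd s" by (simp add: t_def)
    then show "c dvd 1" using c(2) coprime by (meson coprime_common_divisor)
  qed
  have counts: "k_q = count_poles (cball 0 1) (rat_const l - \<omega>) \<and>
              k_minus l = count_zeros (ball 0 1) (rat_const l - \<omega>) \<and>
              k_zero l = count_zeros (sphere 0 1) (rat_const l - \<omega>)" for l
  proof -
    obtain c where c: "c \<noteq> 0" "t l = smult c (rat_num (Fract (t l) q))" "q = smult c (rat_den (Fract (t l) q))"
      using rat_num_den_lowest_terms[OF q coprime_t] by blast
    have "count_roots X (t l) = count_roots X (rat_num (Fract (t l) q))"
      "count_roots X q = count_roots X (rat_den (Fract (t l) q))" for X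
      using count_roots_smult[OF c(1)] c(2,3) by metis+
    then show ?thesis
      unfolding count_poles_def count_zeros_def Fract_t k_q_def k_minus_def k_zero_def t_def[symmetric] by simp
  qed
  have k_zero_iff: "k_zero l > 0 \<longleftrightarrow> (\<exists>z. norm z = 1 \<and> poly (t l) z = 0)" for l
    using count_roots_pos_iff[OF t0, of "sphere 0 1" l] by (auto simp: k_zero_def t_def)
  have image: "rat_image_circle \<omega> = {l. k_zero l > 0}"
  proof -
    obtain c where c: "c \<noteq> 0" "s = smult c (rat_num \<omega>)" "q = smult c (rat_den \<omega>)"
      using rat_num_den_lowest_terms[OF q coprime] unfolding \<omega> by blast
    have poles: "z \<in> rat_poles \<omega> \<longleftrightarrow> poly q z = 0" for z
      using c(1) by (subst c(3)) (simp add: rat_poles_def)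
    have eval: "rat_eval \<omega> z = poly s z / poly q z" for z
      using c(1) by (subst c(3), subst c(2)) (simp add: rat_eval_def)
    \<comment> \<open>Coprimality keeps the roots of t l away from the poles, so the conventional
      value 0 of a division by 0 never counts as a value of \<omega>.\<close>
    have root: "poly (t l) z = 0 \<longleftrightarrow> poly q z \<noteq> 0 \<and> l = poly s z / poly q z" for l z
      using coprime_no_common_root[OF coprime_t[of l], of z] by (auto simp: t_def field_simps)
    show ?thesis
    proof (intro equalityI subsetI)
      fix l assume "l \<in> rat_image_circle \<omega>"
      then obtain \<theta> where "l = rat_eval \<omega> (cis \<theta>)" "cis \<theta> \<notin> rat_poles \<omega>" by (auto simp: rat_image_circle_def)
      then have "poly (t l) (cis \<theta>) = 0" by (simp add: root eval poles)
      then have "\<exists>z. norm z = 1 \<and> poly (t l) z = 0" by (intro exI[of _ "cis \<theta>"]) simp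
      then show "l \<in> {l. k_zero l > 0}" by (simp add: k_zero_iff)
    next
      fix l assume "l \<in> {l. k_zero l > 0}"
      then obtain z where z: "norm z = 1" "poly q z \<noteq> 0" "l = poly s z / poly q z" by (auto simp: k_zero_iff root)
      obtain \<theta> where "0 \<le> \<theta>" "\<theta> \<le> 2 * pi" "z = cis \<theta>" using sphere_eq_cis_image[OF z(1)] by blast
      then show "l \<in> rat_image_circle \<omega>" unfolding rat_image_circle_def using z
        by (intro CollectI exI[of _ \<theta>]) (auto simp: eval poles)
    qed
  qed
  \<comment> \<open>A and A0 collect the poles, C and C0 the zeros of l - \<omega>, split into disc
    and circle; their sizes are the counts of the theorem.\<close>
  have inj: "inj_on (T l) D \<longleftrightarrow> k_q \<le> k_minus l + k_zero l"
    and surj: "T l ` D = Hp p \<longleftrightarrow> k_zero l = 0 \<and> k_minus l \<le> k_q"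
    and dense: "dense_range p D (T l) \<longleftrightarrow> k_minus l \<le> k_q"
    and fredholm: "fredholm p D (T l) \<longleftrightarrow> k_zero l = 0" for l
  proof -
    define A A0 where "A = {#z \<in># proots q. z \<in> ball 0 1#}" and "A0 = {#z \<in># proots q. z \<in> sphere 0 1#}"
    define C C0 where "C = {#z \<in># proots (t l). z \<in> ball 0 1#}" and "C0 = {#z \<in># proots (t l). z \<in> sphere 0 1#}"
    obtain q1 where q1: "q = roots_poly (A + A0) * q1" "\<And>z. z \<in> cball 0 1 \<Longrightarrow> poly q1 z \<noteq> 0"
      using poly_split_roots[OF q, of "cball 0 1"] unfolding filter_cball_eq A_def A0_def by blast
    obtain t1 where t1: "t l = roots_poly (C + C0) * t1" "\<And>z. z \<in> cball 0 1 \<Longrightarrow> poly t1 z \<noteq> 0"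
      using poly_split_roots[OF t0, of l "cball 0 1"] unfolding filter_cball_eq C_def C0_def by blast
    have sub: "set_mset A \<subseteq> ball 0 1" "set_mset A0 \<subseteq> sphere 0 1" "set_mset C \<subseteq> ball 0 1" "set_mset C0 \<subseteq> sphere 0 1"
      by (auto simp: A_def A0_def C_def C0_def)
    have disj: "set_mset (A + A0) \<inter> set_mset (C + C0) = {}"
      using coprime_no_common_root[OF coprime_t[of l]] q t0[of l] by (auto simp: A_def A0_def C_def C0_def)
    have tl: "smult l (roots_poly (A + A0) * q1) - s = roots_poly (C + C0) * t1"
      unfolding q1(1)[symmetric] t1(1)[symmetric] t_def ..
    have k: "k_q = size (A + A0)" "k_minus l = size C" "k_zero l = size C0"
      unfolding k_q_def k_minus_def k_zero_def count_roots_def t_def[symmetric] filter_cball_eq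
      by (simp_all add: A_def A0_def C_def C0_def)
    have DT: "D = toeplitz_dom p (to_fract s / to_fract (roots_poly (A + A0) * q1))"
      "T l = resolvent_map l (toeplitz p (to_fract s / to_fract (roots_poly (A + A0) * q1)))"
      unfolding D_def T_def \<omega> Fract_conv_to_fract q1(1)[symmetric] by simp_all
    note * = p sub(1,2) q1(2) sub(3,4) t1(2) tl disj
    show "inj_on (T l) D \<longleftrightarrow> k_q \<le> k_minus l + k_zero l"
      unfolding DT k using resolvent_inj_iff[OF *] by simp
    show "T l ` D = Hp p \<longleftrightarrow> k_zero l = 0 \<and> k_minus l \<le> k_q"
      unfolding DT k using resolvent_surj_iff[OF *] by simp
    show "dense_range p D (T l) \<longleftrightarrow> k_minus l \<le> k_q"
      unfolding DT k using resolvent_dense_iff[OF *] by simp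
    show "fredholm p D (T l) \<longleftrightarrow> k_zero l = 0"
      unfolding DT k using resolvent_fredholm_iff[OF *] by simp
  qed
  have "resolvent_set p D (toeplitz p \<omega>) = {l. k_zero l = 0 \<and> k_q = k_minus l}"
    unfolding resolvent_set_def bij_betw_def T_def[symmetric] inj surj by auto
  moreover have "point_spectrum D (toeplitz p \<omega>) = {l. k_q > k_minus l + k_zero l}"
    unfolding point_spectrum_def T_def[symmetric] inj by auto
  \<comment> \<open>Failure of density, k_q < k_minus l, already implies injectivity.\<close>
  moreover have "residual_spectrum p D (toeplitz p \<omega>) = {l. k_q < k_minus l}"
    unfolding residual_spectrum_def T_def[symmetric] inj dense by auto
  \<comment> \<open>Given density, surjectivity can fail only through k_zero l > 0.\<close>
  moreover have "continuous_spectrum p D (toeplitz p \<omega>) =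
      {l. k_zero l > 0 \<and> k_minus l \<le> k_q \<and> k_q \<le> k_minus l + k_zero l}"
    unfolding continuous_spectrum_def T_def[symmetric] inj dense surj by auto
  moreover have "essential_spectrum p D (toeplitz p \<omega>) = rat_image_circle \<omega>"
    unfolding essential_spectrum_def T_def[symmetric] fredholm image by auto
  ultimately show ?thesis using counts image unfolding D_def by blast
qed

end
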